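(* Let $p_0$ be an odd prime, $p$ a power of $p_0$, $n \geq 1$ an integer with $p \equiv 1 \pmod n$, and $q = p^n$; write $q = p_0^{f_0}$. Let $e \geq 1$ and let $c_0, c_1, \ldots, c_{e-1} \in \mathbb{F}_p$ be such that the polynomial \[ g(x) = x^{2e} + c_{e-1}x^{2e-1} + \cdots + c_1 x^{e+1} + c_0 x^e + c_1 x^{e-1} + \cdots + c_{e-1}x + 1 \in \mathbb{F}_p[x] \] divides $x^n - 1$. Let \[ R(x) = 2x^{p^e} + 2c_{e-1}x^{p^{e-1}} + \cdots + 2c_1 x^p + c_0 x \in \mathbb{F}_p[x], \] and let $\overline{C}_R$ be the smooth projective compactification of the affine curve $y^p - y = xR(x)$ over $\mathbb{F}_q$. Then: (1) $\overline{C}_R$ is $\mathbb{F}_{q^2}$-maximal if $q \equiv 3 \pmod 4$, and $\mathbb{F}_{q^2}$-minimal if $q \equiv 1 \pmod 4$. (2)(i) If $n$ is even and $p_0 \equiv 1 \pmod 4$, then $\overline{C}_R$ is $\mathbb{F}_q$-minimal. (ii) If $n$ is even, $p_0 \equiv 3 \pmod 4$ and $f_0 \equiv 2 \pmod 4$, then $\overline{C}_R$ is $\mathbb{F}_q$-maximal; if $n$ is even, $p_0 \equiv 3 \pmod 4$ and $f_0 \equiv 0 \pmod 4$, then $\overline{C}_R$ is $\mathbb{F}_q$-minimal. (iii) If $n$ is odd, then $\overline{C}_R$ is neither $\mathbb{F}_q$-maximal nor $\mathbb{F}_q$-minimal.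
   Context: The curve $\overline{C}_R$ is a geometrically connected smooth projective curve over $\mathbb{F}_q$ of genus $g = p^e(p-1)/2$. For a power $Q$ of $q$, a geometrically connected smooth projective curve $C$ of genus $g$ defined over $\mathbb{F}_q$ is called $\mathbb{F}_Q$-maximal (resp. $\mathbb{F}_Q$-minimal) if $|C(\mathbb{F}_Q)| = Q + 1 + 2gQ^{1/2}$ (resp. $|C(\mathbb{F}_Q)| = Q + 1 - 2gQ^{1/2}$). *)

theory Defs
  imports
    "HOL-Computational_Algebra.Computational_Algebra"
    "HOL-Algebra.Algebraic_Closure_Type"
    "HOL-Number_Theory.Cong"
    "HOL-Library.Cardinality"
begin

text \<open>
  A (regular) projective curve \<open>C\<close> over a field \<open>k\<close> is represented by its function field \<open>F\<close>, realised
  as a subfield of an algebraic closure of the rational function field \<open>k(x)\<close>.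
\<close>

type_synonym 'k ambient = "'k poly fract alg_closure"

definition gen_x :: "'k::field ambient" where
  "gen_x = to_ac (to_fract [:0, 1:])"

definition const :: "'k::field \<Rightarrow> 'k ambient" where
  "const a = to_ac (to_fract [:a:])"

definition is_subfield :: "'a::field set \<Rightarrow> bool" where
  "is_subfield K \<longleftrightarrow> 0 \<in> K \<and> 1 \<in> K \<and>
     (\<forall>u\<in>K. \<forall>v\<in>K. u + v \<in> K \<and> u * v \<in> K) \<and> (\<forall>u\<in>K. - u \<in> K \<and> inverse u \<in> K)"

text \<open>
  The affine plane curve \<open>f(x, y) = 0\<close> is given by \<open>f\<close> in \<open>k[x][y]\<close>, irreducible over \<open>k(x)\<close>. The smooth
  projective compactification of this curve (when the curve is smooth) is the curve with function
  field \<open>k(x, \<eta>)\<close>, where \<open>\<eta>\<close> is a root of \<open>f\<close>; different roots give isomorphic fields over \<open>k(x)\<close>.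
\<close>

definition gen_y :: "'k::field poly poly \<Rightarrow> 'k ambient" where
  "gen_y f = (SOME \<eta>. poly (map_poly (\<lambda>h. to_ac (to_fract h)) f) \<eta> = 0)"

definition compactification :: "'k::field poly poly \<Rightarrow> 'k ambient set" where
  "compactification f = is_subfield hull (range const \<union> {gen_x, gen_y f})"

text \<open>
  The closed points of the curve are the valuation rings of \<open>F\<close> over \<open>k\<close> other than \<open>F\<close> itself
  (the local rings of the curve).
\<close>

definition closed_points :: "'k::field ambient set \<Rightarrow> 'k ambient set set" where
  "closed_points F = {V. V \<subset> F \<and> range const \<subseteq> V \<and>
     (\<forall>u\<in>V. \<forall>v\<in>V. u + v \<in> V \<and> u * v \<in> V) \<and> (\<forall>z\<in>F. z \<in> V \<or> inverse z \<in> V)}"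

text \<open>
  For a field \<open>L\<close> between \<open>k\<close> and its algebraic closure, an \<open>L\<close>-rational point, i.e. a \<open>k\<close>-morphism
  from \<open>Spec L\<close> to the curve, amounts to the local ring \<open>V\<close> of a closed point together with a
  \<open>k\<close>-algebra homomorphism from the residue field of \<open>V\<close> to \<open>L\<close>. It is encoded by the induced
  \<open>k\<close>-place \<open>\<pi>\<close> of \<open>F\<close>, a partial map with domain \<open>V\<close>; \<open>None\<close> on \<open>F\<close> is the value \<open>\<infinity>\<close>.
\<close>

definition rational_points :: "'k::field ambient set \<Rightarrow> 'k alg_closure set \<Rightarrow>
    ('k ambient \<Rightarrow> 'k alg_closure option) set" where
  "rational_points F L = {\<pi>. dom \<pi> \<subseteq> F \<and> ran \<pi> \<subseteq> L \<and>
     (\<forall>a. \<pi> (const a) = Some (to_ac a)) \<and>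
     (\<forall>u\<in>dom \<pi>. \<forall>v\<in>dom \<pi>. \<pi> (u + v) = Some (the (\<pi> u) + the (\<pi> v)) \<and>
                              \<pi> (u * v) = Some (the (\<pi> u) * the (\<pi> v))) \<and>
     (\<forall>z\<in>F - dom \<pi>. \<pi> (inverse z) = Some 0)}"

text \<open>
  The genus is the dimension over \<open>k\<close> of \<open>H\<^sup>1(C, \<O>)\<close>, which the resolution
  \<open>0 \<rightarrow> \<O> \<rightarrow> F \<rightarrow> \<Oplus>\<^sub>V F/V \<rightarrow> 0\<close> (with \<open>V\<close> ranging over the closed points) identifies with the cokernel
  of \<open>F \<rightarrow> \<Oplus>\<^sub>V F/V\<close>. Elements of the direct sum are represented by repartitions, and the
  dimension of the cokernel is expressed as the least size of a generating set.
\<close>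

definition repartitions :: "'k::field ambient set \<Rightarrow> ('k ambient set \<Rightarrow> 'k ambient) set" where
  "repartitions F = {r. (\<forall>V\<in>closed_points F. r V \<in> F) \<and> finite {V \<in> closed_points F. r V \<notin> V}}"

definition genus :: "'k::field ambient set \<Rightarrow> nat" where
  "genus F = (LEAST g. \<exists>B. finite B \<and> card B = g \<and> B \<subseteq> repartitions F \<and>
     (\<forall>r\<in>repartitions F. \<exists>a. \<exists>z\<in>F. \<forall>V\<in>closed_points F.
        r V - z - (\<Sum>b\<in>B. const (a b) * b V) \<in> V))"

text \<open>For a power \<open>Q\<close> of the order of a finite field \<open>k\<close>, the field of order \<open>Q\<close> containing \<open>k\<close>.\<close>

definition GF :: "nat \<Rightarrow> 'k::field alg_closure set" where
  "GF Q = {z. z ^ Q = z}"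

definition maximal_curve :: "nat \<Rightarrow> 'k::field ambient set \<Rightarrow> bool" where
  "maximal_curve Q F \<longleftrightarrow>
     real (card (rational_points F (GF Q))) = real Q + 1 + 2 * real (genus F) * sqrt (real Q)"

definition minimal_curve :: "nat \<Rightarrow> 'k::field ambient set \<Rightarrow> bool" where
  "minimal_curve Q F \<longleftrightarrow>
     real (card (rational_points F (GF Q))) = real Q + 1 - 2 * real (genus F) * sqrt (real Q)"

text \<open>The polynomial \<open>y\<^sup>p - y - x R(x)\<close> in \<open>k[x][y]\<close>.\<close>

definition artin_schreier_poly :: "nat \<Rightarrow> 'k::field poly \<Rightarrow> 'k poly poly" where
  "artin_schreier_poly p R = monom 1 p - monom 1 1 - [:[:0, 1:] * R:]"

definition g_poly :: "nat \<Rightarrow> (nat \<Rightarrow> 'k) \<Rightarrow> 'k::field poly" where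
  "g_poly e c = monom 1 (2 * e) + (\<Sum>i=1..<e. monom (c i) (e + i)) + monom (c 0) e
     + (\<Sum>i=1..<e. monom (c i) (e - i)) + 1"

definition R_poly :: "nat \<Rightarrow> nat \<Rightarrow> (nat \<Rightarrow> 'k) \<Rightarrow> 'k::field poly" where
  "R_poly p e c = monom 2 (p ^ e) + (\<Sum>i=1..<e. monom (2 * c i) (p ^ i)) + monom (c 0) 1"

end

theory Submission
  imports Defs
begin

text \<open>
  Counting. The roots of \<open>g\<close> are \<open>n\<close>-th roots of unity, hence lie in \<open>\<F>\<^sub>p\<close>, are simple, differ from \<open>\<plusminus>1\<close> and
  come in pairs \<open>\<zeta>, 1/\<zeta>\<close>. Choosing one root of each pair gives \<open>g = \<gamma> s s\<^sup>*\<close> with \<open>s\<^sup>*\<close> the reflection of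
  \<open>s\<close>. Letting polynomials act by \<open>x \<mapsto>\<close> Frobenius, \<open>tr(a R(a)) = \<gamma> tr((s\<^sup>* a)\<^sup>2)\<close>, so the number of affine
  points reduces to the number of zeros of the form \<open>tr(b\<^sup>2)\<close> on a finite field, which is found by
  elementary double counting.

  Function field. At a place where \<open>x\<close> has a pole, \<open>x\<^sup>i y\<^sup>j\<close> has order \<open>-(p i + N j)\<close> with \<open>N = p\<^sup>e + 1\<close>; as
  these orders are distinct for \<open>0 \<le> j < p\<close>, there is exactly one such place and it is rational. As
  \<open>y\<^sup>p - y\<close> has derivative \<open>-1\<close>, the minimal polynomial of \<open>a\<close> is a local parameter at each affine point
  \<open>(a, b)\<close>. This identifies the rational points. By strong approximation at the finite places,
  \<open>H\<^sup>1(\<O>)\<close> is spanned by the monomials \<open>x\<^sup>i y\<^sup>j\<close> with \<open>i < 0 \<le> j < p\<close> and \<open>p i + N j > 0\<close>; they are independent,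
  and there are \<open>p\<^sup>e (p - 1) / 2\<close> of them.
\<close>

section \<open>Additive polynomials and traces over finite fields\<close>

text \<open>All assertions come from one count over the field of order p^m, with m = 2n or m = n.
  For m = 2k and r = p^k, the number of zeros of tr(b^2) differs from p^(m-1) by r - r/p up to sign,
  and the sign is plus exactly when r is 3 mod 4, because then -1 is a 2(r-1)-th power in that
  field. The kernel of the operator given by the reflected factor and the p points above each zero
  multiply this deviation to p^(e+1) (r - r/p) = p^e (p-1) r, which is 2g sqrt(p^m) on the nose. So
  the class mod 4 of r = q decides over the field of order q^2, and that of r = p0^(f0/2) over the
  field of order q with n even. For odd m the deviation vanishes while g > 0. The curve equation is
  not known to be irreducible beforehand: this follows from pole orders at a place of the whole
  ambient field, which Chevalley's theorem supplies. The genus is a least number of generators; as k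
  is finite, its lower bound is a pigeonhole argument on coefficient vectors.\<close>

lemma pderiv_sum: "pderiv (sum f A) = (\<Sum>x\<in>A. pderiv (f x))"
  by (induction A rule: infinite_finite_induct) (auto simp: pderiv_add)

text \<open>If \<open>P = (x - a) Q\<close> then \<open>P'(a) = Q(a)\<close>, so separability makes
  every root split off exactly once; induct on the degree.\<close>

lemma card_roots_separable:
  fixes P :: "'a::alg_closed_field poly"
  assumes "\<And>a. poly P a = 0 \<Longrightarrow> poly (pderiv P) a \<noteq> 0"
  shows "finite {x. poly P x = 0} \<and> card {x. poly P x = 0} = degree P"
  using assms
proof (induction "degree P" arbitrary: P)
  case 0
  then obtain c where "P = [:c:]" by (metis degree_eq_zeroE)
  with 0 show ?case by auto
next
  case (Suc n)
  then obtain a where a: "poly P a = 0"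
    using alg_closed_imp_poly_has_root[of P] by auto
  then obtain Q where Q: "P = [:-a, 1:] * Q"
    by (metis dvdE poly_eq_0_iff_dvd)
  with Suc have Q0: "Q \<noteq> 0" by auto
  have dP: "pderiv P = Q + [:-a, 1:] * pderiv Q"
    unfolding Q by (subst pderiv_mult) (simp add: pderiv_pCons add.commute)
  have deg: "degree P = Suc (degree Q)"
    unfolding Q by (subst degree_mult_eq) (use Q0 in auto)
  have qa: "poly Q a \<noteq> 0"
    using Suc.prems[OF a] dP by simp
  have sep: "poly (pderiv Q) b \<noteq> 0" if "poly Q b = 0" for b
    using Suc.prems[of b] that dP Q by auto
  have IH: "finite {x. poly Q x = 0} \<and> card {x. poly Q x = 0} = degree Q"
    using Suc.hyps(1)[of Q] Suc.hyps(2) deg sep by auto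
  have "{x. poly P x = 0} = insert a {x. poly Q x = 0}"
    unfolding Q by auto
  with IH qa deg show ?case by simp
qed

lemma finite_roots_separable:
  fixes P :: "'a::alg_closed_field poly"
  assumes "\<And>a. poly P a = 0 \<Longrightarrow> poly (pderiv P) a \<noteq> 0"
  shows "finite {x. poly P x = 0}" "card {x. poly P x = 0} = degree P"
  using card_roots_separable[of P] assms by auto

lemma card_power_eq:
  fixes w :: "'a::alg_closed_field"
  assumes "w \<noteq> 0" "of_nat N \<noteq> (0::'a)"
  shows "finite {z. z ^ N = w}" "card {z. z ^ N = w} = N"
proof -
  define P where "P = monom 1 N - [:w:]"
  have N: "N > 0" using assms by (intro Nat.gr0I) auto
  have P: "poly P z = z ^ N - w" for z by (simp add: P_def poly_monom)
  have deg: "degree P = N"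
    unfolding P_def diff_conv_add_uminus
    by (subst degree_add_eq_left) (use N in \<open>auto simp: degree_monom_eq\<close>)
  have d: "pderiv P = monom (of_nat N) (N - 1)"
    by (simp add: P_def pderiv_diff pderiv_monom pderiv_pCons)
  have sep: "poly (pderiv P) a \<noteq> 0" if "poly P a = 0" for a
  proof -
    have "a \<noteq> 0" using that assms N by (auto simp: P power_0_left)
    thus ?thesis using assms by (simp add: d poly_monom)
  qed
  have eq: "{z. poly P z = 0} = {z. z ^ N = w}" by (simp add: P)
  show "finite {z. z ^ N = w}" "card {z. z ^ N = w} = N"
    using finite_roots_separable[of P, OF sep] eq deg by auto
qed

lemma card_eq_sum_fibres:
  assumes "finite A" "finite B" "\<And>x. x \<in> A \<Longrightarrow> f x \<in> B" "\<And>y. y \<in> B \<Longrightarrow> card {x\<in>A. f x = y} = k"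
  shows "card A = card B * k"
proof -
  have "card A = (\<Sum>y\<in>B. card {x\<in>A. f x = y})"
    using sum.group[of A B f "\<lambda>_. 1::nat"] assms by (auto simp: image_subset_iff)
  thus ?thesis using assms by simp
qed

text \<open>Instantiated twice: at the algebraic closure of \<open>k\<close> for counting points,
  and at the ambient field of functions, where exponents \<open>p ^ s\<close> serve the
  approximation at finite places.\<close>

locale frobenius_power =
  fixes \<phi> :: "'a::alg_closed_field \<Rightarrow> 'a" and p :: nat
  assumes phi: "\<phi> x = x ^ p"
    and phi_add: "\<phi> (x + y) = \<phi> x + \<phi> y"
    and p_gt_1: "1 < p" and p_zero: "of_nat p = (0::'a)"
begin

lemma add_pow: "(x + y :: 'a) ^ p = x ^ p + y ^ p"
  using phi_add phi by simp

lemma zero_pow_p_pow [simp]: "(0::'a) ^ (p ^ i) = 0"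
  using p_gt_1 by (simp add: power_0_left)

lemma add_pow_p_pow: "(x + y :: 'a) ^ (p ^ i) = x ^ (p ^ i) + y ^ (p ^ i)"
  by (induction i) (simp_all add: power_mult add_pow mult.commute[of p])

lemma minus_pow_p_pow: "(- x :: 'a) ^ (p ^ i) = - (x ^ (p ^ i))"
proof -
  have "(x + - x) ^ (p ^ i) = x ^ (p ^ i) + (- x) ^ (p ^ i)"
    by (rule add_pow_p_pow)
  thus ?thesis by (simp add: eq_neg_iff_add_eq_0 add.commute)
qed

lemma diff_pow_p_pow: "(x - y :: 'a) ^ (p ^ i) = x ^ (p ^ i) - y ^ (p ^ i)"
  using add_pow_p_pow[of x "-y" i] by (simp add: minus_pow_p_pow)

lemma sum_pow_p_pow: "(\<Sum>j\<in>A. f j :: 'a) ^ (p ^ i) = (\<Sum>j\<in>A. f j ^ (p ^ i))"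
  by (induction A rule: infinite_finite_induct) (simp_all add: add_pow_p_pow)

lemmas minus_pow = minus_pow_p_pow[where i = 1, simplified]
lemmas sum_pow = sum_pow_p_pow[where i = 1, simplified]

text \<open>\<open>p\<close> may be a proper prime power, so \<open>fld (Suc 0)\<close>, the field
  of order \<open>p\<close>, takes the part of the prime field throughout; \<open>tr m\<close> is
  the trace from \<open>fld m\<close> down to it.\<close>

definition fld :: "nat \<Rightarrow> 'a set" where "fld m = {z. z ^ (p ^ m) = z}"

definition tr :: "nat \<Rightarrow> 'a \<Rightarrow> 'a" where "tr m z = (\<Sum>i<m. z ^ (p ^ i))"

lemma fld_1: "z \<in> fld (Suc 0) \<longleftrightarrow> z ^ p = z"
  by (simp add: fld_def)

lemma fld_pow_iff: "z \<in> fld (Suc 0) \<Longrightarrow> z ^ (p ^ i) = z"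
  by (induction i) (simp_all add: fld_1 power_mult mult.commute[of p])

lemma fld_1_subset: "z \<in> fld (Suc 0) \<Longrightarrow> z \<in> fld m"
  using fld_pow_iff by (simp add: fld_def)

lemma fld_add: "x \<in> fld m \<Longrightarrow> y \<in> fld m \<Longrightarrow> x + y \<in> fld m"
  by (simp add: fld_def add_pow_p_pow)
lemma fld_minus: "x \<in> fld m \<Longrightarrow> - x \<in> fld m"
  by (simp add: fld_def minus_pow_p_pow)
lemma fld_diff: "x \<in> fld m \<Longrightarrow> y \<in> fld m \<Longrightarrow> x - y \<in> fld m"
  by (simp add: fld_def diff_pow_p_pow)
lemma fld_mult: "x \<in> fld m \<Longrightarrow> y \<in> fld m \<Longrightarrow> x * y \<in> fld m"
  by (simp add: fld_def power_mult_distrib)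
lemma fld_divide: "x \<in> fld m \<Longrightarrow> y \<in> fld m \<Longrightarrow> x / y \<in> fld m"
  by (simp add: fld_def power_divide)
lemma fld_0: "0 \<in> fld m"
  by (simp add: fld_def)
lemma fld_one: "1 \<in> fld m"
  by (simp add: fld_def)
lemma fld_power: "x \<in> fld m \<Longrightarrow> x ^ j \<in> fld m"
  by (simp add: fld_def flip: power_mult) (simp add: power_mult mult.commute[of j])
lemma fld_sum: "(\<And>i. i \<in> A \<Longrightarrow> f i \<in> fld m) \<Longrightarrow> sum f A \<in> fld m"
  by (simp add: fld_def sum_pow_p_pow)

text \<open>The polynomial \<open>s\<close> acts as \<open>s(\<phi>)\<close>, where \<open>\<phi>\<close> is the Frobenius map.\<close>

definition twist :: "'a poly \<Rightarrow> 'a \<Rightarrow> 'a" where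
  "twist s z = (\<Sum>i\<le>degree s. coeff s i * z ^ (p ^ i))"

lemma twist_bound:
  assumes "degree s \<le> d"
  shows "twist s z = (\<Sum>i\<le>d. coeff s i * z ^ (p ^ i))"
  unfolding twist_def using assms
  by (intro sum.mono_neutral_left) (auto simp: coeff_eq_0)

lemma twist_pCons: "twist (pCons a s) z = a * z + twist s (z ^ p)"
proof -
  have "twist (pCons a s) z = (\<Sum>i\<le>Suc (degree s). coeff (pCons a s) i * z ^ (p ^ i))"
    by (rule twist_bound) (simp add: degree_pCons_le)
  also have "\<dots> = a * z + (\<Sum>i\<le>degree s. coeff s i * (z ^ p) ^ (p ^ i))"
    by (subst sum.atMost_Suc_shift) (simp add: power_mult)
  finally show ?thesis by (simp add: twist_def)
qed

lemma twist_0 [simp]: "twist 0 z = 0"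
  by (simp add: twist_def)

lemma twist_poly_add: "twist (s + t) z = twist s z + twist t z"
proof (induction s t arbitrary: z rule: poly_induct2)
  case (pCons a s b t)
  then show ?case by (simp add: twist_pCons algebra_simps)
qed auto

lemma twist_smult: "twist (smult a s) z = a * twist s z"
  by (induction s arbitrary: z) (auto simp: twist_pCons algebra_simps)

lemma twist_poly_minus: "twist (- s) z = - twist s z"
  using twist_smult[of "-1" s z] by simp

lemma twist_poly_diff: "twist (s - t) z = twist s z - twist t z"
  using twist_poly_add[of s "-t"] by (simp add: twist_poly_minus)

lemma twist_1 [simp]: "twist 1 z = z"
  by (simp add: twist_def)

lemma twist_poly_sum: "twist (\<Sum>i\<in>A. f i) z = (\<Sum>i\<in>A. twist (f i) z)"
  by (induction A rule: infinite_finite_induct) (auto simp: twist_poly_add)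

lemma twist_monom: "twist (monom a i) z = a * z ^ (p ^ i)"
proof (induction i arbitrary: z)
  case (Suc i)
  then show ?case by (simp add: monom_Suc twist_pCons power_mult)
qed (simp add: twist_def monom_0)

lemma twist_add: "twist s (y + z) = twist s y + twist s z"
  by (simp add: twist_def add_pow_p_pow algebra_simps sum.distrib)

lemma twist_zero [simp]: "twist s 0 = 0"
  by (simp add: twist_def)

lemma twist_diff: "twist s (y - z) = twist s y - twist s z"
  by (simp add: twist_def diff_pow_p_pow algebra_simps sum_subtractf)

text \<open>Twists of such polynomials commute with the \<open>p\<close>-th power map, so products
  of polynomials become compositions of operators (\<open>twist_mult\<close>).\<close>

definition over_prime :: "'a poly \<Rightarrow> bool" where
  "over_prime s \<longleftrightarrow> (\<forall>i. coeff s i \<in> fld (Suc 0))"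

lemma over_prime_pCons: "over_prime (pCons a s) \<longleftrightarrow> a \<in> fld (Suc 0) \<and> over_prime s"
  unfolding over_prime_def by (metis coeff_pCons_0 coeff_pCons_Suc nat.exhaust)

lemma over_prime_mult: "over_prime s \<Longrightarrow> over_prime t \<Longrightarrow> over_prime (s * t)"
  unfolding over_prime_def coeff_mult by (auto intro!: fld_sum fld_mult)

lemma over_prime_reflect: "over_prime s \<Longrightarrow> over_prime (reflect_poly s)"
  unfolding over_prime_def by (auto simp: coeff_reflect_poly fld_0)

lemma twist_frob: "over_prime s \<Longrightarrow> twist s (z ^ (p ^ i)) = twist s z ^ (p ^ i)"
  unfolding twist_def over_prime_def
  by (simp add: sum_pow_p_pow power_mult_distrib fld_pow_iff flip: power_mult)
    (simp add: mult.commute)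

lemma twist_mult:
  assumes "over_prime t"
  shows "twist (s * t) z = twist s (twist t z)"
proof (induction s arbitrary: z)
  case (pCons a s)
  have "twist t (z ^ p) = twist t z ^ p"
    using twist_frob[OF assms, of z 1] by simp
  thus ?case by (simp add: twist_poly_add twist_smult twist_pCons pCons.IH)
qed simp

lemma twist_scale: "c \<in> fld (Suc 0) \<Longrightarrow> twist s (c * z) = c * twist s z"
  by (simp add: twist_def power_mult_distrib fld_pow_iff sum_distrib_left mult_ac)

lemma twist_mem: "over_prime s \<Longrightarrow> z \<in> fld m \<Longrightarrow> twist s z \<in> fld m"
  unfolding twist_def over_prime_def
  by (intro fld_sum fld_mult fld_power) (auto intro: fld_1_subset)

text \<open>As a polynomial in \<open>z\<close>, \<open>twist s z - w\<close> has only the exponents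
  \<open>p ^ i\<close> besides 0, so its derivative is the constant \<open>coeff s 0\<close>: all
  roots are simple and their number is the degree.\<close>

lemma card_twist_fibre:
  assumes "coeff s 0 \<noteq> 0"
  shows "finite {z. twist s z = w}" "card {z. twist s z = w} = p ^ degree s"
proof -
  define P where "P = (\<Sum>i\<le>degree s. monom (coeff s i) (p ^ i)) - [:w:]"
  have s0: "s \<noteq> 0" using assms by auto
  have P: "poly P z = twist s z - w" for z
    by (simp add: P_def twist_def poly_sum poly_monom)
  have "coeff (\<Sum>i\<le>degree s. monom (coeff s i) (p ^ i)) j =
      (\<Sum>i\<le>degree s. if p ^ i = j then coeff s i else 0)" for j
    by (simp add: coeff_sum)
  hence co: "coeff P j = (\<Sum>i\<le>degree s. if p ^ i = j then coeff s i else 0) - (if j = 0 then w else 0)" for j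
    by (auto simp: P_def coeff_pCons split: nat.splits)
  have deg: "degree P = p ^ degree s"
  proof (rule antisym)
    show "degree P \<le> p ^ degree s"
    proof (rule degree_le, intro allI impI)
      fix j assume j: "p ^ degree s < j"
      have "p ^ i \<noteq> j" if "i \<le> degree s" for i
        using power_increasing[OF that, of p] j p_gt_1 by auto
      thus "coeff P j = 0" using j unfolding co by (auto intro!: sum.neutral)
    qed
    have "coeff P (p ^ degree s) = (\<Sum>i\<le>degree s. if i = degree s then coeff s i else 0)"
      unfolding co using p_gt_1 by (auto intro!: sum.cong simp: power_inject_exp)
    also have "\<dots> = lead_coeff s" by simp
    finally show "p ^ degree s \<le> degree P" using s0 by (intro le_degree) auto
  qed
  have "pderiv P = (\<Sum>i\<le>degree s. pderiv (monom (coeff s i) (p ^ i)))"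
    by (simp add: P_def pderiv_diff pderiv_sum pderiv_pCons)
  also have "\<dots> = (\<Sum>i\<le>degree s. if i = 0 then [:coeff s 0:] else 0)"
    using p_zero by (intro sum.cong) (auto simp: pderiv_monom monom_0)
  also have "\<dots> = [:coeff s 0:]" by simp
  finally have d: "pderiv P = [:coeff s 0:]" .
  have eq: "{z. poly P z = 0} = {z. twist s z = w}" by (simp add: P)
  show "finite {z. twist s z = w}" "card {z. twist s z = w} = p ^ degree s"
    using finite_roots_separable[of P] d assms eq deg by auto
qed

lemma twist_surj: "coeff s 0 \<noteq> 0 \<Longrightarrow> \<exists>z. twist s z = w"
proof -
  assume "coeff s 0 \<noteq> 0"
  from card_twist_fibre[OF this, of w] have "card {z. twist s z = w} > 0" using p_gt_1 by simp
  thus ?thesis by (metis (mono_tags, lifting) card_gt_0_iff empty_Collect_eq)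
qed

text \<open>The operator of \<open>x ^ m - 1\<close> has kernel \<open>fld m\<close>, so
  factorisations of \<open>cyc m\<close> describe kernels and images inside
  \<open>fld m\<close>.\<close>

definition cyc :: "nat \<Rightarrow> 'a poly" where "cyc m = monom 1 m - 1"

lemma twist_cyc: "twist (cyc m) z = z ^ (p ^ m) - z"
  by (simp add: cyc_def twist_poly_diff twist_monom)

lemma fld_cyc: "z \<in> fld m \<longleftrightarrow> twist (cyc m) z = 0"
  by (simp add: fld_def twist_cyc)

lemma degree_cyc: "m > 0 \<Longrightarrow> degree (cyc m) = m"
  using degree_add_eq_left[of "-1" "monom (1::'a) m"] by (simp add: cyc_def degree_monom_eq)

lemma coeff_cyc_0: "m > 0 \<Longrightarrow> coeff (cyc m) 0 = -1"
  by (simp add: cyc_def)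

lemma card_fld: assumes "m > 0" shows "finite (fld m)" "card (fld m) = p ^ m"
proof -
  have "fld m = {z. twist (cyc m) z = 0}" using fld_cyc by auto
  thus "finite (fld m)" "card (fld m) = p ^ m"
    using card_twist_fibre[of "cyc m" 0] assms by (auto simp: degree_cyc coeff_cyc_0)
qed

lemma over_prime_cyc: "over_prime (cyc m)"
  unfolding over_prime_def cyc_def
  using p_gt_1 by (auto simp: coeff_1 fld_0 fld_one minus_pow fld_1)

lemma tr_add: "tr m (x + y) = tr m x + tr m y"
  by (simp add: tr_def add_pow_p_pow sum.distrib)
lemma tr_0 [simp]: "tr m 0 = 0"
  by (simp add: tr_def)
lemma tr_scale: "c \<in> fld (Suc 0) \<Longrightarrow> tr m (c * z) = c * tr m z"
  by (simp add: tr_def power_mult_distrib fld_pow_iff sum_distrib_left)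
lemma tr_sum: "tr m (\<Sum>i\<in>A. f i) = (\<Sum>i\<in>A. tr m (f i))"
  by (induction A rule: infinite_finite_induct) (auto simp: tr_add)

lemma tr_pow: "tr m z ^ p = tr m z + (z ^ (p ^ m) - z)"
proof -
  have "tr m z ^ p = (\<Sum>i<m. z ^ (p ^ Suc i))"
    by (simp add: tr_def sum_pow flip: power_mult) (simp add: mult.commute)
  also have "\<dots> + z = (\<Sum>i<Suc m. z ^ (p ^ i))"
    by (subst sum.lessThan_Suc_shift) simp
  also have "\<dots> = tr m z + z ^ (p ^ m)" by (simp add: tr_def)
  finally show ?thesis by (simp add: algebra_simps)
qed

lemma tr_mem: "z \<in> fld m \<Longrightarrow> tr m z \<in> fld (Suc 0)"
  by (simp add: fld_1 tr_pow) (simp add: fld_def)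

lemma tr_frob_eq: "tr m (z ^ p) = tr m z ^ p"
  by (simp add: tr_def sum_pow flip: power_mult) (simp add: mult.commute)

lemma tr_frob: "z \<in> fld m \<Longrightarrow> tr m (z ^ (p ^ i)) = tr m z"
proof (induction i)
  case (Suc i)
  have "tr m (z ^ (p ^ Suc i)) = tr m (z ^ (p ^ i)) ^ p"
    by (metis tr_frob_eq power_Suc power_mult mult.commute)
  with Suc tr_mem[OF Suc.prems] show ?case by (simp add: fld_1)
qed simp

text \<open>The trace is the twist of \<open>1 + x + ... + x ^ (m - 1)\<close>, whose constant
  coefficient is 1, and by \<open>tr_pow\<close> every preimage of an element of
  \<open>fld (Suc 0)\<close> already lies in \<open>fld m\<close>.\<close>

lemma card_tr_fibre:
  assumes "m > 0" "w \<in> fld (Suc 0)"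
  shows "card {z\<in>fld m. tr m z = w} = p ^ (m - 1)"
proof -
  define s where "s = (\<Sum>i<m. monom (1::'a) i)"
  have tw: "twist s z = tr m z" for z
    by (simp add: s_def twist_poly_sum twist_monom tr_def)
  have co: "coeff s j = (if j < m then 1 else 0)" for j
    by (simp add: s_def coeff_sum)
  have deg: "degree s = m - 1"
    by (rule antisym) (use assms in \<open>auto intro!: degree_le le_degree simp: co\<close>)
  have "{z\<in>fld m. tr m z = w} = {z. twist s z = w}"
  proof -
    have "z \<in> fld m" if "tr m z = w" for z
      using tr_pow[of m z] that assms(2) by (simp add: fld_1 fld_def)
    thus ?thesis by (auto simp: tw)
  qed
  thus ?thesis using card_twist_fibre[of s w] assms by (simp add: co deg)
qed

text \<open>Additive Hilbert 90: \<open>tr m (b ^ p - b)\<close> telescopes to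
  \<open>b ^ (p ^ m) - b\<close>, so a solution \<open>b\<close> lies in \<open>fld m\<close>
  exactly when the right-hand side has trace zero.\<close>

lemma card_artin_schreier:
  assumes "m > 0" "t \<in> fld m"
  shows "card {b\<in>fld m. b ^ p - b = t} = (if tr m t = 0 then p else 0)"
proof -
  have eq: "tr m (b ^ p - b) = b ^ (p ^ m) - b" for b
    using tr_add[of m "b ^ p - b" b] by (simp add: tr_frob_eq tr_pow algebra_simps)
  have "{b\<in>fld m. b ^ p - b = t} = (if tr m t = 0 then {b. twist (cyc 1) b = t} else {})"
    by (auto simp: eq[symmetric] fld_def twist_cyc) (simp_all add: eq)
  thus ?thesis using card_twist_fibre[of "cyc 1" t] by (simp add: coeff_cyc_0 degree_cyc)
qed

text \<open>\<open>twist f\<close> maps onto the whole closed field, and a preimage of a point in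
  the kernel of \<open>twist h\<close> is killed by \<open>twist (h * f)\<close>, hence lies in
  \<open>fld m\<close>.\<close>

lemma twist_image_fld:
  assumes "m > 0" and cyc: "cyc m = f * h" and "over_prime f" "over_prime h"
  shows "twist f ` fld m = {y. twist h y = 0}"
proof
  show "twist f ` fld m \<subseteq> {y. twist h y = 0}"
    using assms by (auto simp: fld_cyc mult.commute[of f] twist_mult)
  have "coeff f 0 * coeff h 0 = -1"
    using coeff_cyc_0[OF assms(1)] by (simp add: cyc coeff_mult_0)
  hence f0: "coeff f 0 \<noteq> 0" by auto
  show "{y. twist h y = 0} \<subseteq> twist f ` fld m"
  proof
    fix y assume y: "y \<in> {y. twist h y = 0}"
    obtain z where "twist f z = y" using twist_surj[OF f0] by blast
    with y assms show "y \<in> twist f ` fld m"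
      by (auto simp: fld_cyc mult.commute[of f] twist_mult intro!: image_eqI[of _ _ z])
  qed
qed

text \<open>For the trace form, the adjoint of the \<open>p ^ i\<close>-th power map is its inverse.
  The factor \<open>z ^ (p ^ degree f)\<close> shifts these inverses to nonnegative powers and
  thereby turns \<open>f\<close> into its reflection.\<close>

lemma tr_adjoint:
  assumes "over_prime f" "z \<in> fld m" "y \<in> fld m"
  shows "tr m (z ^ (p ^ degree f) * twist f y) = tr m (twist (reflect_poly f) z * y)"
proof -
  let ?d = "degree f"
  have c: "coeff f i \<in> fld (Suc 0)" for i using assms by (auto simp: over_prime_def)
  have "tr m (z ^ (p ^ ?d) * twist f y) = (\<Sum>i\<le>?d. coeff f i * tr m (z ^ (p ^ ?d) * y ^ (p ^ i)))"
    by (simp add: twist_def sum_distrib_left tr_sum mult.left_commute[of _ "coeff f _"] tr_scale[OF c])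
  also have "\<dots> = (\<Sum>i\<le>?d. coeff f i * tr m (z ^ (p ^ (?d - i)) * y))"
  proof (intro sum.cong refl)
    fix i assume i: "i \<in> {..?d}"
    have "z ^ (p ^ ?d) * y ^ (p ^ i) = (z ^ (p ^ (?d - i)) * y) ^ (p ^ i)"
      using i by (simp add: power_mult_distrib flip: power_mult power_add)
    thus "coeff f i * tr m (z ^ (p ^ ?d) * y ^ (p ^ i)) = coeff f i * tr m (z ^ (p ^ (?d - i)) * y)"
      using assms by (simp add: tr_frob fld_mult fld_power)
  qed
  also have "\<dots> = (\<Sum>i\<le>?d. coeff f (?d - i) * tr m (z ^ (p ^ i) * y))"
    by (rule sum.reindex_bij_witness[of _ "\<lambda>i. ?d - i" "\<lambda>i. ?d - i"]) auto
  also have "\<dots> = tr m (twist (reflect_poly f) z * y)"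
    by (simp add: twist_bound[OF degree_reflect_poly_le] coeff_reflect_poly sum_distrib_right tr_sum
        mult.assoc tr_scale[OF c] cong: sum.cong)
      (auto intro!: sum.cong simp: tr_scale[OF c])
  finally show ?thesis .
qed

lemma tr_nondegenerate:
  assumes "m > 0" "z \<in> fld m" "\<And>y. y \<in> fld m \<Longrightarrow> tr m (z * y) = 0"
  shows "z = 0"
proof (rule ccontr)
  assume z: "z \<noteq> 0"
  have "tr m w = 0" if "w \<in> fld m" for w
    using assms(3)[of "w / z"] z that assms(2) by (simp add: fld_divide)
  hence "{w\<in>fld m. tr m w = 0} = fld m" by auto
  hence "p ^ m = p ^ (m - 1)"
    using card_tr_fibre[OF assms(1) fld_0] card_fld(2)[OF assms(1)] by simp
  thus False using assms(1) p_gt_1 by (simp add: power_inject_exp)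
qed

section \<open>The quadratic form attached to the curve\<close>

text \<open>Adding a suitable multiple of \<open>u0\<close> carries any fibre of \<open>f\<close>
  bijectively onto any other, so all \<open>p\<close> fibres have the same size.\<close>

lemma card_fibre_linear:
  assumes "finite U" and add: "\<And>u v. u \<in> U \<Longrightarrow> v \<in> U \<Longrightarrow> u + v \<in> U"
    and scale: "\<And>c u. c \<in> fld (Suc 0) \<Longrightarrow> u \<in> U \<Longrightarrow> c * u \<in> U"
    and f_add: "\<And>u v. u \<in> U \<Longrightarrow> v \<in> U \<Longrightarrow> f (u + v) = f u + f v"
    and f_scale: "\<And>c u. c \<in> fld (Suc 0) \<Longrightarrow> u \<in> U \<Longrightarrow> f (c * u) = c * f u"
    and f_mem: "\<And>u. u \<in> U \<Longrightarrow> f u \<in> fld (Suc 0)"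
    and u0: "u0 \<in> U" "f u0 \<noteq> 0" and w: "w \<in> fld (Suc 0)"
  shows "p * card {u\<in>U. f u = w} = card U"
proof -
  have fib: "card {u\<in>U. f u = v} = card {u\<in>U. f u = w}" if v: "v \<in> fld (Suc 0)" for v
  proof (rule bij_betw_same_card)
    define d where "d = ((w - v) / f u0) * u0"
    define d' where "d' = ((v - w) / f u0) * u0"
    have c: "(w - v) / f u0 \<in> fld (Suc 0)" "(v - w) / f u0 \<in> fld (Suc 0)"
      using u0 v w f_mem by (auto intro: fld_divide fld_diff)
    have d: "d \<in> U" "f d = w - v"
      using u0 scale[OF c(1) u0(1)] f_scale[OF c(1) u0(1)] unfolding d_def by simp_all
    have d': "d' \<in> U" "f d' = v - w"
      using u0 scale[OF c(2) u0(1)] f_scale[OF c(2) u0(1)] unfolding d'_def by simp_all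
    have e: "d' = - d" using u0 by (simp add: d_def d'_def field_simps)
    show "bij_betw (\<lambda>u. u + d) {u\<in>U. f u = v} {u\<in>U. f u = w}"
    proof (rule bij_betw_byWitness[of _ "\<lambda>u. u + d'"])
      show "(\<lambda>u. u + d) ` {u\<in>U. f u = v} \<subseteq> {u\<in>U. f u = w}"
        using add[OF _ d(1)] f_add[OF _ d(1)] d(2) by auto
      show "(\<lambda>u. u + d') ` {u\<in>U. f u = w} \<subseteq> {u\<in>U. f u = v}"
        using add[OF _ d'(1)] f_add[OF _ d'(1)] d'(2) by auto
    qed (simp_all add: e)
  qed
  have "card U = card (fld (Suc 0)) * card {u\<in>U. f u = w}"
  proof (rule card_eq_sum_fibres[where f = f])
    show "finite U" "finite (fld (Suc 0))" using assms(1) card_fld by auto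
    show "card {x\<in>U. f x = y} = card {u\<in>U. f u = w}" if "y \<in> fld (Suc 0)" for y
      by (rule fib[OF that])
  qed (rule f_mem)
  thus ?thesis using card_fld(2)[of "Suc 0"] by simp
qed

text \<open>
  Write \<open>g = \<gamma> s s\<^sup>*\<close> with \<open>s\<^sup>*\<close> the reflection of \<open>s\<close>. By adjunction the quadratic form attached to \<open>g\<close>
  is \<open>\<gamma> tr((s\<^sup>*(\<phi>) z)\<^sup>2)\<close>. The image \<open>I\<close> of \<open>s\<^sup>*(\<phi>)\<close> contains its orthogonal complement, the kernel of
  \<open>s(\<phi>)\<close>, translations by which equidistribute \<open>tr(y\<^sup>2)\<close> outside \<open>I\<close>.
\<close>

lemma card_trace_square_twist:
  assumes m: "m > 0" and two: "(2::'a) \<noteq> 0"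
    and s: "over_prime s" "coeff s 0 \<noteq> 0" and v: "over_prime v" and cyc: "cyc m = s * reflect_poly s * v"
  shows "int (p * card {z\<in>fld m. tr m (twist (reflect_poly s) z ^ 2) = 0})
    = p ^ m + p ^ (degree s + 1) * (int (card {b\<in>fld m. tr m (b ^ 2) = 0}) - p ^ (m - 1))"
proof -
  define \<sigma> where "\<sigma> = reflect_poly s"
  define e where "e = degree s"
  define I where "I = twist \<sigma> ` fld m"
  define U where "U = {u. twist s u = 0}"
  define ZI where "ZI = {y\<in>I. tr m (y ^ 2) = 0}"
  define T where "T = {b\<in>fld m - I. tr m (b ^ 2) = 0}"
  have \<sigma>: "over_prime \<sigma>" "coeff \<sigma> 0 \<noteq> 0" "degree \<sigma> = e" "reflect_poly \<sigma> = s"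
    using s by (auto simp: \<sigma>_def over_prime_reflect e_def)
  have cyc': "cyc m = \<sigma> * (s * v)" "cyc m = s * (\<sigma> * v)" "cyc m = (\<sigma> * v) * s"
    using cyc by (simp_all add: \<sigma>_def mult_ac)
  have sv: "over_prime (s * v)" "over_prime (\<sigma> * v)"
    using s v \<sigma> by (auto intro: over_prime_mult)
  have fin: "finite (fld m)" using card_fld m by auto
  have cyc_nz: "cyc m \<noteq> 0" using coeff_cyc_0[OF m] by auto
  hence nz: "s \<noteq> 0" "\<sigma> \<noteq> 0" "v \<noteq> 0" using cyc' by auto
  have "coeff s 0 * coeff \<sigma> 0 * coeff v 0 = -1"
    using coeff_cyc_0[OF m] by (simp add: cyc'(2) coeff_mult_0 mult_ac)
  hence v0: "coeff v 0 \<noteq> 0" by auto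
  have "degree (cyc m) = e + (e + degree v)"
    unfolding cyc'(2) using nz \<sigma> by (simp add: degree_mult_eq e_def)
  hence mdeg: "m = e + (e + degree v)" using m by (simp add: degree_cyc)
  have I: "I = {y. twist (s * v) y = 0}"
    unfolding I_def using twist_image_fld[OF m cyc'(1)] \<sigma> sv by auto
  have I_sub: "I \<subseteq> fld m" unfolding I_def using twist_mem \<sigma> by auto
  have "card {y. twist (s * v) y = 0} = p ^ degree (s * v)"
    by (rule card_twist_fibre) (use s v0 in \<open>simp add: coeff_mult_0\<close>)
  also have "degree (s * v) = m - e" using nz mdeg by (simp add: degree_mult_eq e_def)
  finally have cardI: "card I = p ^ (m - e)" by (simp add: I)
  have cardU: "card U = p ^ e" and finU: "finite U"
    unfolding U_def using card_twist_fibre s by (auto simp: e_def)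
  have U: "U = twist (\<sigma> * v) ` fld m"
    unfolding U_def using twist_image_fld[OF m cyc'(3)] s sv by auto
  have U_sub: "U \<subseteq> fld m" unfolding U using twist_mem sv by auto
  have U_I: "u \<in> I" if "u \<in> U" for u
    using that s unfolding U_def I by (auto simp: mult.commute[of s] twist_mult)
  have orth: "tr m (y * u) = 0" if "y \<in> I" "u \<in> U" for y u
  proof -
    from that obtain z where z: "z \<in> fld m" "y = twist \<sigma> z" by (auto simp: I_def)
    have "tr m (y * u) = tr m (z ^ (p ^ degree s) * twist s u)"
      using tr_adjoint[OF s(1) z(1), of u] that U_sub z by (auto simp: \<sigma>_def)
    thus ?thesis using that by (simp add: U_def)
  qed
  \<comment> \<open>\<open>U\<close> is the image of \<open>twist (\<sigma> * v)\<close>, so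
    orthogonality to \<open>U\<close> says that the adjoint operator kills \<open>b\<close>. As
    \<open>v\<close> reflects to \<open>- v\<close>, this adjoint is \<open>- twist (s * v)\<close>,
    whose kernel is \<open>I\<close>.\<close>
  have orth': "b \<in> I" if b: "b \<in> fld m" "\<And>u. u \<in> U \<Longrightarrow> tr m (b * u) = 0" for b
  proof -
    let ?d = "degree (\<sigma> * v)"
    \<comment> \<open>\<open>tr_adjoint\<close> wants \<open>b\<close> as a \<open>p ^ ?d\<close>-th
      power. Since \<open>b ^ (p ^ (m * ?d)) = b\<close>, the exponent \<open>m * ?d - ?d\<close>
      gives such a root inside \<open>fld m\<close>.\<close>
    define b' where "b' = b ^ (p ^ (m * ?d - ?d))"
    have pw: "b ^ (p ^ (m * j)) = b" for j
      using b(1) by (induction j) (simp_all add: fld_def power_add power_mult)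
    have "m * ?d - ?d + ?d = m * ?d" using m by simp
    hence b': "b' ^ (p ^ ?d) = b" "b' \<in> fld m"
      using pw[of ?d] b(1) by (simp_all add: b'_def fld_power flip: power_mult power_add)
    have "tr m (twist (reflect_poly (\<sigma> * v)) b' * y) = 0" if "y \<in> fld m" for y
      using tr_adjoint[OF sv(2) b'(2) that] b(2) that by (auto simp: b' U)
    moreover have "twist (reflect_poly (\<sigma> * v)) b' \<in> fld m"
      using sv b' over_prime_reflect twist_mem by blast
    ultimately have "twist (reflect_poly (\<sigma> * v)) b' = 0"
      using tr_nondegenerate[OF m] by blast
    hence "twist (reflect_poly (\<sigma> * v)) b = 0"
      using twist_frob[of "reflect_poly (\<sigma> * v)" b' ?d] over_prime_reflect[OF sv(2)] b' by simp
    moreover have "reflect_poly v = - v"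
    proof -
      have "reflect_poly (cyc m) = - cyc m"
      proof (rule poly_eqI)
        have co: "coeff (cyc m) i = (if i = m then 1 else 0) - (if i = 0 then 1 else 0)" for i
          by (simp add: cyc_def coeff_1)
        show "coeff (reflect_poly (cyc m)) i = coeff (- cyc m) i" for i
          using m by (auto simp: coeff_reflect_poly degree_cyc co)
      qed
      moreover have "reflect_poly (cyc m) = \<sigma> * s * reflect_poly v"
        using \<sigma> by (simp add: cyc \<sigma>_def reflect_poly_mult)
      ultimately have "\<sigma> * s * reflect_poly v = \<sigma> * s * (- v)" by (simp add: cyc \<sigma>_def mult_ac)
      thus ?thesis using nz by (metis mult_cancel_left mult_eq_0_iff)
    qed
    ultimately have "twist (- (s * v)) b = 0" using \<sigma> by (simp add: reflect_poly_mult)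
    thus ?thesis by (simp add: I twist_poly_minus)
  qed
  have eq1: "card {z\<in>fld m. tr m (twist \<sigma> z ^ 2) = 0} = card ZI * p ^ e"
  proof (rule card_eq_sum_fibres[where f = "twist \<sigma>"])
    fix y assume y: "y \<in> ZI"
    then obtain z0 where z0: "z0 \<in> fld m" "y = twist \<sigma> z0" by (auto simp: ZI_def I_def)
    have ker: "z \<in> fld m" if "twist \<sigma> z = 0" for z
      using that \<sigma> cyc'(1) by (simp add: fld_cyc mult.commute[of \<sigma>] twist_mult)
    have "z \<in> fld m" if "twist \<sigma> z = y" for z
      using ker[of "z - z0"] that z0 fld_add[of "z - z0" m z0] by (simp add: twist_diff)
    hence "{z \<in> {z\<in>fld m. tr m (twist \<sigma> z ^ 2) = 0}. twist \<sigma> z = y} = {z. twist \<sigma> z = y}"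
      using y by (auto simp: ZI_def)
    thus "card {z \<in> {z\<in>fld m. tr m (twist \<sigma> z ^ 2) = 0}. twist \<sigma> z = y} = p ^ e"
      using card_twist_fibre \<sigma> by simp
  qed (use fin I_sub in \<open>auto simp: ZI_def I_def intro: finite_subset\<close>)
  have UaddB: "b + u \<in> fld m - I" if "b \<in> fld m - I" "u \<in> U" for b u
  proof -
    have "b \<in> I" if "b + u \<in> I"
    proof -
      have "twist (s * v) (b + u) - twist (s * v) u = 0"
        using that U_I[OF \<open>u \<in> U\<close>] by (simp add: I)
      thus ?thesis by (simp add: I twist_add)
    qed
    thus ?thesis using that U_sub fld_add by auto
  qed
  have Uminus: "- u \<in> U" if "u \<in> U" for u
    using that twist_diff[of s 0 u] by (simp add: U_def)
  \<comment> \<open>Pairs \<open>(b, u)\<close> with \<open>tr m ((b + u) ^ 2) = 0\<close> are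
    counted in two ways; translation by an element of \<open>U\<close> permutes the complement of
    \<open>I\<close>.\<close>
  have eq2: "card U * card T = (\<Sum>b\<in>fld m - I. card {u\<in>U. tr m ((b + u) ^ 2) = 0})"
  proof -
    have shift: "card T = card {b\<in>fld m - I. tr m ((b + u) ^ 2) = 0}" if u: "u \<in> U" for u
    proof (rule bij_betw_same_card, rule bij_betw_byWitness)
      show "(\<lambda>b. b - u) ` T \<subseteq> {b \<in> fld m - I. tr m ((b + u)\<^sup>2) = 0}"
        using UaddB[OF _ Uminus[OF u]] by (auto simp: T_def)
      show "(\<lambda>b. b + u) ` {b \<in> fld m - I. tr m ((b + u)\<^sup>2) = 0} \<subseteq> T"
        using UaddB[OF _ u] by (auto simp: T_def)
    qed auto
    have "card U * card T = (\<Sum>u\<in>U. card {b\<in>fld m - I. tr m ((b + u) ^ 2) = 0})"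
    proof -
      have "(\<Sum>u\<in>U. card {b\<in>fld m - I. tr m ((b + u) ^ 2) = 0}) = (\<Sum>u\<in>U. card T)"
        by (intro sum.cong refl) (rule shift[symmetric])
      thus ?thesis by simp
    qed
    also have "\<dots> = (\<Sum>u\<in>U. \<Sum>b\<in>fld m - I. if tr m ((b + u) ^ 2) = 0 then 1 else 0)"
      using fin by (intro sum.cong refl, subst sum.If_cases) (auto simp: Int_def)
    also have "\<dots> = (\<Sum>b\<in>fld m - I. \<Sum>u\<in>U. if tr m ((b + u) ^ 2) = 0 then 1 else 0)"
      by (rule sum.swap)
    also have "\<dots> = (\<Sum>b\<in>fld m - I. card {u\<in>U. tr m ((b + u) ^ 2) = 0})"
      using finU by (intro sum.cong refl, subst sum.If_cases) (auto simp: Int_def)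
    finally show ?thesis .
  qed
  \<comment> \<open>\<open>U\<close> is totally isotropic, so the form at \<open>b + u\<close> is
    \<open>tr m (b ^ 2) + 2 * tr m (b * u)\<close>, affine in \<open>u\<close>; by
    \<open>orth'\<close> it is not constant when \<open>b\<close> is outside
    \<open>I\<close>.\<close>
  have equi: "p * card {u\<in>U. tr m ((b + u) ^ 2) = 0} = card U" if b: "b \<in> fld m - I" for b
  proof -
    obtain u0 where u0: "u0 \<in> U" "tr m (b * u0) \<noteq> 0" using orth' b by blast
    have two_mem: "2 \<in> fld (Suc 0)" using fld_add[OF fld_one fld_one] by simp
    have ex: "tr m ((b + u) ^ 2) = tr m (b ^ 2) + 2 * tr m (b * u)" if "u \<in> U" for u
    proof -
      have "tr m (u ^ 2) = 0" using orth[OF U_I that] that by (simp add: power2_eq_square)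
      moreover have "tr m (2 * (b * u)) = 2 * tr m (b * u)" using tr_scale two_mem by blast
      ultimately show ?thesis by (simp add: power2_sum tr_add mult.assoc)
    qed
    have "{u\<in>U. tr m ((b + u) ^ 2) = 0} = {u\<in>U. 2 * tr m (b * u) = - tr m (b ^ 2)}"
      using ex by (auto simp: eq_neg_iff_add_eq_0 add.commute)
    moreover have "p * card {u\<in>U. 2 * tr m (b * u) = - tr m (b ^ 2)} = card U"
    proof (rule card_fibre_linear)
      show "finite U" by fact
      show "u0 \<in> U" "2 * tr m (b * u0) \<noteq> 0" using u0 two by auto
      show "u + w \<in> U" if "u \<in> U" "w \<in> U" for u w using that by (auto simp: U_def twist_add)
      show "c * u \<in> U" if "c \<in> fld (Suc 0)" "u \<in> U" for c u
        using that by (auto simp: U_def twist_scale)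
      show "2 * tr m (b * (c * u)) = c * (2 * tr m (b * u))" if "c \<in> fld (Suc 0)" for c u
        using tr_scale[OF that, of m "b * u"] by (simp add: mult_ac)
      show "- tr m (b\<^sup>2) \<in> fld (Suc 0)" using b by (intro fld_minus tr_mem fld_power) auto
      show "2 * tr m (b * u) \<in> fld (Suc 0)" if "u \<in> U" for u
        using b that U_sub by (intro fld_mult tr_mem two_mem) auto
    qed (simp add: tr_add distrib_left)
    ultimately show ?thesis by simp
  qed
  have "p * (card U * card T) = card (fld m - I) * card U"
    using equi by (simp add: eq2 sum_distrib_left)
  hence pT: "p * card T = card (fld m - I)" using cardU p_gt_1 by simp
  have "card (fld m - I) + card I = card (fld m)"
    using I_sub fin by (metis card_Diff_subset card_mono finite_subset le_add_diff_inverse2)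
  with pT have pT': "p * card T + p ^ (m - e) = p ^ m"
    using cardI card_fld m by simp
  have "{b\<in>fld m. tr m (b ^ 2) = 0} = ZI \<union> T" using I_sub by (auto simp: ZI_def T_def)
  moreover have "card (ZI \<union> T) = card ZI + card T"
    by (rule card_Un_disjoint) (use fin I_sub in \<open>auto simp: ZI_def T_def intro: finite_subset\<close>)
  ultimately have Z: "card {b\<in>fld m. tr m (b ^ 2) = 0} = card ZI + card T" by simp
  have pm: "int p ^ m = int p * int p ^ (m - 1)" using m by (cases m) auto
  have pe: "int p ^ e * p ^ (m - e) = p ^ m" using mdeg by (simp flip: power_add)
  have "int (p * (card ZI * p ^ e)) = int p ^ m + int p ^ e * (p * (int (card ZI) + card T) - p ^ m)"
  proof -
    have "int p * card T = int p ^ m - p ^ (m - e)" using pT' by (simp flip: of_nat_power of_nat_mult)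
    hence "int p ^ e * (int p * card T) = int p ^ e * (int p ^ m - p ^ (m - e))" by (simp only:)
    hence "int p ^ e * (p * (int (card ZI) + card T) - p ^ m) = p ^ e * p * card ZI - int p ^ e * p ^ (m - e)"
      by (simp add: algebra_simps)
    thus ?thesis unfolding pe by simp
  qed
  also have "\<dots> = int p ^ m + p ^ (e + 1) * (int (card ZI) + card T - p ^ (m - 1))"
    using pm by (simp add: algebra_simps)
  finally show ?thesis unfolding eq1[unfolded \<sigma>_def] Z e_def[symmetric] by simp
qed

lemma card_two_roots:
  assumes "(2::'a) \<noteq> 0" "w \<noteq> 0"
  shows "finite {z::'a. z ^ 2 = w}" "card {z::'a. z ^ 2 = w} = 2"
  using card_power_eq[of w 2] assms by auto

lemma card_trace_zero_nonzero:
  assumes "m > 0"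
  shows "card ({z\<in>fld m. tr m z = 0} - {0}) = p ^ (m - 1) - 1"
  using card_tr_fibre[OF assms fld_0] card_fld(1)[OF assms] by (subst card_Diff_singleton) (auto simp: fld_0)

text \<open>
  An element \<open>\<epsilon>\<close> with \<open>\<phi>(\<epsilon>) = - \<epsilon>\<close> has \<open>\<epsilon>\<^sup>2\<close> in the prime field, but \<open>\<epsilon>\<close> not in an extension of odd
  degree \<open>m\<close>. So the square roots of the elements of \<open>fld m\<close> lie in \<open>fld m \<union> \<epsilon> fld m\<close>.
\<close>

lemma card_trace_square_odd:
  assumes m: "odd m" and two: "(2::'a) \<noteq> 0"
  shows "card {b\<in>fld m. tr m (b ^ 2) = 0} = p ^ (m - 1)"
proof -
  have m0: "m > 0" using m by (auto intro: Nat.gr0I)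
  have p1: "p - 1 > 0" using p_gt_1 by simp
  obtain \<epsilon> :: 'a where "\<epsilon> ^ (p - 1) = -1" using nth_root_exists[OF p1] by blast
  hence eps: "\<epsilon> ^ p = - \<epsilon>" "\<epsilon> \<noteq> 0"
    using p1 power_Suc[of \<epsilon> "p - 1"] by (auto simp: power_0_left)
  have eps_pow: "\<epsilon> ^ (p ^ j) = (-1) ^ j * \<epsilon>" for j
  proof (induction j)
    case (Suc j)
    have "\<epsilon> ^ (p ^ Suc j) = ((-1) ^ j * \<epsilon>) ^ p"
      using Suc by (simp add: power_mult mult.commute[of p])
    also have "\<dots> = (-1) ^ j * \<epsilon> ^ p"
      by (cases "even j") (simp_all add: minus_pow)
    finally show ?case using eps by simp
  qed simp
  have eps_m: "\<epsilon> ^ (p ^ m) = - \<epsilon>" using eps_pow[of m] m by simp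
  have eps2: "\<epsilon> ^ 2 \<in> fld (Suc 0)"
    by (simp add: fld_1 power2_eq_square power_mult_distrib eps)
  define Z where "Z = {b\<in>fld m. tr m (b ^ 2) = 0}"
  \<comment> \<open>All square roots, in the closed field, of the nonzero trace-zero elements of
    \<open>fld m\<close>. Squaring is two-to-one on \<open>W\<close>, and \<open>W\<close> consists
    of two copies of \<open>Z - {0}\<close>, so the factors 2 cancel.\<close>
  define W where "W = {b. b ^ 2 \<in> fld m \<and> tr m (b ^ 2) = 0} - {0}"
  have finZ: "finite Z" using card_fld m0 by (simp add: Z_def)
  have W_eq: "W = (Z - {0}) \<union> (\<lambda>b. \<epsilon> * b) ` (Z - {0})"
  proof
    show "W \<subseteq> (Z - {0}) \<union> (\<lambda>b. \<epsilon> * b) ` (Z - {0})"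
    proof
      fix w assume w: "w \<in> W"
      hence "(w ^ (p ^ m)) ^ 2 = w ^ 2"
        by (simp add: W_def fld_def flip: power_mult) (simp add: mult.commute)
      hence "w ^ (p ^ m) = w \<or> w ^ (p ^ m) = - w" by (simp add: power2_eq_iff)
      thus "w \<in> (Z - {0}) \<union> (\<lambda>b. \<epsilon> * b) ` (Z - {0})"
      proof
        assume "w ^ (p ^ m) = w"
        with w show ?thesis by (auto simp: Z_def W_def fld_def)
      next
        assume a: "w ^ (p ^ m) = - w"
        hence wm: "w / \<epsilon> \<in> fld m" by (simp add: fld_def power_divide eps_m)
        have "\<epsilon> ^ 2 * tr m ((w / \<epsilon>) ^ 2) = tr m (w ^ 2)"
          using tr_scale[OF eps2, of m "(w / \<epsilon>) ^ 2"] eps by (simp add: power_divide)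
        hence "w / \<epsilon> \<in> Z - {0}" using w wm eps by (auto simp: W_def Z_def)
        thus ?thesis using eps by (intro UnI2 image_eqI[of _ _ "w / \<epsilon>"]) auto
      qed
    qed
    show "(Z - {0}) \<union> (\<lambda>b. \<epsilon> * b) ` (Z - {0}) \<subseteq> W"
      using eps eps2 fld_1_subset[OF eps2, of m]
      by (auto simp: Z_def W_def power_mult_distrib tr_scale intro!: fld_mult intro: fld_power)
  qed
  have disj: "(Z - {0}) \<inter> (\<lambda>b. \<epsilon> * b) ` (Z - {0}) = {}"
  proof -
    have "\<epsilon> * b \<notin> fld m" if "b \<in> fld m" "b \<noteq> 0" for b
    proof
      assume "\<epsilon> * b \<in> fld m"
      with that have "- (\<epsilon> * b) = \<epsilon> * b" by (simp add: fld_def power_mult_distrib eps_m)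
      hence "2 * (\<epsilon> * b) = 0" by (metis add.right_inverse mult_2)
      thus False using that eps two by simp
    qed
    thus ?thesis by (auto simp: Z_def)
  qed
  have inj: "inj_on (\<lambda>b. \<epsilon> * b) (Z - {0})" using eps by (auto simp: inj_on_def)
  have cW: "card W = 2 * card (Z - {0})"
    unfolding W_eq using finZ disj by (subst card_Un_disjoint) (auto simp: card_image[OF inj])
  have "card W = card ({z\<in>fld m. tr m z = 0} - {0}) * 2"
  proof (rule card_eq_sum_fibres[where f = "\<lambda>b. b ^ 2"])
    show "finite W" unfolding W_eq using finZ by auto
    show "finite ({z\<in>fld m. tr m z = 0} - {0})" using card_fld m0 by simp
    fix y assume y: "y \<in> {z\<in>fld m. tr m z = 0} - {0}"
    hence "{x\<in>W. x ^ 2 = y} = {x. x ^ 2 = y}" by (auto simp: W_def)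
    thus "card {x\<in>W. x ^ 2 = y} = 2" using card_two_roots[OF two] y by auto
  next
    show "w ^ 2 \<in> {z\<in>fld m. tr m z = 0} - {0}" if "w \<in> W" for w
      using that unfolding W_def by simp
  qed
  with cW have "card (Z - {0}) = p ^ (m - 1) - 1" using card_trace_zero_nonzero[OF m0] by simp
  moreover have Z0: "0 \<in> Z" by (simp add: Z_def fld_0)
  moreover have "card Z > 0" using finZ Z0 card_gt_0_iff by blast
  moreover have "card (Z - {0}) = card Z - 1" using Z0 by (rule card_Diff_singleton)
  moreover have "p ^ (m - 1) > 0" using p_gt_1 by simp
  ultimately have "card Z = p ^ (m - 1)" by linarith
  thus ?thesis by (simp only: Z_def)
qed

text \<open>
  With \<open>r = p\<^sup>k\<close>, double counting of the pairs \<open>(b, c)\<close> with \<open>tr((b c)\<^sup>2) = 0\<close>, where \<open>c\<close> ranges over the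
  group \<open>D\<close> of the square roots of the nonzero elements of \<open>fld k\<close>.
\<close>

lemma card_trace_square_even:
  assumes k: "k > 0" and "odd p"
  defines "r \<equiv> p ^ k"
  shows "int (card {b\<in>fld (2 * k). tr (2 * k) (b ^ 2) = 0}) =
    (if r mod 4 = 3 then int (p ^ (2 * k - 1)) + (r - p ^ (k - 1)) else int (p ^ (2 * k - 1)) - (int r - p ^ (k - 1)))"
proof -
  define m where "m = 2 * k"
  define Z where "Z = {b\<in>fld m. tr m (b ^ 2) = 0}"
  define D where "D = {c::'a. c ^ (2 * (r - 1)) = 1}"
  \<comment> \<open>These are the nonzero \<open>b\<close> in \<open>fld m\<close> with
    \<open>b ^ 2 + (b ^ 2) ^ r = 0\<close>, that is, those whose square has relative trace zero over
    \<open>fld k\<close>.\<close>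
  define W where "W = {b\<in>fld m. b ^ (2 * (r - 1)) = -1}"
  define s where "s = p ^ (k - 1)"
  have m0: "m > 0" using k by (simp add: m_def)
  have rs: "r = p * s" using k by (cases k) (auto simp: r_def s_def)
  have s0: "s > 0" using p_gt_1 by (simp add: s_def)
  have r3: "odd r" "r > 1"
    using \<open>odd p\<close> k p_gt_1 one_less_power[of p k] by (auto simp: r_def)
  have pm: "p ^ m = r * r" by (simp add: m_def r_def mult_2 power_add)
  have r_zero: "(of_nat r :: 'a) = 0" by (simp add: rs p_zero)
  have two: "(2::'a) \<noteq> 0"
  proof
    assume "(2::'a) = 0"
    hence "(of_nat (2 * (p div 2)) :: 'a) = 0" by simp
    moreover have "p = 2 * (p div 2) + 1" using \<open>odd p\<close> by presburger
    ultimately have "(of_nat p :: 'a) = 1" by (metis add.left_neutral of_nat_1 of_nat_add)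
    thus False using p_zero by simp
  qed
  have N_nz: "(of_nat (2 * (r - 1)) :: 'a) \<noteq> 0"
    using r3 r_zero two by (simp add: of_nat_diff)
  have neg1: "(-1::'a) \<noteq> 1" using two by (metis add.right_inverse one_add_one)
  have finD: "finite D" and cardD: "card D = 2 * (r - 1)"
    using card_power_eq[OF _ N_nz, of 1] by (simp_all add: D_def)
  have fin: "finite (fld m)" using card_fld m0 by blast
  obtain j where j: "r + 1 = 2 * j" using r3 by (metis dvdE even_add odd_one)
  have rr: "r * r - 1 = 2 * (r - 1) * j"
  proof -
    have "r * r - 1 = (r - 1) * (r + 1)" by (cases r) auto
    also have "\<dots> = (r - 1) * (2 * j)" by (simp only: j)
    finally show ?thesis by (simp only: mult_ac)
  qed
  have mem_iff: "b \<in> fld m \<longleftrightarrow> (b ^ (2 * (r - 1))) ^ j = 1" if "b \<noteq> 0" for b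
  proof -
    have "r * r \<noteq> 0" using r3 by simp
    hence "b ^ (p ^ m) = b * b ^ (r * r - 1)"
      unfolding pm using power_minus_mult[of "r * r" b] by (simp add: mult.commute)
    moreover have "b ^ (r * r - 1) = (b ^ (2 * (r - 1))) ^ j"
      by (simp only: rr power_mult)
    ultimately show ?thesis using that by (simp add: fld_def)
  qed
  have D_fld: "c \<in> fld m" "c \<noteq> 0" if "c \<in> D" for c
  proof -
    show "c \<noteq> 0" using that r3 by (auto simp: D_def power_0_left)
    thus "c \<in> fld m" using that by (simp add: mem_iff D_def)
  qed
  have D_sq: "c \<in> D \<longleftrightarrow> c ^ 2 \<in> fld k - {0}" for c
  proof -
    have "(c ^ 2) ^ r = c ^ 2 * (c ^ 2) ^ (r - 1)"
      using r3 power_minus_mult[of r "c ^ 2"] by (simp add: mult.commute)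
    moreover have "(c ^ 2) ^ (r - 1) = c ^ (2 * (r - 1))" by (rule power_mult[symmetric])
    moreover have "c \<noteq> 0" if "c \<in> D" using that by (rule D_fld)
    ultimately show ?thesis by (auto simp: fld_def r_def[symmetric] D_def)
  qed
  \<comment> \<open>As \<open>r * r - 1 = 2 * (r - 1) * j\<close>, a solution of
    \<open>b ^ (2 * (r - 1)) = -1\<close> lies in \<open>fld m\<close> iff
    \<open>(-1) ^ j = 1\<close>; and \<open>j = (r + 1) / 2\<close> is even exactly when
    \<open>r mod 4 = 3\<close>. This is the origin of the sign.\<close>
  have cardW: "finite W \<and> card W = (if r mod 4 = 3 then 2 * (r - 1) else 0)"
  proof (cases "r mod 4 = 3")
    case True
    have "even j" using j True by presburger
    have "b \<in> fld m" if "b ^ (2 * (r - 1)) = -1" for b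
    proof -
      have "b \<noteq> 0" using that r3 by (auto simp: power_0_left)
      thus ?thesis using mem_iff[of b] that \<open>even j\<close> by simp
    qed
    hence "W = {b. b ^ (2 * (r - 1)) = -1}" by (auto simp: W_def)
    thus ?thesis using card_power_eq[OF _ N_nz, of "-1"] True by simp
  next
    case False
    have "odd j" using j r3 False by presburger
    have "b \<notin> W" for b
    proof
      assume b: "b \<in> W"
      hence "b \<noteq> 0" using r3 by (auto simp: W_def power_0_left)
      moreover have "b \<in> fld m" "b ^ (2 * (r - 1)) = -1" using b by (auto simp: W_def)
      ultimately have "(-1::'a) ^ j = 1" using mem_iff[of b] by simp
      thus False using \<open>odd j\<close> neg1 by simp
    qed
    hence "W = {}" by blast
    thus ?thesis using False by simp
  qed
  have tr_m: "tr m y = tr k (y + y ^ r)" for y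
  proof -
    have split: "(\<Sum>i<k + j. f i) = (\<Sum>i<k. f i) + (\<Sum>i<j. f (k + i))" for f :: "nat \<Rightarrow> 'a" and j
      by (induction j) (simp_all add: add.assoc)
    have "tr m y = (\<Sum>i<k. y ^ (p ^ i)) + (\<Sum>i<k. y ^ (p ^ (k + i)))"
      unfolding tr_def m_def mult_2 by (rule split)
    thus ?thesis by (simp add: tr_def add_pow_p_pow sum.distrib r_def power_add power_mult)
  qed
  have count_D: "card {c\<in>D. tr k (c ^ 2 * w) = 0} = 2 * (s - 1)" if w: "w \<in> fld k" "w \<noteq> 0" for w
  proof -
    have "card {c\<in>D. tr k (c ^ 2 * w) = 0} = card ({z\<in>fld k. tr k z = 0} - {0}) * 2"
    proof (rule card_eq_sum_fibres[where f = "\<lambda>c. c ^ 2 * w"])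
      fix y assume y: "y \<in> {z\<in>fld k. tr k z = 0} - {0}"
      have "c \<in> D" if "c ^ 2 = y / w" for c
        using that y w fld_divide[of y k w] by (simp add: D_sq)
      hence "{c \<in> {c\<in>D. tr k (c ^ 2 * w) = 0}. c ^ 2 * w = y} = {c. c ^ 2 = y / w}"
        using y w by (auto simp: field_simps)
      thus "card {c \<in> {c\<in>D. tr k (c ^ 2 * w) = 0}. c ^ 2 * w = y} = 2"
        using card_two_roots[OF two, of "y / w"] y w by simp
    next
      show "finite {c\<in>D. tr k (c ^ 2 * w) = 0}" using finD by simp
      show "finite ({z\<in>fld k. tr k z = 0} - {0})" using card_fld[OF k] by simp
      show "c ^ 2 * w \<in> {z\<in>fld k. tr k z = 0} - {0}" if "c \<in> {c\<in>D. tr k (c ^ 2 * w) = 0}" for c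
        using that w by (auto simp: D_sq intro: fld_mult)
    qed
    thus ?thesis using card_trace_zero_nonzero[OF k] by (simp add: s_def)
  qed
  \<comment> \<open>Since \<open>c ^ 2\<close> lies in \<open>fld k\<close>, the trace is
    \<open>tr k (c ^ 2 * w)\<close> with \<open>w\<close> the relative trace of
    \<open>b ^ 2\<close>. If \<open>w = 0\<close> every \<open>c\<close> counts; otherwise
    \<open>c ^ 2 * w\<close> takes each nonzero value in \<open>fld k\<close> twice.\<close>
  have count_b: "card {c\<in>D. tr m ((b * c) ^ 2) = 0} =
      (if b \<in> insert 0 W then 2 * (r - 1) else 2 * (s - 1))" if b: "b \<in> fld m" for b
  proof -
    define w where "w = b ^ 2 + (b ^ 2) ^ r"
    have "(b ^ r) ^ r = b" using b by (simp add: fld_def pm power_mult)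
    moreover have "((b ^ 2) ^ r) ^ r = ((b ^ r) ^ r) ^ 2" by (simp only: power_mult[symmetric] mult_ac)
    ultimately have "((b ^ 2) ^ r) ^ r = b ^ 2" by simp
    moreover have "w ^ r = (b ^ 2) ^ r + ((b ^ 2) ^ r) ^ r"
      unfolding w_def r_def by (rule add_pow_p_pow)
    ultimately have "w ^ r = w" unfolding w_def by (simp only: add.commute)
    hence w_mem: "w \<in> fld k" by (simp add: fld_def r_def)
    have e: "tr m ((b * c) ^ 2) = tr k (c ^ 2 * w)" if "c \<in> D" for c
    proof -
      have "(c ^ 2) ^ r = c ^ 2" using that by (simp add: D_sq fld_def r_def)
      thus ?thesis by (simp add: tr_m w_def power_mult_distrib algebra_simps)
    qed
    have "w = 0 \<longleftrightarrow> b \<in> insert 0 W"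
    proof -
      have "(b ^ 2) ^ r = b ^ 2 * (b ^ 2) ^ (r - 1)"
        using r3 power_minus_mult[of r "b ^ 2"] by (simp add: mult.commute)
      hence "w = b ^ 2 * (1 + (b ^ 2) ^ (r - 1))"
        unfolding w_def by (simp only: distrib_left mult_1_right)
      hence "w = b ^ 2 * (1 + b ^ (2 * (r - 1)))" by (simp only: power_mult[symmetric])
      thus ?thesis using b by (auto simp: W_def eq_neg_iff_add_eq_0 add.commute)
    qed
    thus ?thesis
      using count_D[OF w_mem] cardD e by (cases "w = 0") (auto cong: conj_cong)
  qed
  have "card D * card Z = (\<Sum>c\<in>D. card {b\<in>fld m. tr m ((b * c) ^ 2) = 0})"
  proof -
    have "card Z = card {b\<in>fld m. tr m ((b * c) ^ 2) = 0}" if c: "c \<in> D" for c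
      by (rule bij_betw_same_card, rule bij_betw_byWitness[of _ "\<lambda>b. b * c" "\<lambda>b. b / c"])
        (use D_fld[OF c] in \<open>auto simp: Z_def intro: fld_mult fld_divide\<close>)
    hence "(\<Sum>c\<in>D. card Z) = (\<Sum>c\<in>D. card {b\<in>fld m. tr m ((b * c) ^ 2) = 0})"
      by (rule sum.cong[OF refl])
    thus ?thesis by simp
  qed
  also have "\<dots> = (\<Sum>c\<in>D. \<Sum>b\<in>fld m. if tr m ((b * c) ^ 2) = 0 then 1 else 0)"
    using fin by (intro sum.cong refl, subst sum.If_cases) (auto simp: Int_def)
  also have "\<dots> = (\<Sum>b\<in>fld m. \<Sum>c\<in>D. if tr m ((b * c) ^ 2) = 0 then 1 else 0)"
    by (rule sum.swap)
  also have "\<dots> = (\<Sum>b\<in>fld m. card {c\<in>D. tr m ((b * c) ^ 2) = 0})"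
    using finD by (intro sum.cong refl, subst sum.If_cases) (auto simp: Int_def)
  also have "\<dots> = (\<Sum>b\<in>fld m. if b \<in> insert 0 W then 2 * (r - 1) else 2 * (s - 1))"
    using count_b by (intro sum.cong) auto
  also have "\<dots> = card (insert 0 W) * (2 * (r - 1)) + card (fld m - insert 0 W) * (2 * (s - 1))"
  proof -
    have "(\<Sum>b\<in>fld m. if b \<in> A then u else v) = card A * u + card (fld m - A) * v"
      if "A \<subseteq> fld m" for A and u v :: nat
    proof -
      have "fld m \<inter> {b. b \<in> A} = A" "fld m \<inter> - {b. b \<in> A} = fld m - A" using that by auto
      thus ?thesis using fin by (subst sum.If_cases) simp_all
    qed
    thus ?thesis by this (auto simp: W_def fld_0)
  qed
  finally have main: "2 * (r - 1) * card Z = card (insert 0 W) * (2 * (r - 1)) + card (fld m - insert 0 W) * (2 * (s - 1))"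
    using cardD by simp
  define w where "w = card W"
  have c1: "card (insert 0 W) = Suc w"
    using cardW r3 by (simp add: w_def W_def power_0_left)
  have c2: "card (fld m - insert 0 W) + Suc w = r * r"
  proof -
    have "insert 0 W \<subseteq> fld m" by (auto simp: W_def fld_0)
    hence "card (fld m - insert 0 W) + card (insert 0 W) = card (fld m)"
      using fin by (metis card_Diff_subset card_mono finite_subset le_add_diff_inverse2)
    thus ?thesis using c1 card_fld(2)[OF m0] pm by simp
  qed
  hence c2': "int (card (fld m - insert 0 W)) = int r * r - 1 - w" by (simp flip: of_nat_mult)
  have "int (2 * (r - 1) * card Z) = int (card (insert 0 W) * (2 * (r - 1)) + card (fld m - insert 0 W) * (2 * (s - 1)))"
    using main by simp
  moreover have "int (2 * (r - 1)) = 2 * (int r - 1)" "int (2 * (s - 1)) = 2 * (int s - 1)"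
    using r3 s0 by auto
  ultimately have "2 * ((int r - 1) * card Z) = 2 * ((1 + w) * (int r - 1) + (int r * r - 1 - w) * (int s - 1))"
    by (simp only: of_nat_mult[of "2 * (r - 1)"] of_nat_add of_nat_mult[of _ "2 * (r - 1)"] of_nat_mult[of _ "2 * (s - 1)"] c1 c2')
      (simp add: algebra_simps)
  hence "(int r - 1) * card Z = (1 + w) * (int r - 1) + (int r * r - 1 - w) * (int s - 1)" by simp
  moreover have "(1 + int w) * (int r - 1) + (int r * r - 1 - w) * (int s - 1) =
     (int r - 1) * (if r mod 4 = 3 then int r * s + (int r - s) else int r * s - (int r - s))"
    using cardW r3 by (auto simp: w_def of_nat_diff algebra_simps)
  ultimately have "int (card Z) = (if r mod 4 = 3 then int r * s + (int r - s) else int r * s - (int r - s))"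
    using r3 by simp
  moreover have "p ^ (2 * k - 1) = r * s"
    using k by (cases k) (auto simp: r_def s_def power_add mult_2)
  moreover have "s \<le> r" using rs p_gt_1 by simp
  ultimately show ?thesis unfolding Z_def m_def s_def by (auto simp: of_nat_diff)
qed

end

section \<open>The self-reciprocal polynomial \<open>g\<close> and the number of affine
  points\<close>

lemma poly_pderiv_sum:
  fixes P :: "'a::idom poly"
  assumes "degree P \<le> d"
  shows "x * poly (pderiv P) x = (\<Sum>i\<le>d. of_nat i * coeff P i * x ^ i)"
proof -
  have "P = (\<Sum>i\<le>d. monom (coeff P i) i)"
    using poly_as_sum_of_monoms'[OF assms] by simp
  hence "pderiv P = (\<Sum>i\<le>d. pderiv (monom (coeff P i) i))"
    by (metis (no_types) pderiv_sum)
  also have "x * poly (\<Sum>i\<le>d. pderiv (monom (coeff P i) i)) x = (\<Sum>i\<le>d. of_nat i * coeff P i * x ^ i)"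
    unfolding poly_sum sum_distrib_left
  proof (intro sum.cong refl)
    fix i show "x * poly (pderiv (monom (coeff P i) i)) x = of_nat i * coeff P i * x ^ i"
      by (cases i) (simp_all add: pderiv_monom poly_monom mult_ac)
  qed
  finally show ?thesis .
qed

lemma coeff_g_poly:
  assumes "e \<ge> 1"
  shows "coeff (g_poly e c) j =
    (if j = 2 * e \<or> j = 0 then 1 else if j > e \<and> j < 2 * e then c (j - e) else if j = e then c 0
     else if j < e then c (e - j) else 0)"
proof -
  have 1: "coeff (\<Sum>i=1..<e. monom (c i) (e + i)) j = (if j > e \<and> j < 2 * e then c (j - e) else 0)"
  proof -
    have "coeff (\<Sum>i=1..<e. monom (c i) (e + i)) j = (\<Sum>i=1..<e. if i = j - e \<and> j > e then c i else 0)"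
      unfolding coeff_sum by (intro sum.cong refl) auto
    also have "\<dots> = (if j > e \<and> j < 2 * e then c (j - e) else 0)"
      by (cases "j > e") auto
    finally show ?thesis .
  qed
  have 2: "coeff (\<Sum>i=1..<e. monom (c i) (e - i)) j = (if j < e \<and> j > 0 then c (e - j) else 0)"
  proof -
    have "coeff (\<Sum>i=1..<e. monom (c i) (e - i)) j = (\<Sum>i=1..<e. if i = e - j \<and> j < e then c i else 0)"
      unfolding coeff_sum by (intro sum.cong refl) auto
    also have "\<dots> = (if j < e \<and> j > 0 then c (e - j) else 0)"
      by (cases "j < e") auto
    finally show ?thesis .
  qed
  show ?thesis
    unfolding g_poly_def coeff_add 1 2 using assms by (auto simp: coeff_1)
qed

lemma degree_g_poly: "e \<ge> 1 \<Longrightarrow> degree (g_poly e c) = 2 * e"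
  by (rule antisym) (auto intro!: degree_le le_degree simp: coeff_g_poly)

lemma coeff_g_poly_symmetric:
  "e \<ge> 1 \<Longrightarrow> j \<le> 2 * e \<Longrightarrow> coeff (g_poly e c) (2 * e - j) = coeff (g_poly e c) j"
  by (auto simp: coeff_g_poly)

lemma reflect_g_poly: "e \<ge> 1 \<Longrightarrow> reflect_poly (g_poly e c) = g_poly e c"
  by (rule poly_eqI) (auto simp: coeff_reflect_poly degree_g_poly coeff_g_poly_symmetric coeff_g_poly)

context frobenius_power begin

text \<open>Raising coefficients to the \<open>p\<close>-th power is multiplicative on polynomials,
  and its fixed points are the \<open>over_prime\<close> ones; apply it to \<open>A = B * C\<close>
  and cancel \<open>B\<close>.\<close>

lemma over_prime_cofactor:
  assumes "over_prime A" "over_prime B" "A = B * C" "B \<noteq> 0"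
  shows "over_prime C"
proof -
  let ?f = "map_poly (\<lambda>z. z ^ p)"
  have co: "coeff (?f D) i = coeff D i ^ p" for D :: "'a poly" and i
    using zero_pow_p_pow[of 1] by (subst coeff_map_poly) auto
  have mult: "?f (D * E) = ?f D * ?f E" for D E :: "'a poly"
    by (rule poly_eqI) (simp add: co coeff_mult sum_pow power_mult_distrib)
  have fixed: "?f D = D \<longleftrightarrow> over_prime D" for D :: "'a poly"
    by (auto simp: over_prime_def fld_1 poly_eq_iff co)
  have "B * ?f C = B * C"
    using assms fixed mult by metis
  thus ?thesis using assms(4) fixed by simp
qed

text \<open>Write \<open>p - 1 = n j\<close>. Then \<open>z ^ p = z\<close> for every
  \<open>n\<close>-th root of unity \<open>z\<close>, and \<open>n j = -1\<close> in the field makes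
  \<open>n\<close> invertible, so \<open>x ^ n - 1\<close> has only simple roots.\<close>

lemma cyc_separable:
  assumes "n \<ge> 1" "[p = 1] (mod n)" "poly (cyc n) z = 0"
  shows "z ^ n = 1" "z \<in> fld (Suc 0)" "poly (pderiv (cyc n)) z \<noteq> 0"
proof -
  show zn: "z ^ n = 1" using assms(3) by (simp add: cyc_def poly_monom)
  have "n dvd p - 1" using assms(2) p_gt_1 by (simp add: cong_altdef_nat cong_sym_eq)
  then obtain j where j: "p - 1 = n * j" by (elim dvdE)
  hence p: "p = Suc (n * j)" using p_gt_1 by simp
  show "z \<in> fld (Suc 0)"
  proof -
    have "z ^ p = z" by (subst p) (simp add: power_mult zn)
    thus ?thesis by (simp add: fld_1)
  qed
  have "(of_nat n :: 'a) * of_nat j = -1"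
    using p_zero by (simp add: p eq_neg_iff_add_eq_0 add.commute)
  hence n0: "(of_nat n :: 'a) \<noteq> 0" by auto
  have "z \<noteq> 0" using zn assms(1) by (auto simp: power_0_left)
  thus "poly (pderiv (cyc n)) z \<noteq> 0"
    using n0 by (simp add: cyc_def pderiv_diff pderiv_monom poly_monom)
qed

lemma not_double_root:
  assumes "n \<ge> 1" "[p = 1] (mod n)" "P dvd cyc n" "poly P z = 0"
  shows "poly (pderiv P) z \<noteq> 0"
proof
  assume d: "poly (pderiv P) z = 0"
  obtain Q where Q: "cyc n = P * Q" using assms(3) by (elim dvdE)
  have "poly (cyc n) z = 0" "poly (pderiv (cyc n)) z = 0"
    using assms(4) d by (simp_all add: Q pderiv_mult)
  thus False using cyc_separable assms by blast
qed

text \<open>Each induction step removes one pair \<open>z\<close>, \<open>1/z\<close>, distinct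
  because \<open>z\<close> is neither 1 nor -1, and puts only \<open>x - z\<close> into
  \<open>s\<close>. As \<open>z\<close> lies in \<open>fld (Suc 0)\<close>, so do the coefficients
  of \<open>s\<close>.\<close>

lemma symmetric_factorization:
  assumes n: "n \<ge> 1" "[p = 1] (mod n)"
  shows "P dvd cyc n \<Longrightarrow> (\<And>z. poly P z = 0 \<Longrightarrow> poly P (inverse z) = 0) \<Longrightarrow>
    poly P 1 \<noteq> 0 \<Longrightarrow> poly P (-1) \<noteq> 0 \<Longrightarrow>
    \<exists>\<gamma> s. P = smult \<gamma> (s * reflect_poly s) \<and> over_prime s \<and> coeff s 0 \<noteq> 0"
proof (induction "degree P" arbitrary: P rule: less_induct)
  case (less P)
  note sym = less.prems(2)
  show ?case
  proof (cases "degree P = 0")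
    case True
    then obtain \<gamma> where "P = [:\<gamma>:]" by (metis degree_eq_zeroE)
    thus ?thesis
      by (intro exI[of _ \<gamma>] exI[of _ 1]) (auto simp: over_prime_def coeff_1 fld_0 fld_one)
  next
    case False
    then obtain z where z: "poly P z = 0" using alg_closed_imp_poly_has_root[of P] by auto
    have cyc_root: "poly (cyc n) w = 0" if "poly P w = 0" for w
      using that less.prems(1) by (auto elim!: dvdE)
    note zz = cyc_separable[OF n cyc_root[OF z]]
    have z0: "z \<noteq> 0" using zz n by (auto simp: power_0_left)
    have zinv: "inverse z \<noteq> z"
    proof
      assume "inverse z = z"
      hence "z * z = 1" using z0 by (metis right_inverse)
      hence "z = 1 \<or> z = -1" by (simp add: square_eq_1_iff)
      thus False using less.prems z by auto
    qed
    obtain P1 where P1: "P = [:-z, 1:] * P1" using z by (metis poly_eq_0_iff_dvd dvdE)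
    have "poly P1 (inverse z) = 0" using sym[OF z] zinv by (simp add: P1)
    then obtain Q where "P1 = [:- inverse z, 1:] * Q" by (metis poly_eq_0_iff_dvd dvdE)
    hence Q: "P = [:-z, 1:] * [:- inverse z, 1:] * Q" by (simp only: P1 mult.assoc)
    have Qdvd: "Q dvd cyc n" using less.prems(1) Q by (metis dvd_mult_right)
    have polyP: "poly P w = (w - z) * (w - inverse z) * poly Q w" for w
      by (simp only: Q poly_mult) simp
    define A where "A = [:-z, 1:]"
    define B where "B = [:- inverse z, 1:]"
    have AB: "P = A * B * Q" by (simp only: Q A_def B_def)
    have P0: "P \<noteq> 0" using False by auto
    hence Q0: "Q \<noteq> 0" using Q by auto
    have deg: "degree P = degree Q + 2"
    proof -
      have "A \<noteq> 0" "B \<noteq> 0" "degree A = 1" "degree B = 1" by (simp_all add: A_def B_def)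
      thus ?thesis using Q0 by (simp add: AB degree_mult_eq)
    qed
    \<comment> \<open>Simplicity of the roots of \<open>P\<close> prevents the removed pair from
      recurring in \<open>Q\<close>, so the pairing of roots descends to \<open>Q\<close>.\<close>
    have simple: "w \<noteq> z \<and> w \<noteq> inverse z" if "poly Q w = 0" for w
    proof -
      have "poly P w = 0" using that Q by simp
      hence "poly (pderiv P) w \<noteq> 0" using not_double_root[OF n less.prems(1)] by blast
      moreover have "poly (pderiv P) w = poly A w * poly B w * poly (pderiv Q) w"
        using that by (simp add: AB pderiv_mult)
      ultimately show ?thesis by (auto simp: A_def B_def)
    qed
    have symQ: "poly Q (inverse w) = 0" if "poly Q w = 0" for w
    proof -
      have "poly P w = 0" using that Q by simp
      hence "poly P (inverse w) = 0" by (rule sym)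
      moreover have "inverse w \<noteq> z" "inverse w \<noteq> inverse z" using simple[OF that] by auto
      ultimately show ?thesis by (simp add: polyP)
    qed
    have "poly Q 1 \<noteq> 0" "poly Q (-1) \<noteq> 0" using less.prems(3,4) by (auto simp: Q)
    then obtain \<gamma> s where s: "Q = smult \<gamma> (s * reflect_poly s)" "over_prime s" "coeff s 0 \<noteq> 0"
      using less.hyps[of Q] deg Qdvd symQ by auto
    \<comment> \<open>The reflection of \<open>x - z\<close> is \<open>1 - z x\<close>, which is
      \<open>- z\<close> times \<open>x - 1/z\<close>; the scalar is absorbed by
      \<open>\<gamma>\<close>.\<close>
    have "reflect_poly A = smult (- z) B"
      using z0 by (simp add: reflect_poly_pCons A_def B_def)
    hence "P = smult (\<gamma> / (- z)) ((A * s) * reflect_poly (A * s))"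
      using z0 by (simp add: AB s(1) reflect_poly_mult mult_ac)
    moreover have "over_prime (A * s)"
      using zz(2) s(2) by (intro over_prime_mult)
        (auto simp: A_def over_prime_pCons fld_minus fld_one over_prime_def[of 0] fld_0)
    moreover have "coeff (A * s) 0 \<noteq> 0" using z0 s(3) by (simp add: A_def coeff_mult_0)
    ultimately show ?thesis by blast
  qed
qed

lemma cyc_dvd: "n dvd m \<Longrightarrow> cyc n dvd cyc m"
proof -
  assume "n dvd m"
  then obtain j where j: "m = n * j" by (elim dvdE)
  have "monom (1::'a) n - 1 dvd monom 1 n ^ j - 1"
  proof (induction j)
    case (Suc j)
    have "monom (1::'a) n ^ Suc j - 1 = monom 1 n * (monom 1 n ^ j - 1) + (monom 1 n - 1)"
      by (simp add: algebra_simps)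
    thus ?case using Suc by (simp only: dvd_add dvd_mult dvd_refl)
  qed simp
  thus ?thesis by (simp add: cyc_def j monom_power)
qed

text \<open>Invariance of the trace turns both \<open>z ^ (p ^ e) * z ^ (p ^ (e + i))\<close> and
  \<open>z ^ (p ^ e) * z ^ (p ^ (e - i))\<close> into \<open>z * z ^ (p ^ i)\<close>. Hence the
  factor 2 in every coefficient of \<open>R\<close> but \<open>c 0\<close>: each collects two
  symmetric coefficients of \<open>g\<close>.\<close>

lemma tr_R_poly:
  assumes "z \<in> fld m" "\<And>i. i < e \<Longrightarrow> c i \<in> fld (Suc 0)" "e \<ge> 1"
  shows "tr m (z * poly (R_poly p e c) z) = tr m (z ^ (p ^ e) * twist (g_poly e c) z)"
proof -
  have c: "tr m (c i * w) = c i * tr m w" if "i < e" for i w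
    using assms(2)[OF that] tr_scale by blast
  have "tr m (z ^ (p ^ e) * z ^ (p ^ (2 * e))) = tr m ((z * z ^ (p ^ e)) ^ (p ^ e))"
    by (simp add: power_mult_distrib mult_2 power_add flip: power_mult)
  also have "\<dots> = tr m (z * z ^ (p ^ e))"
    by (intro tr_frob fld_mult fld_power assms)
  finally have e: "tr m (z ^ (p ^ e) * z ^ (p ^ (2 * e))) = tr m (z * z ^ (p ^ e))" .
  have up: "tr m (z ^ (p ^ e) * z ^ (p ^ (e + i))) = tr m (z * z ^ (p ^ i))" for i
  proof -
    have "z ^ (p ^ e) * z ^ (p ^ (e + i)) = (z * z ^ (p ^ i)) ^ (p ^ e)"
      by (simp add: power_mult_distrib power_add mult.commute flip: power_mult)
    thus ?thesis by (simp add: tr_frob fld_mult fld_power assms)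
  qed
  have down: "tr m (z ^ (p ^ e) * z ^ (p ^ (e - i))) = tr m (z * z ^ (p ^ i))" if "i < e" for i
  proof -
    have "p ^ e = p ^ i * p ^ (e - i)" using that by (simp flip: power_add)
    hence "z ^ (p ^ e) * z ^ (p ^ (e - i)) = (z * z ^ (p ^ i)) ^ (p ^ (e - i))"
      by (simp add: power_mult_distrib mult.commute flip: power_mult)
    thus ?thesis by (simp add: tr_frob fld_mult fld_power assms)
  qed
  have "tr m (z ^ (p ^ e) * twist (g_poly e c) z) =
     tr m (z ^ (p ^ e) * z ^ (p ^ (2 * e))) + (\<Sum>i=1..<e. c i * tr m (z ^ (p ^ e) * z ^ (p ^ (e + i))))
     + c 0 * tr m (z ^ (p ^ e) * z ^ (p ^ e)) + (\<Sum>i=1..<e. c i * tr m (z ^ (p ^ e) * z ^ (p ^ (e - i))))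
     + tr m (z ^ (p ^ e) * z)"
    using assms(3)
    by (simp add: g_poly_def twist_poly_add twist_poly_sum twist_monom distrib_left sum_distrib_left
        tr_add tr_sum mult.left_commute[of _ "c _"] c cong: sum.cong_simp)
  also have "\<dots> = 2 * tr m (z * z ^ (p ^ e)) + 2 * (\<Sum>i=1..<e. c i * tr m (z * z ^ (p ^ i))) + c 0 * tr m (z * z)"
    using up[of 0] by (simp add: e up down cong: sum.cong_simp) (simp add: mult.commute)
  also have "\<dots> = tr m (z * poly (R_poly p e c) z)"
  proof -
    have two: "tr m (2 * w) = 2 * tr m w" for w
      using tr_add[of m w w] by simp
    have "z * poly (R_poly p e c) z = 2 * (z * z ^ (p ^ e)) + (\<Sum>i=1..<e. 2 * (c i * (z * z ^ (p ^ i)))) + c 0 * (z * z)"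
      by (simp add: R_poly_def poly_sum poly_monom distrib_left sum_distrib_left mult_ac)
    thus ?thesis using assms(3) by (simp add: tr_add tr_sum two c sum_distrib_left cong: sum.cong_simp)
  qed
  finally show ?thesis ..
qed

theorem card_affine_points:
  assumes n: "n \<ge> 1" "[p = 1] (mod n)" and e: "e \<ge> 1" and two: "(2::'a) \<noteq> 0"
    and c: "\<And>i. i < e \<Longrightarrow> c i \<in> fld (Suc 0)" and dvd: "g_poly e c dvd cyc n"
    and m: "m > 0" "n dvd m"
  shows "int (card {(a, b). a \<in> fld m \<and> b \<in> fld m \<and> b ^ p - b = a * poly (R_poly p e c) a})
    = p ^ m + p ^ (e + 1) * (int (card {b\<in>fld m. tr m (b ^ 2) = 0}) - p ^ (m - 1))"
proof -
  let ?g = "g_poly e c"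
  have sym: "poly ?g (inverse z) = 0" if "poly ?g z = 0" for z
  proof -
    have "z \<noteq> 0" using that e by (auto simp: poly_0_coeff_0 coeff_g_poly)
    thus ?thesis using poly_reflect_poly_nz[of "inverse z" ?g] that
      by (simp add: reflect_g_poly[OF e])
  qed
  \<comment> \<open>For \<open>\<epsilon>\<close> equal to 1 or -1, pairing \<open>i\<close> with
    \<open>2 * e - i\<close> gives \<open>2 \<epsilon> g'(\<epsilon>) = 2 e g(\<epsilon>)\<close>,
    so a root there would be a double root of a divisor of \<open>x ^ n - 1\<close>.\<close>
  have pm1: "poly ?g \<epsilon> \<noteq> 0" if \<epsilon>: "\<epsilon> ^ 2 = 1" for \<epsilon>
  proof
    assume g: "poly ?g \<epsilon> = 0"
    have ei: "\<epsilon> ^ (2 * e - i) = \<epsilon> ^ i" if "i \<le> 2 * e" for i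
    proof -
      have "\<epsilon> ^ (2 * e - i) * \<epsilon> ^ i = (\<epsilon> ^ 2) ^ e" using that by (simp flip: power_add power_mult)
      moreover have "\<epsilon> ^ i * \<epsilon> ^ i = (\<epsilon> ^ 2) ^ i" by (simp add: mult_2 flip: power_add power_mult)
      moreover have "\<epsilon> \<noteq> 0" using \<epsilon> by auto
      ultimately show ?thesis using \<epsilon> by (metis mult_cancel_right power_not_zero power_one)
    qed
    have "\<epsilon> * poly (pderiv ?g) \<epsilon> = (\<Sum>i\<le>2*e. of_nat i * coeff ?g i * \<epsilon> ^ i)"
      by (rule poly_pderiv_sum) (simp add: degree_g_poly[OF e])
    moreover have "(\<Sum>i\<le>2*e. of_nat i * coeff ?g i * \<epsilon> ^ i) = (\<Sum>i\<le>2*e. of_nat (2 * e - i) * coeff ?g i * \<epsilon> ^ i)"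
      by (rule sum.reindex_bij_witness[of _ "\<lambda>i. 2 * e - i" "\<lambda>i. 2 * e - i"])
        (auto simp: coeff_g_poly_symmetric[OF e] ei)
    moreover have "(\<Sum>i\<le>2*e. of_nat i * coeff ?g i * \<epsilon> ^ i) + (\<Sum>i\<le>2*e. of_nat (2 * e - i) * coeff ?g i * \<epsilon> ^ i)
       = of_nat (2 * e) * poly ?g \<epsilon>"
      unfolding poly_altdef degree_g_poly[OF e] sum_distrib_left sum.distrib[symmetric]
      by (intro sum.cong refl) (auto simp: algebra_simps of_nat_diff)
    ultimately have "2 * (\<epsilon> * poly (pderiv ?g) \<epsilon>) = 0" using g by simp
    moreover have "\<epsilon> \<noteq> 0" using \<epsilon> by auto
    ultimately have "poly (pderiv ?g) \<epsilon> = 0" using two by simp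
    thus False using not_double_root[OF n dvd g] by simp
  qed
  obtain \<gamma> s where s: "?g = smult \<gamma> (s * reflect_poly s)" "over_prime s" "coeff s 0 \<noteq> 0"
    using symmetric_factorization[OF n dvd sym] pm1 by auto
  have s0: "s \<noteq> 0" using s by auto
  \<comment> \<open>\<open>g\<close> is monic, so comparing leading coefficients expresses
    \<open>\<gamma>\<close> by coefficients of \<open>s\<close>. It therefore lies in
    \<open>fld (Suc 0)\<close> and may be taken out of traces.\<close>
  have "lead_coeff ?g = 1" using e by (simp add: degree_g_poly coeff_g_poly)
  moreover have "lead_coeff ?g = \<gamma> * lead_coeff (s * reflect_poly s)"
    unfolding s(1) by (rule lead_coeff_smult)
  moreover have "lead_coeff (reflect_poly s) = coeff s 0"
    using s(3) by (simp add: coeff_reflect_poly)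
  ultimately have lc: "\<gamma> * (lead_coeff s * coeff s 0) = 1"
    by (simp only: lead_coeff_mult)
  hence \<gamma>0: "\<gamma> \<noteq> 0" by auto
  have "lead_coeff s * coeff s 0 \<noteq> 0" using lc by auto
  hence "\<gamma> = 1 / (lead_coeff s * coeff s 0)" using lc by (simp only: eq_divide_eq) simp
  hence \<gamma>: "\<gamma> \<in> fld (Suc 0)" using s(2) by (auto simp: over_prime_def intro!: fld_divide fld_mult fld_one)
  have "2 * e = 2 * degree s"
    using degree_g_poly[OF e, of c] s s0 \<gamma>0 by (simp add: degree_mult_eq)
  hence deg: "degree s = e" by simp
  have "s * reflect_poly s dvd ?g" by (metis s(1) dvd_smult dvd_refl)
  then obtain v where v: "cyc m = s * reflect_poly s * v"
    using dvd cyc_dvd[OF m(2)] by (meson dvdE dvd_trans)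
  have op: "over_prime (s * reflect_poly s)" using s by (intro over_prime_mult over_prime_reflect)
  have v_op: "over_prime v"
    using over_prime_cofactor[OF over_prime_cyc op v] s0 by simp
  have trR: "tr m (z * poly (R_poly p e c) z) = \<gamma> * tr m ((twist (reflect_poly s) z) ^ 2)"
    if z: "z \<in> fld m" for z
  proof -
    have "tr m (z * poly (R_poly p e c) z) = tr m (\<gamma> * (z ^ (p ^ degree s) * twist s (twist (reflect_poly s) z)))"
      unfolding deg using tr_R_poly[OF z c e] s by (simp add: twist_smult twist_mult over_prime_reflect mult_ac)
    also have "\<dots> = \<gamma> * tr m (z ^ (p ^ degree s) * twist s (twist (reflect_poly s) z))"
      by (rule tr_scale[OF \<gamma>])
    also have "tr m (z ^ (p ^ degree s) * twist s (twist (reflect_poly s) z)) = tr m ((twist (reflect_poly s) z) ^ 2)"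
      unfolding power2_eq_square
      by (rule tr_adjoint) (use s z in \<open>auto intro: twist_mem over_prime_reflect\<close>)
    finally show ?thesis .
  qed
  let ?f = "\<lambda>a. a * poly (R_poly p e c) a"
  have R_mem: "?f a \<in> fld m" if a: "a \<in> fld m" for a
  proof -
    have two_mem: "2 \<in> fld m" using fld_add[OF fld_one fld_one] by simp
    have "c i \<in> fld m" if "i < e" for i using c[OF that] by (rule fld_1_subset)
    hence "poly (R_poly p e c) a \<in> fld m"
      using a e two_mem by (auto simp: R_poly_def poly_sum poly_monom intro!: fld_add fld_sum fld_mult fld_power)
    thus ?thesis using a by (rule_tac fld_mult)
  qed
  have fin: "finite (fld m)" using card_fld m by auto
  have "{(a, b). a \<in> fld m \<and> b \<in> fld m \<and> b ^ p - b = ?f a} = (SIGMA a:fld m. {b\<in>fld m. b ^ p - b = ?f a})"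
    by auto
  hence "card {(a, b). a \<in> fld m \<and> b \<in> fld m \<and> b ^ p - b = ?f a} = (\<Sum>a\<in>fld m. card {b\<in>fld m. b ^ p - b = ?f a})"
    using fin by simp
  also have "\<dots> = (\<Sum>a\<in>fld m. if tr m (twist (reflect_poly s) a ^ 2) = 0 then p else 0)"
    by (intro sum.cong refl) (use card_artin_schreier[OF m(1) R_mem] trR \<gamma>0 in auto)
  also have "\<dots> = p * card {z\<in>fld m. tr m (twist (reflect_poly s) z ^ 2) = 0}"
    using fin by (subst sum.If_cases) (auto simp: Int_def)
  finally show ?thesis
    using card_trace_square_twist[OF m(1) two s(2,3) v_op v] deg by simp
qed

end

section \<open>Valuation rings\<close>

text \<open>Covers the embedding of \<open>k[x]\<close> into the function field as well as
  evaluations at points, which are not injective. As \<open>ev y\<close> is again such a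
  homomorphism, bivariate evaluation is \<open>ev\<close> applied twice.\<close>

locale comm_hom =
  fixes f :: "'a::comm_ring_1 \<Rightarrow> 'b::comm_ring_1"
  assumes hom_add: "f (x + y) = f x + f y" and hom_mult: "f (x * y) = f x * f y" and hom_1: "f 1 = 1"
begin

lemma hom_0: "f 0 = 0"
  using hom_add[of 0 0] by simp

lemma hom_minus: "f (- x) = - f x"
  using hom_add[of x "-x"] by (simp add: hom_0 eq_neg_iff_add_eq_0 add.commute)

definition ev :: "'b \<Rightarrow> 'a poly \<Rightarrow> 'b" where "ev y B = poly (map_poly f B) y"

lemma ev_0 [simp]: "ev y 0 = 0"
  by (simp add: ev_def)

lemma ev_pCons: "ev y (pCons a B) = f a + y * ev y B"
  by (simp add: ev_def map_poly_pCons hom_0)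

lemma ev_const: "ev y [:a:] = f a"
  by (simp add: ev_pCons)

lemma ev_add: "ev y (A + B) = ev y A + ev y B"
  by (induction A B rule: poly_induct2) (simp_all add: ev_pCons hom_add algebra_simps)

lemma ev_smult: "ev y (smult a B) = f a * ev y B"
  by (induction B) (simp_all add: ev_pCons hom_mult algebra_simps)

lemma ev_mult: "ev y (A * B) = ev y A * ev y B"
  by (induction A) (simp_all add: ev_pCons ev_add ev_smult hom_0 algebra_simps)

lemma ev_1: "ev y 1 = 1"
  using ev_const[of y 1] by (simp add: hom_1 one_pCons)

lemma comm_hom_ev: "comm_hom (ev y)"
  by unfold_locales (auto simp: ev_add ev_mult ev_1)

lemma ev_X: "ev y [:0, 1:] = y"
  by (simp add: ev_pCons hom_0 hom_1)

lemma ev_altdef: "degree B \<le> d \<Longrightarrow> ev y B = (\<Sum>i\<le>d. f (coeff B i) * y ^ i)"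
proof -
  assume d: "degree B \<le> d"
  have "degree (map_poly f B) \<le> d" using d by (intro degree_le) (auto simp: coeff_map_poly hom_0 coeff_eq_0)
  moreover have "poly Q y = (\<Sum>i\<le>d. coeff Q i * y ^ i)" if "degree Q \<le> d" for Q
    unfolding poly_altdef using that
    by (intro sum.mono_neutral_left) (auto simp: coeff_eq_0)
  ultimately show ?thesis by (simp add: ev_def coeff_map_poly hom_0)
qed

lemma ev_uminus: "ev y (- B) = - ev y B"
  using comm_hom.hom_minus[OF comm_hom_ev] .

lemma ev_diff: "ev y (A - B) = ev y A - ev y B"
  using ev_add[of y A "-B"] by (simp add: ev_uminus)

lemma ev_power: "ev y (A ^ n) = ev y A ^ n"
  by (induction n) (simp_all add: ev_1 ev_mult)

lemma ev_sum: "ev y (\<Sum>i\<in>I. g i) = (\<Sum>i\<in>I. ev y (g i))"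
  by (induction I rule: infinite_finite_induct) (simp_all add: ev_add)

lemma ev_prod: "ev y (\<Prod>i\<in>I. g i) = (\<Prod>i\<in>I. ev y (g i))"
  by (induction I rule: infinite_finite_induct) (simp_all add: ev_mult ev_1)

lemma ev_monom: "ev y (monom a n) = f a * y ^ n"
  by (induction n) (simp_all add: monom_0 monom_Suc ev_pCons hom_0 mult_ac)

end

definition is_subring :: "'a::comm_ring_1 set \<Rightarrow> bool" where
  "is_subring R \<longleftrightarrow> 0 \<in> R \<and> 1 \<in> R \<and> (\<forall>u\<in>R. \<forall>v\<in>R. u + v \<in> R \<and> u * v \<in> R) \<and> (\<forall>u\<in>R. - u \<in> R)"

locale val_ring =
  fixes F V :: "'a::field set"
  assumes F: "is_subfield F" and sub: "V \<subseteq> F" and V: "is_subring V"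
    and val: "z \<in> F \<Longrightarrow> z \<in> V \<or> inverse z \<in> V"
begin

definition M :: "'a set" where "M = {z\<in>V. z = 0 \<or> inverse z \<notin> V}"

lemma V_0: "0 \<in> V" and V_1: "1 \<in> V" and V_add: "u \<in> V \<Longrightarrow> v \<in> V \<Longrightarrow> u + v \<in> V"
  and V_mult: "u \<in> V \<Longrightarrow> v \<in> V \<Longrightarrow> u * v \<in> V" and V_minus: "u \<in> V \<Longrightarrow> - u \<in> V"
  using V by (auto simp: is_subring_def)

lemma V_diff: "u \<in> V \<Longrightarrow> v \<in> V \<Longrightarrow> u - v \<in> V"
  using V_add[of u "-v"] V_minus by simp

lemma V_power: "u \<in> V \<Longrightarrow> u ^ n \<in> V"
  by (induction n) (auto simp: V_1 V_mult)

lemma V_sum: "(\<And>i. i \<in> I \<Longrightarrow> g i \<in> V) \<Longrightarrow> sum g I \<in> V"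
  by (induction I rule: infinite_finite_induct) (auto simp: V_0 V_add)

lemma M_V: "u \<in> M \<Longrightarrow> u \<in> V"
  by (simp add: M_def)

lemma M_0: "0 \<in> M"
  by (simp add: M_def V_0)

lemma not_V_M: "z \<in> F \<Longrightarrow> z \<notin> V \<Longrightarrow> inverse z \<in> M"
  using val[of z] V_0 by (auto simp: M_def)

lemma unit_V: "z \<in> V \<Longrightarrow> z \<notin> M \<Longrightarrow> inverse z \<in> V"
  by (auto simp: M_def)

lemma unit_not_M: "z \<noteq> 0 \<Longrightarrow> inverse z \<in> V \<Longrightarrow> z \<notin> M"
  by (auto simp: M_def)

lemma one_not_M: "1 \<notin> M"
  by (simp add: M_def V_1)

lemma M_mult: "u \<in> M \<Longrightarrow> v \<in> V \<Longrightarrow> u * v \<in> M"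
proof -
  assume u: "u \<in> M" and v: "v \<in> V"
  have "inverse u \<in> V" if "u \<noteq> 0" "v \<noteq> 0" "inverse (u * v) \<in> V"
    using V_mult[OF that(3) v] that by (simp add: field_simps)
  thus ?thesis using u v V_mult by (auto simp: M_def)
qed

lemma M_mult': "v \<in> V \<Longrightarrow> u \<in> M \<Longrightarrow> v * u \<in> M"
  using M_mult by (simp add: mult.commute)

lemma M_minus: "u \<in> M \<Longrightarrow> - u \<in> M"
  using M_mult[of u "-1"] V_minus[OF V_1] by simp

lemma F_divide: "u \<in> F \<Longrightarrow> v \<in> F \<Longrightarrow> u / v \<in> F"
  using F by (auto simp: is_subfield_def divide_inverse)

text \<open>One of the quotients \<open>u / v\<close> and \<open>v / u\<close> lies in
  \<open>V\<close>, so the sum is an element of \<open>M\<close> times an element of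
  \<open>V\<close>.\<close>

lemma M_add:
  assumes "u \<in> M" "v \<in> M"
  shows "u + v \<in> M"
proof -
  have *: "u + v \<in> M" if uv: "u \<in> M" "v \<in> M" "u / v \<in> V" "v \<noteq> 0" for u v
  proof -
    have "u + v = v * (1 + u / v)" using that by (simp add: field_simps)
    thus ?thesis using M_mult[OF uv(2)] V_add[OF V_1 uv(3)] by simp
  qed
  show ?thesis
  proof (cases "u = 0 \<or> v = 0")
    case False
    have "u / v \<in> F" using assms M_V sub F_divide by blast
    hence "u / v \<in> V \<or> v / u \<in> V" using val[of "u / v"] by (simp add: inverse_eq_divide)
    thus ?thesis using *[of u v] *[of v u] assms False by (auto simp: add.commute)
  qed (use assms in auto)
qed

lemma M_diff: "u \<in> M \<Longrightarrow> v \<in> M \<Longrightarrow> u - v \<in> M"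
  using M_add[of u "-v"] M_minus by simp

lemma M_sum: "(\<And>i. i \<in> I \<Longrightarrow> g i \<in> M) \<Longrightarrow> sum g I \<in> M"
  by (induction I rule: infinite_finite_induct) (auto simp: M_0 M_add)

lemma M_prime: "u * v \<in> M \<Longrightarrow> u \<in> V \<Longrightarrow> v \<in> V \<Longrightarrow> u \<in> M \<or> v \<in> M"
proof (rule ccontr)
  assume a: "u * v \<in> M" "u \<in> V" "v \<in> V" "\<not> (u \<in> M \<or> v \<in> M)"
  hence "inverse (u * v) \<in> V" using V_mult unit_V by (simp add: mult.commute)
  moreover have "u * v \<noteq> 0" using a M_0 by auto
  ultimately show False using a(1) by (auto simp: M_def)
qed

lemma M_prime_power: "u ^ n \<in> M \<Longrightarrow> u \<in> V \<Longrightarrow> u \<in> M"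
  by (induction n) (use one_not_M M_prime V_power in auto)

lemma M_prime_prod: "finite I \<Longrightarrow> (\<Prod>i\<in>I. g i) \<in> M \<Longrightarrow> (\<And>i. i \<in> I \<Longrightarrow> g i \<in> V) \<Longrightarrow> \<exists>i\<in>I. g i \<in> M"
proof (induction I rule: finite_induct)
  case (insert i I)
  have "prod g J \<in> V" if "\<And>i. i \<in> J \<Longrightarrow> g i \<in> V" for J
    using that by (induction J rule: infinite_finite_induct) (auto simp: V_1 V_mult)
  hence "prod g I \<in> V" using insert.prems(2) by blast
  thus ?case using insert M_prime[of "g i" "prod g I"] by auto
qed (use one_not_M in simp)

lemma power_V: "z \<in> F \<Longrightarrow> z ^ n \<in> V \<Longrightarrow> n > 0 \<Longrightarrow> z \<in> V"
proof (rule ccontr)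
  assume a: "z \<in> F" "z ^ n \<in> V" "n > 0" "z \<notin> V"
  hence "inverse z \<in> M" by (rule_tac not_V_M)
  hence "inverse z ^ n \<in> M" using \<open>n > 0\<close>
    by (cases n) (use M_mult V_power M_V in \<open>auto simp del: power_inverse\<close>)
  moreover have "z \<noteq> 0" using a V_0 by auto
  ultimately show False using a(2) M_mult[of "inverse z ^ n" "z ^ n"] one_not_M
    by (simp add: power_inverse)
qed

lemma mult_unit_V_iff:
  assumes "u \<in> V" "u \<notin> M" shows "z * u \<in> V \<longleftrightarrow> z \<in> V"
proof
  assume "z * u \<in> V"
  hence "z * u * inverse u \<in> V" using unit_V[OF assms] V_mult by blast
  moreover have "u \<noteq> 0" using assms M_0 by auto
  ultimately show "z \<in> V" by (simp add: mult.assoc)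
qed (use assms V_mult in auto)

end

lemma is_subringD:
  assumes "is_subring R"
  shows "0 \<in> R" "1 \<in> R" "u \<in> R \<Longrightarrow> v \<in> R \<Longrightarrow> u + v \<in> R" "u \<in> R \<Longrightarrow> v \<in> R \<Longrightarrow> u * v \<in> R"
    "u \<in> R \<Longrightarrow> - u \<in> R" "u \<in> R \<Longrightarrow> v \<in> R \<Longrightarrow> u - v \<in> R" "u \<in> R \<Longrightarrow> u ^ n \<in> R"
proof -
  note * = assms[unfolded is_subring_def]
  show "0 \<in> R" "1 \<in> R" "u \<in> R \<Longrightarrow> v \<in> R \<Longrightarrow> u + v \<in> R" "u \<in> R \<Longrightarrow> v \<in> R \<Longrightarrow> u * v \<in> R"
    "u \<in> R \<Longrightarrow> - u \<in> R" using * by auto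
  show "u - v \<in> R" if "u \<in> R" "v \<in> R" using * that by (metis add_uminus_conv_diff)
  show "u ^ n \<in> R" if "u \<in> R" using * that by (induction n) auto
qed

lemma is_subring_sum: "is_subring R \<Longrightarrow> (\<And>i. i \<in> I \<Longrightarrow> g i \<in> R) \<Longrightarrow> sum g I \<in> R"
  by (induction I rule: infinite_finite_induct) (auto simp: is_subringD)

definition adjoin :: "'a::comm_ring_1 set \<Rightarrow> 'a \<Rightarrow> 'a set" where
  "adjoin R z = {poly P z | P. \<forall>i. coeff P i \<in> R}"

lemma adjoin:
  assumes "is_subring R"
  shows "is_subring (adjoin R z)" "R \<subseteq> adjoin R z" "z \<in> adjoin R z"
proof -
  note R = is_subringD[OF assms]
  have I: "poly P z \<in> adjoin R z" if "\<And>i. coeff P i \<in> R" for P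
    using that by (auto simp: adjoin_def)
  show "is_subring (adjoin R z)"
    unfolding is_subring_def
  proof (intro conjI ballI)
    show "0 \<in> adjoin R z" using I[of 0] R by simp
    show "1 \<in> adjoin R z" using I[of 1] R by (simp add: coeff_1)
    fix u assume "u \<in> adjoin R z"
    then obtain P where P: "u = poly P z" "\<And>i. coeff P i \<in> R" by (auto simp: adjoin_def)
    show "- u \<in> adjoin R z" using I[of "-P"] P R by simp
    fix v assume "v \<in> adjoin R z"
    then obtain Q where Q: "v = poly Q z" "\<And>i. coeff Q i \<in> R" by (auto simp: adjoin_def)
    show "u + v \<in> adjoin R z" using I[of "P + Q"] P Q R by simp
    have "coeff (P * Q) i \<in> R" for i
      unfolding coeff_mult using P Q R by (intro is_subring_sum[OF assms]) auto
    thus "u * v \<in> adjoin R z" using I[of "P * Q"] P Q by simp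
  qed
  show "R \<subseteq> adjoin R z"
    using I[of "[:_:]"] R by (auto simp: coeff_pCons split: nat.splits)
  show "z \<in> adjoin R z"
    using I[of "[:0, 1:]"] R by (simp add: coeff_pCons split: nat.splits)
qed

text \<open>Chevalley's extension theorem, for the ideal generated by one element.\<close>

theorem exists_val_ring:
  fixes u :: "'a::field"
  assumes R0: "is_subring R0" "u \<in> R0" "inverse u \<notin> R0"
  shows "\<exists>V. val_ring UNIV V \<and> R0 \<subseteq> V \<and> inverse u \<notin> V"
proof -
  define \<R> where "\<R> = {R. is_subring R \<and> R0 \<subseteq> R \<and> inverse u \<notin> R}"
  have "\<exists>R\<in>\<R>. \<forall>Y\<in>\<R>. R \<subseteq> Y \<longrightarrow> Y = R"
  proof (rule subset_Zorn)
    fix \<K> assume C: "subset.chain \<R> \<K>"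
    show "\<exists>U\<in>\<R>. \<forall>Y\<in>\<K>. Y \<subseteq> U"
    proof (cases "\<K> = {}")
      case True
      thus ?thesis using R0 by (auto simp: \<R>_def)
    next
      case False
      have CA: "Y \<in> \<R>" if "Y \<in> \<K>" for Y using C that by (auto simp: subset.chain_def)
      hence sr: "is_subring Y" if "Y \<in> \<K>" for Y using that by (auto simp: \<R>_def)
      have two: "\<exists>Y\<in>\<K>. a \<in> Y \<and> b \<in> Y" if ab: "a \<in> \<Union>\<K>" "b \<in> \<Union>\<K>" for a b
      proof -
        from ab obtain Y Y2 where XY: "Y \<in> \<K>" "Y2 \<in> \<K>" "a \<in> Y" "b \<in> Y2" by blast
        hence "Y \<subseteq> Y2 \<or> Y2 \<subseteq> Y" using C by (auto simp: subset_chain_def)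
        thus ?thesis using XY by blast
      qed
      have "is_subring (\<Union>\<K>)"
        unfolding is_subring_def
      proof (intro conjI ballI)
        show "0 \<in> \<Union>\<K>" "1 \<in> \<Union>\<K>" using False sr is_subringD(1,2) by blast+
        show "- a \<in> \<Union>\<K>" if "a \<in> \<Union>\<K>" for a using that sr is_subringD(5) by blast
        fix a b assume "a \<in> \<Union>\<K>" "b \<in> \<Union>\<K>"
        then obtain Y where "Y \<in> \<K>" "a \<in> Y" "b \<in> Y" using two by blast
        thus "a + b \<in> \<Union>\<K>" "a * b \<in> \<Union>\<K>" using sr is_subringD(3,4) by blast+
      qed
      hence "\<Union>\<K> \<in> \<R>" using CA False by (auto simp: \<R>_def)
      thus ?thesis by blast
    qed
  qed
  then obtain R where "R \<in> \<R>" and max: "\<And>Y. Y \<in> \<R> \<Longrightarrow> R \<subseteq> Y \<Longrightarrow> Y = R" by blast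
  hence R: "is_subring R" "R0 \<subseteq> R" "inverse u \<notin> R" by (auto simp: \<R>_def)
  note RD = is_subringD[OF R(1)]
  have u0: "u \<noteq> 0" using R RD(1) by auto
  have uR: "u \<in> R" using R0 R by auto
  \<comment> \<open>The ideal generated by \<open>u\<close>, proper exactly because
    \<open>inverse u\<close> is missing from \<open>R\<close>.\<close>
  define I where "I = (\<lambda>a. u * a) ` R"
  have I_R: "a \<in> R" if "a \<in> I" for a using that uR RD by (auto simp: I_def)
  have I_add: "a + b \<in> I" if "a \<in> I" "b \<in> I" for a b
    using that RD(3) by (auto simp: I_def distrib_left[symmetric])
  have I_mult: "a * b \<in> I" if "a \<in> I" "b \<in> R" for a b
    using that RD(4) by (auto simp: I_def mult.assoc)
  have I_0: "0 \<in> I" using RD(1) by (auto simp: I_def)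
  have I_sum: "sum g J \<in> I" if "\<And>i. i \<in> J \<Longrightarrow> g i \<in> I" for g :: "nat \<Rightarrow> 'a" and J
    using that by (induction J rule: infinite_finite_induct) (auto simp: I_0 I_add)
  have I_1: "1 \<notin> I"
  proof
    assume "1 \<in> I"
    then obtain a where "a \<in> R" "u * a = 1" by (auto simp: I_def)
    thus False using R(3) inverse_unique by blast
  qed
  \<comment> \<open>By maximality \<open>R[z]\<close> contains \<open>inverse u\<close>; multiplying
    its expression by \<open>u\<close> writes 1 as a polynomial in \<open>z\<close> with
    coefficients in \<open>I\<close>.\<close>
  have ex: "\<exists>P. (\<forall>i. coeff P i \<in> I) \<and> poly P z = 1" if z: "z \<notin> R" for z
  proof -
    have "adjoin R z \<noteq> R" using adjoin(3)[OF R(1)] z by blast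
    hence "adjoin R z \<notin> \<R>" using max adjoin(2)[OF R(1)] by blast
    hence "inverse u \<in> adjoin R z" using adjoin(1,2)[OF R(1)] R by (auto simp: \<R>_def)
    then obtain P where P: "inverse u = poly P z" "\<forall>i. coeff P i \<in> R" by (auto simp: adjoin_def)
    have "u * poly P z = 1" using u0 by (simp flip: P(1))
    hence "poly (smult u P) z = 1" by simp
    moreover have "\<forall>i. coeff (smult u P) i \<in> I" using P(2) by (auto simp: I_def)
    ultimately show ?thesis by blast
  qed
  \<comment> \<open>If \<open>1 - b\<close> had no inverse in \<open>R\<close>, clearing
    denominators in the relation for that inverse would put a power of \<open>1 - b\<close> into
    \<open>I\<close>; but this power differs from 1 by an element of \<open>I\<close>.\<close>
  have unit: "inverse (1 - b) \<in> R" if b: "b \<in> I" for b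
  proof (rule ccontr)
    let ?w = "1 - b"
    assume "inverse ?w \<notin> R"
    then obtain P where P: "\<And>i. coeff P i \<in> I" "poly P (inverse ?w) = 1" using ex by blast
    have w0: "?w \<noteq> 0" using b I_1 by auto
    have wR: "?w \<in> R" by (intro RD(6) RD(2) I_R b)
    let ?d = "degree P"
    have "?w ^ ?d = ?w ^ ?d * poly P (inverse ?w)" using P by simp
    also have "\<dots> = (\<Sum>i\<le>?d. coeff P i * ?w ^ (?d - i))"
      unfolding poly_altdef sum_distrib_left
    proof (intro sum.cong refl)
      fix i assume "i \<in> {..?d}"
      hence "?w ^ ?d = ?w ^ (?d - i) * ?w ^ i" by (simp flip: power_add)
      thus "?w ^ ?d * (coeff P i * inverse ?w ^ i) = coeff P i * ?w ^ (?d - i)"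
        using w0 by (simp add: field_simps)
    qed
    also have "\<dots> \<in> I" using P wR RD by (intro I_sum I_mult) auto
    finally have wI: "?w ^ ?d \<in> I" .
    have "1 - ?w ^ j \<in> I" for j
    proof (induction j)
      case (Suc j)
      have "1 - ?w ^ Suc j = (1 - ?w ^ j) + b * ?w ^ j" by (simp add: algebra_simps)
      moreover have "b * ?w ^ j \<in> I" by (intro I_mult b RD(7) wR)
      ultimately show ?case using I_add[OF Suc] by (simp only:)
    qed (simp add: I_0)
    from I_add[OF this[of ?d] wI] show False using I_1 by simp
  qed
  \<comment> \<open>The relation for \<open>inverse z\<close>, multiplied by \<open>z ^ ?m\<close>
    and divided by the unit \<open>w\<close>, expresses \<open>z ^ ?m\<close> by lower powers with
    coefficients in \<open>I\<close>. Substituting it removes the leading term of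
    \<open>P\<close>.\<close>
  have reduce: "\<exists>P'. (\<forall>i. coeff P' i \<in> I) \<and> poly P' z = 1 \<and> degree P' < degree P"
    if z: "z \<noteq> 0" and P: "\<And>i. coeff P i \<in> I" "poly P z = 1"
      and Q: "\<And>i. coeff Q i \<in> I" "poly Q (inverse z) = 1" and deg: "degree Q \<le> degree P" for z P Q
  proof -
    let ?m = "degree P"
    define w where "w = 1 - coeff Q 0"
    define a where "a = coeff P ?m"
    have wR: "inverse w \<in> R" using unit Q by (simp add: w_def)
    have w0: "w \<noteq> 0" using Q(1)[of 0] I_1 by (auto simp: w_def)
    have m0: "?m > 0"
    proof (rule Nat.gr0I)
      assume "?m = 0"
      then obtain b where "P = [:b:]" by (metis degree_eq_zeroE)
      thus False using P(1)[of 0] P(2) I_1 by simp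
    qed
    define S where "S = (\<Sum>j=1..?m. monom (coeff Q j) (?m - j))"
    have "poly Q (inverse z) = (\<Sum>j\<le>?m. coeff Q j * inverse z ^ j)"
      unfolding poly_altdef using deg by (intro sum.mono_neutral_left) (auto simp: coeff_eq_0)
    also have "\<dots> = coeff Q 0 + (\<Sum>j=1..?m. coeff Q j * inverse z ^ j)"
      by (simp add: atMost_atLeast0 sum.atLeast_Suc_atMost)
    finally have "w = (\<Sum>j=1..?m. coeff Q j * inverse z ^ j)" using Q(2) by (simp add: w_def algebra_simps)
    hence "w * z ^ ?m = (\<Sum>j=1..?m. coeff Q j * inverse z ^ j * z ^ ?m)" by (simp add: sum_distrib_right)
    also have "\<dots> = poly S z"
      unfolding S_def poly_sum poly_monom
    proof (intro sum.cong refl)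
      fix j assume "j \<in> {1..?m}"
      hence "z ^ ?m = z ^ (?m - j) * z ^ j" by (simp flip: power_add)
      thus "coeff Q j * inverse z ^ j * z ^ ?m = coeff Q j * z ^ (?m - j)"
        using z by (simp add: field_simps)
    qed
    finally have S: "z ^ ?m = inverse w * poly S z" using w0 by (simp add: field_simps)
    define P' where "P' = (P - monom a ?m) + smult (a * inverse w) S"
    have coS: "coeff S i \<in> I" for i
      unfolding S_def coeff_sum using Q I_0 by (intro I_sum) auto
    have "a \<in> I" using P by (simp add: a_def)
    have "coeff P' i \<in> I" for i
    proof -
      have "coeff (P - monom a ?m) i \<in> I" using P I_0 by (simp add: a_def)
      moreover have "coeff S i * (a * inverse w) \<in> I"
        using I_mult[OF coS] RD(4)[OF I_R[OF \<open>a \<in> I\<close>] wR] by blast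
      ultimately show ?thesis using I_add unfolding P'_def by (simp add: mult.commute)
    qed
    moreover have "poly P' z = 1"
      using P(2) S by (simp add: P'_def poly_monom mult.assoc)
    moreover have "degree P' < ?m"
    proof -
      have "coeff P' i = 0" if "i \<ge> ?m" for i
      proof -
        have "coeff S i = 0" unfolding S_def coeff_sum using that m0 by (intro sum.neutral) auto
        moreover have "coeff (P - monom a ?m) i = 0"
          using that by (cases "i = ?m") (auto simp: a_def coeff_eq_0)
        ultimately show ?thesis by (simp add: P'_def)
      qed
      hence "degree P' \<le> ?m - 1" using m0 by (intro degree_le) auto
      thus ?thesis using m0 by linarith
    qed
    ultimately show ?thesis by blast
  qed
  \<comment> \<open>Descent on the sum of the degrees: whichever of the two relations has the larger
    degree is shortened by the other.\<close>
  have no: False if "z \<noteq> 0" "\<forall>i. coeff P i \<in> I" "poly P z = 1" "\<forall>i. coeff Q i \<in> I" "poly Q (inverse z) = 1"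
    for z P Q
    using that
  proof (induction "degree P + degree Q" arbitrary: P Q z rule: less_induct)
    case less
    show False
    proof (cases "degree Q \<le> degree P")
      case True
      then obtain P' where "\<forall>i. coeff P' i \<in> I" "poly P' z = 1" "degree P' < degree P"
        using reduce[of z P Q] less.prems by blast
      thus False using less.hyps[of P' Q z] less.prems by simp
    next
      case False
      then obtain Q' where "\<forall>i. coeff Q' i \<in> I" "poly Q' (inverse z) = 1" "degree Q' < degree Q"
        using reduce[of "inverse z" Q P] less.prems by auto
      thus False using less.hyps[of P Q' z] less.prems by simp
    qed
  qed
  have "val_ring UNIV R"
  proof
    show "is_subfield (UNIV::'a set)" by (simp add: is_subfield_def)
    show "is_subring R" by fact
    fix z :: 'a
    show "z \<in> R \<or> inverse z \<in> R"
    proof (rule ccontr)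
      assume a: "\<not> (z \<in> R \<or> inverse z \<in> R)"
      hence "z \<noteq> 0" using RD(1) by auto
      thus False using no ex[of z] ex[of "inverse z"] a by blast
    qed
  qed simp
  thus ?thesis using R by blast
qed

section \<open>The place at infinity\<close>

lemma comm_hom_to_ac: "comm_hom (to_ac :: 'a::field \<Rightarrow> 'a alg_closure)"
  by unfold_locales auto

lemma (in val_ring) M_power: "u \<in> M \<Longrightarrow> i > 0 \<Longrightarrow> u ^ i \<in> M"
  by (cases i) (use M_mult[OF _ V_power[OF M_V]] in auto)

text \<open>Places, rational points and genus are treated for any right-hand side \<open>h\<close>
  of degree \<open>N\<close> prime to \<open>p\<close>; the special \<open>h = x R(x)\<close> enters
  in \<open>self_reciprocal_curve\<close>.\<close>

locale artin_schreier =
  fixes p0 p n N :: nat and h :: "'k::{finite,field} poly"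
  assumes p0: "prime p0" and p_pow: "\<exists>a\<ge>1. p = p0 ^ a" and char: "CHAR('k) = p0"
    and card_k: "CARD('k) = p ^ n" and n0: "n > 0"
    and degree_h: "degree h = N" and N0: "N > 0" and coprime: "coprime p N"
begin

lemma p_gt_1: "p > 1"
  using p_pow p0 by (metis one_less_power prime_gt_1_nat less_le_trans zero_less_one)

lemma freshman: "CHAR('b) = p0 \<Longrightarrow> (x + y :: 'b::comm_semiring_1) ^ p = x ^ p + y ^ p"
  using p_pow p0 freshmans_dream' by metis

lemma char_ambient: "CHAR('k ambient) = p0"
proof -
  have "CHAR('k poly fract) = p0"
  proof (rule CHAR_eqI)
    have of_nat: "(of_nat m :: 'k poly fract) = to_fract [:of_nat m:]" for m
      by (induction m) (simp_all flip: to_fract_1 to_fract_add add: one_pCons)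
    have z: "(of_nat m :: 'k poly fract) = 0 \<longleftrightarrow> p0 dvd m" for m
      using of_nat_eq_0_iff_char_dvd[where ?'a = 'k, of m] by (simp add: of_nat char)
    show "of_nat p0 = (0 :: 'k poly fract)" using z by simp
    show "p0 dvd m" if "of_nat m = (0 :: 'k poly fract)" for m using z that by simp
  qed
  thus ?thesis by simp
qed

lemma frobenius_closure: "frobenius_power (\<lambda>z :: 'k alg_closure. z ^ p) p"
proof
  have "p0 dvd p" using p_pow by (auto simp: dvd_power)
  thus "of_nat p = (0 :: 'k alg_closure)" using of_nat_eq_0_iff_char_dvd[where ?'a = "'k alg_closure", of p] char by simp
  show "(x + y :: 'k alg_closure) ^ p = x ^ p + y ^ p" for x y by (rule freshman) (simp add: char)
qed (use p_gt_1 in auto)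

lemma frobenius_ambient: "frobenius_power (\<lambda>z :: 'k ambient. z ^ p) p"
proof
  have "p0 dvd p" using p_pow by (auto simp: dvd_power)
  thus "of_nat p = (0 :: 'k ambient)"
    using of_nat_eq_0_iff_char_dvd[where ?'a = "'k ambient", of p] char_ambient by simp
  show "(x + y :: 'k ambient) ^ p = x ^ p + y ^ p" for x y by (rule freshman) (rule char_ambient)
qed (use p_gt_1 in auto)

definition embed :: "'k poly \<Rightarrow> 'k ambient" where "embed B = to_ac (to_fract B)"

definition f :: "'k poly poly" where "f = monom 1 p - monom 1 1 - [:h:]"

definition eta :: "'k ambient" where "eta = gen_y f"

sublocale em: comm_hom embed
  by unfold_locales (auto simp: embed_def)

text \<open>\<open>E B\<close> is \<open>B(x, \<eta>)\<close>; the range of \<open>E\<close> is the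
  coordinate ring of the affine curve.\<close>

abbreviation E :: "'k poly poly \<Rightarrow> 'k ambient" where "E \<equiv> em.ev eta"

lemma embed_eq_0 [simp]: "embed B = 0 \<longleftrightarrow> B = 0"
  by (simp add: embed_def)

lemma degree_f: "degree f = p"
proof -
  have "f = monom 1 p + (- monom 1 1 - [:h:])" by (simp add: f_def)
  also have "degree \<dots> = p"
  proof (subst degree_add_eq_left)
    have "degree (- monom 1 1 - [:h:]) \<le> 1"
      by (rule degree_diff_le) (auto simp: degree_monom_le)
    thus "degree (- monom 1 1 - [:h:]) < degree (monom (1::'k poly) p)"
      using p_gt_1 by (simp add: degree_monom_eq)
  qed (simp add: degree_monom_eq)
  finally show ?thesis .
qed

lemma lead_coeff_f: "coeff f p = 1"
  using p_gt_1 by (simp add: f_def coeff_pCons split: nat.splits)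

lemma E_f: "E f = 0"
proof -
  have eq: "em.ev y f = poly (map_poly (\<lambda>h. to_ac (to_fract h)) f) y" for y
    unfolding em.ev_def unfolding embed_def[abs_def] ..
  have "degree (map_poly (\<lambda>h. to_ac (to_fract h)) f) = p"
    by (subst degree_map_poly) (auto simp: degree_f lead_coeff_f)
  then obtain y where "poly (map_poly (\<lambda>h. to_ac (to_fract h)) f) y = 0"
    using alg_closed_imp_poly_has_root p_gt_1 by (metis gr_implies_not0 gr0I not_one_less_zero)
  thus ?thesis unfolding eta_def gen_y_def eq by (rule someI)
qed

lemma eta_eq: "eta ^ p - eta = embed h"
  using E_f by (simp add: f_def em.ev_diff em.ev_monom em.ev_const em.hom_1)

lemma h_nz: "h \<noteq> 0" using degree_h N0 by auto

lemma eta_nz: "eta \<noteq> 0"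
  using eta_eq h_nz p_gt_1 by (auto simp: power_0_left)

lemma x_nz: "(gen_x :: 'k ambient) \<noteq> 0"
  by (simp add: gen_x_def)

lemma embed_const: "embed [:a:] = const a"
  by (simp add: embed_def const_def)

lemma const_hom: "const (a + b) = const a + const b" "const (a * b) = const a * const b"
   "const (- a) = - const a" "const 1 = (1 :: 'k ambient)" "const (0::'k) = 0"
   "const (a::'k) = 0 \<longleftrightarrow> a = 0" "const (inverse a) = inverse (const a)"
proof -
  show add: "const (a + b) = const a + const b" and mult: "const (a * b) = const a * const b"
    and "const (- a) = - const a" for a b :: 'k
    by (simp_all add: const_def flip: to_ac_add to_ac_mult to_ac_minus to_fract_add to_fract_mult to_fract_uminus)
  show 1: "const 1 = (1 :: 'k ambient)" "const (0::'k) = 0" by (simp_all add: const_def flip: one_pCons)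
  show "const (a::'k) = 0 \<longleftrightarrow> a = 0" by (simp add: const_def)
  show "const (inverse a) = inverse (const a)"
    using mult[of a "inverse a"] 1 by (cases "a = 0") (auto intro!: inverse_unique[symmetric])
qed

lemma embed_pCons: "embed (pCons a B) = const a + gen_x * embed B"
proof -
  have "pCons a B = [:a:] + [:0, 1:] * B" by simp
  thus ?thesis unfolding embed_const[symmetric] gen_x_def
    by (simp only: em.hom_add em.hom_mult) (simp add: embed_def)
qed

lemma embed_sum: "embed B = (\<Sum>i\<le>degree B. const (coeff B i) * gen_x ^ i)"
proof -
  have "embed B = (\<Sum>i\<le>d. const (coeff B i) * gen_x ^ i)" if "degree B \<le> d" for d
    using that
  proof (induction B arbitrary: d)
    case 0
    thus ?case by (simp add: em.hom_0 const_hom)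
  next
    case (pCons a B)
    show ?case
    proof (cases "B = 0")
      case True
      have "(\<Sum>i\<le>d. const (coeff (pCons a B) i) * gen_x ^ i) = (\<Sum>i\<in>{0}. const (coeff (pCons a B) i) * gen_x ^ i)"
        by (rule sum.mono_neutral_right) (auto simp: True coeff_pCons const_hom split: nat.splits)
      thus ?thesis by (simp add: True embed_const)
    next
      case False
      then obtain d' where d: "d = Suc d'" "degree B \<le> d'" using pCons by (cases d) auto
      show ?thesis
        by (subst d(1), subst sum.atMost_Suc_shift)
          (simp add: embed_pCons pCons.IH[OF d(2)] sum_distrib_left mult_ac)
    qed
  qed
  thus ?thesis by simp
qed

definition mono :: "int \<Rightarrow> int \<Rightarrow> 'k ambient" where
  "mono i j = gen_x powi i * eta powi j"

lemma mono_nz: "mono i j \<noteq> 0"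
  by (simp add: mono_def x_nz eta_nz)

lemma mono_mult: "mono i j * mono i' j' = mono (i + i') (j + j')"
  by (simp add: mono_def power_int_add x_nz eta_nz)

lemma mono_inverse: "inverse (mono i j) = mono (- i) (- j)"
  by (simp add: mono_def power_int_minus)

lemma mono_divide: "mono i j / mono i' j' = mono (i - i') (j - j')"
  by (simp add: divide_inverse mono_inverse mono_mult)

text \<open>The pole order of \<open>x\<^sup>i y\<^sup>j\<close> at infinity.\<close>

definition wt :: "int \<Rightarrow> int \<Rightarrow> int" where "wt i j = int p * i + int N * j"

text \<open>Modulo \<open>p\<close> the weight is \<open>N j\<close>, which determines
  \<open>j\<close> among \<open>0, ..., p - 1\<close> because \<open>N\<close> is prime to
  \<open>p\<close>.\<close>

lemma wt_inj:
  assumes "wt i j = wt i' j'" "0 \<le> j" "j < p" "0 \<le> j'" "j' < p"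
  shows "i = i' \<and> j = j'"
proof -
  have "int p * (i - i') = int N * (j' - j)" using assms(1) by (simp add: wt_def algebra_simps)
  hence "int p dvd int N * (j' - j)" by (metis dvd_triv_left)
  hence "int p dvd j' - j" using coprime by (simp add: coprime_dvd_mult_right_iff)
  hence "j = j'"
  proof -
    assume d: "int p dvd j' - j"
    have "\<bar>j' - j\<bar> < int p" using assms by auto
    thus ?thesis using dvd_imp_le_int[OF _ d] by (cases "j' = j") auto
  qed
  thus ?thesis using assms(1) p_gt_1 by (simp add: wt_def)
qed

text \<open>The term of largest pole order among those of \<open>y\<close>-degree below
  \<open>p\<close>. By \<open>wt_inj\<close> no two terms tie, so this one determines the behaviour
  at infinity.\<close>

definition leading :: "'k poly poly \<Rightarrow> nat \<Rightarrow> nat \<Rightarrow> 'k \<Rightarrow> bool" where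
  "leading B i j l \<longleftrightarrow> j < p \<and> coeff B j \<noteq> 0 \<and> i = degree (coeff B j) \<and> l = lead_coeff (coeff B j) \<and>
     (\<forall>j'<p. j' \<noteq> j \<longrightarrow> coeff B j' \<noteq> 0 \<longrightarrow> wt (degree (coeff B j')) j' < wt i j)"

lemma ex_leading:
  assumes "degree B < p" "B \<noteq> 0"
  shows "\<exists>i j l. leading B i j l"
proof -
  define S where "S = {j. j < p \<and> coeff B j \<noteq> 0}"
  define w where "w j = wt (degree (coeff B j)) j" for j :: nat
  have "degree B \<in> S" using assms by (auto simp: S_def)
  moreover have "finite S" by (simp add: S_def)
  ultimately obtain j where j: "j \<in> S" "\<And>j'. j' \<in> S \<Longrightarrow> w j' \<le> w j"
    using Max_in[of "w ` S"] Max_ge[of "w ` S"] by (metis (no_types, lifting) empty_iff finite_imageI imageE image_eqI)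
  have "w j' < w j" if "j' \<in> S" "j' \<noteq> j" for j'
    using j(2)[OF that(1)] wt_inj[of "degree (coeff B j')" j' "degree (coeff B j)" j] that j(1)
    by (fastforce simp: w_def S_def)
  thus ?thesis using j(1) unfolding leading_def S_def w_def by blast
qed

end

text \<open>With \<open>F = UNIV\<close> such a place is available before anything is known about
  the function field, and yields the independence of \<open>1, y, ..., y ^ (p - 1)\<close> over
  \<open>k(x)\<close>. With \<open>F = C\<close> the locale describes the point at infinity.\<close>

locale infinite_place = artin_schreier p0 p n N h + val_ring F V
  for p0 p n N and h :: "'k::{finite,field} poly" and F V :: "'k ambient set" +
  assumes V_consts: "range const \<subseteq> V" and x_F: "gen_x \<in> F" and eta_F: "eta \<in> F" and x_V: "gen_x \<notin> V"
begin

lemma const_V: "const a \<in> V" using V_consts by auto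

lemma const_M: "const a \<in> M \<longleftrightarrow> a = 0"
proof -
  have "const a \<notin> M" if "a \<noteq> 0"
    using unit_not_M[of "const a"] that const_V[of "inverse a"] by (simp add: const_hom)
  thus ?thesis by (auto simp: const_hom M_0)
qed

lemma F_simps: "u \<in> F \<Longrightarrow> v \<in> F \<Longrightarrow> u * v \<in> F" "u \<in> F \<Longrightarrow> inverse u \<in> F" "1 \<in> F"
  "u \<in> F \<Longrightarrow> v \<in> F \<Longrightarrow> u + v \<in> F" "u \<in> F \<Longrightarrow> - u \<in> F"
  using F by (auto simp: is_subfield_def)

lemma F_power: "u \<in> F \<Longrightarrow> u ^ i \<in> F"
  by (induction i) (auto simp: F_simps)

lemma F_powi: "u \<in> F \<Longrightarrow> u powi i \<in> F"
  by (simp add: power_int_def F_power F_simps)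

lemma mono_F: "mono i j \<in> F"
  by (simp add: mono_def F_simps F_powi x_F eta_F)

lemma inv_x_M: "inverse gen_x \<in> M"
  using not_V_M x_F x_V by blast

lemma embed_lead: "embed B / gen_x ^ degree B - const (lead_coeff B) \<in> M"
proof -
  let ?d = "degree B"
  have "embed B = (\<Sum>i<?d. const (coeff B i) * gen_x ^ i) + const (lead_coeff B) * gen_x ^ ?d"
    unfolding embed_sum by (simp add: lessThan_Suc_atMost[symmetric])
  hence "embed B / gen_x ^ ?d - const (lead_coeff B) = (\<Sum>i<?d. const (coeff B i) * gen_x ^ i / gen_x ^ ?d)"
    using x_nz by (simp add: add_divide_distrib sum_divide_distrib)
  also have "\<dots> \<in> M"
  proof (rule M_sum)
    fix i assume i: "i \<in> {..<?d}"
    hence "(gen_x :: 'k ambient) ^ ?d = gen_x ^ i * gen_x ^ Suc (?d - i - 1)"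
      by (subst power_add[symmetric]) auto
    hence "const (coeff B i) * gen_x ^ i / gen_x ^ ?d = const (coeff B i) * (inverse gen_x * inverse gen_x ^ (?d - i - 1))"
      using x_nz by (simp add: field_simps)
    thus "const (coeff B i) * gen_x ^ i / gen_x ^ ?d \<in> M"
      using M_mult'[OF const_V M_mult[OF inv_x_M V_power[OF M_V[OF inv_x_M]]]] by simp
  qed
  finally show ?thesis .
qed

lemma embed_lead_V: "embed B / gen_x ^ degree B \<in> V"
  using V_add[OF M_V[OF embed_lead[of B]] const_V[of "lead_coeff B"]] by simp

lemma x_power_not_V: "i > 0 \<Longrightarrow> gen_x ^ i \<notin> V"
  using power_V[OF x_F] x_V by blast

lemma lc_nz: "lead_coeff h \<noteq> 0" using h_nz by simp

lemma eta_not_V: "eta \<notin> V"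
proof
  assume "eta \<in> V"
  hence "embed h \<in> V" unfolding eta_eq[symmetric] by (intro V_diff V_power)
  let ?u = "embed h / gen_x ^ N"
  have "?u - const (lead_coeff h) \<in> M" using embed_lead[of h] by (simp add: degree_h)
  hence "?u \<notin> M" using const_M[of "lead_coeff h"] lc_nz M_diff[of ?u "?u - const (lead_coeff h)"] by auto
  moreover have "?u = embed h * inverse gen_x ^ N" by (simp add: field_simps)
  moreover have "inverse gen_x ^ N \<in> M"
    using N0 M_power[OF inv_x_M] by blast
  ultimately show False using M_mult'[OF \<open>embed h \<in> V\<close>] by metis
qed

lemma inv_eta_M: "inverse eta \<in> M"
  using not_V_M eta_F eta_not_V by blast

text \<open>A unit with residue \<open>lead_coeff h\<close>. It expresses
  \<open>p v(\<eta>) = N v(x)\<close> without introducing a value group.\<close>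

definition U :: "'k ambient" where "U = eta ^ p / gen_x ^ N"

text \<open>The curve equation reads \<open>\<eta> ^ p * (1 - t) = h\<close> with
  \<open>t = \<eta> ^ (1 - p)\<close> in \<open>M\<close>, and \<open>h\<close> is asymptotic to its
  leading term.\<close>

lemma U_const: "U - const (lead_coeff h) \<in> M"
proof -
  define t where "t = inverse eta ^ (p - 1)"
  have t: "t \<in> M"
    unfolding t_def using p_gt_1 by (intro M_power inv_eta_M) simp
  have t1: "1 - t \<in> V" "1 - t \<notin> M"
    using V_diff[OF V_1 M_V[OF t]] M_add[of "1 - t" t] t one_not_M by auto
  hence t0: "1 - t \<noteq> 0" using M_0 by auto
  have "eta ^ p = eta ^ (p - 1) * eta" using p_gt_1 power_minus_mult[of p eta] by simp
  hence "eta ^ p * t = eta" using eta_nz by (simp add: t_def field_simps)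
  hence "eta ^ p * (1 - t) = embed h" by (simp add: eta_eq[symmetric] algebra_simps)
  hence e: "U * (1 - t) = embed h / gen_x ^ N" by (simp add: U_def)
  have "(U - const (lead_coeff h)) * (1 - t) = (embed h / gen_x ^ N - const (lead_coeff h)) + const (lead_coeff h) * t"
    using e by (simp add: algebra_simps)
  also have "\<dots> \<in> M" using embed_lead[of h] M_mult'[OF const_V t] M_add by (simp add: degree_h)
  finally have "(U - const (lead_coeff h)) * (1 - t) \<in> M" .
  from M_mult[OF this unit_V[OF t1]] t0 show ?thesis by (simp add: mult.assoc)
qed

lemma U_V: "U \<in> V" and U_M: "U \<notin> M"
proof -
  show "U \<in> V" using V_add[OF M_V[OF U_const] const_V[of "lead_coeff h"]] by simp
  show "U \<notin> M"
  proof
    assume "U \<in> M"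
    from M_diff[OF this U_const] have "const (lead_coeff h) \<in> M" by (simp add: algebra_simps)
    thus False using const_M lc_nz by simp
  qed
qed

lemma U_powi: "U powi j \<in> V" "U powi j \<notin> M"
proof -
  have *: "u ^ i \<in> V \<and> u ^ i \<notin> M" if "u \<in> V" "u \<notin> M" for u and i :: nat
    using that M_prime_power V_power by blast
  have U0: "U \<noteq> 0" using U_M M_0 by auto
  have "inverse U \<in> V" "inverse U \<notin> M" using unit_V[OF U_V U_M] unit_not_M[of "inverse U"] U_V U0 by auto
  with * U_V U_M show "U powi j \<in> V" "U powi j \<notin> M" by (auto simp: power_int_def)
qed

text \<open>Up to a unit, the \<open>p\<close>-th power of a monomial is the power of
  \<open>x\<close> with exponent \<open>wt i j\<close>. So the sign of the weight decides membership
  in \<open>V\<close> and \<open>M\<close>.\<close>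

lemma mono_power_p: "mono i j ^ p = gen_x powi (wt i j) * U powi j"
proof -
  have "U powi j = eta powi (int p * j) / gen_x powi (int N * j)"
    by (simp add: U_def power_int_divide_distrib power_int_power)
  moreover have "mono i j ^ p = gen_x powi (int p * i) * eta powi (int p * j)"
    by (simp add: mono_def power_mult_distrib power_int_power' mult.commute)
  moreover have "(gen_x :: 'k ambient) powi (wt i j) = gen_x powi (int p * i) * gen_x powi (int N * j)"
    by (simp add: wt_def power_int_add x_nz)
  ultimately show ?thesis using x_nz by simp
qed

lemma mono_not_V: "wt i j > 0 \<Longrightarrow> mono i j \<notin> V"
proof
  assume w: "wt i j > 0" and "mono i j \<in> V"
  hence "gen_x powi (wt i j) * U powi j \<in> V" using V_power mono_power_p by metis
  hence "gen_x ^ nat (wt i j) \<in> V" using w mult_unit_V_iff[OF U_powi] by (simp add: power_int_def)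
  thus False using x_power_not_V w by simp
qed

lemma mono_M: "wt i j < 0 \<Longrightarrow> mono i j \<in> M"
proof -
  assume "wt i j < 0"
  hence "wt (- i) (- j) > 0" by (simp add: wt_def)
  from not_V_M[OF mono_F mono_not_V[OF this]] show ?thesis by (simp add: mono_inverse)
qed

lemma mono_0: "wt i j = 0 \<Longrightarrow> \<exists>m. mono i j = U powi m \<and> i = - int N * m \<and> j = int p * m"
proof -
  assume w: "wt i j = 0"
  hence "int p * i = - (int N * j)" by (simp add: wt_def)
  hence "int p dvd int N * j" by (metis dvd_minus_iff dvd_triv_left)
  hence "int p dvd j" using coprime by (simp add: coprime_dvd_mult_right_iff)
  then obtain m where m: "j = int p * m" by (elim dvdE)
  hence "int p * i = int p * (- int N * m)" using w by (simp add: wt_def algebra_simps)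
  hence i: "i = - int N * m" by (rule mult_left_cancel[THEN iffD1, rotated]) (use p_gt_1 in simp)
  have "mono i j = U powi m"
    by (simp add: mono_def U_def i m power_int_divide_distrib power_int_power power_int_minus field_simps)
  thus ?thesis using i m by blast
qed

lemma leading_M:
  assumes "leading B i j l" "degree B < p"
  shows "E B / mono i j - const l \<in> M"
proof -
  have j: "j < p" "i = degree (coeff B j)" "l = lead_coeff (coeff B j)"
    and less: "\<And>j'. j' < p \<Longrightarrow> j' \<noteq> j \<Longrightarrow> coeff B j' \<noteq> 0 \<Longrightarrow> wt (degree (coeff B j')) j' < wt i j"
    using assms by (auto simp: leading_def)
  have m: "gen_x ^ a * eta ^ b = mono (int a) (int b)" for a b by (simp add: mono_def)
  have split: "embed (coeff B j') * eta ^ j' / mono i j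
      = embed (coeff B j') / gen_x ^ degree (coeff B j') * mono (int (degree (coeff B j')) - i) (int j' - j)" for j'
    unfolding mono_divide[symmetric] m[symmetric] using x_nz by simp
  have "E B = (\<Sum>j'<p. embed (coeff B j') * eta ^ j')"
    using em.ev_altdef[of B "p - 1"] assms(2) p_gt_1 by (simp add: lessThan_Suc_atMost[symmetric])
  hence "E B / mono i j - const l = (\<Sum>j'<p. embed (coeff B j') * eta ^ j' / mono i j) - const l"
    by (simp add: sum_divide_distrib)
  also have "\<dots> = (\<Sum>j'\<in>{..<p} - {j}. embed (coeff B j') * eta ^ j' / mono i j) + (embed (coeff B j) * eta ^ j / mono i j - const l)"
    using j by (subst sum.remove[of _ j]) auto
  also have "\<dots> \<in> M"
  proof (intro M_add M_sum)
    have "mono 0 0 = 1" by (simp add: mono_def)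
    thus "embed (coeff B j) * eta ^ j / mono i j - const l \<in> M"
      using embed_lead[of "coeff B j"] unfolding split by (simp add: j)
    fix j' assume j': "j' \<in> {..<p} - {j}"
    show "embed (coeff B j') * eta ^ j' / mono i j \<in> M"
    proof (cases "coeff B j' = 0")
      case False
      hence "wt (int (degree (coeff B j')) - i) (int j' - j) < 0"
        using less[of j'] j' by (simp add: wt_def algebra_simps)
      thus ?thesis unfolding split using M_mult'[OF embed_lead_V mono_M] by blast
    qed (simp add: em.hom_0 M_0)
  qed
  finally show ?thesis .
qed

lemma lead_unit: "z - const l \<in> M \<Longrightarrow> l \<noteq> 0 \<Longrightarrow> z \<in> V \<and> z \<notin> M"
  using V_add[OF M_V const_V[of l], of "z - const l"] const_M[of l] M_diff[of z "z - const l"] by auto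

text \<open>The leading term cannot cancel. This amounts to the irreducibility of \<open>f\<close>
  over \<open>k(x)\<close>, obtained from pole orders alone.\<close>

lemma E_nz:
  assumes "degree B < p" "B \<noteq> 0"
  shows "E B \<noteq> 0"
proof
  assume 0: "E B = 0"
  obtain i j l where L: "leading B i j l" using ex_leading assms by blast
  hence "l \<noteq> 0" by (auto simp: leading_def)
  thus False using lead_unit[OF leading_M[OF L assms(1)]] 0 M_0 by simp
qed

end

section \<open>The function field and its unique place at infinity\<close>

lemma fract_denominators:
  fixes q :: "'a::idom fract poly"
  shows "\<exists>d q'. d \<noteq> 0 \<and> smult (to_fract d) q = map_poly to_fract q'"
proof (induction q)
  case 0
  show ?case by (intro exI[of _ 1] exI[of _ 0]) simp
next
  case (pCons a q)
  then obtain d q' where IH: "d \<noteq> 0" "smult (to_fract d) q = map_poly to_fract q'" by blast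
  obtain u v where "a = Fract u v" "v \<noteq> 0" by (cases a)
  hence "to_fract v * a = to_fract u" by (simp add: Fract_conv_to_fract)
  hence 1: "to_fract (d * v) * a = to_fract (d * u)" by (simp add: mult.assoc)
  have 2: "smult (to_fract (d * v)) q = map_poly to_fract (smult v q')"
    using arg_cong[OF IH(2), of "smult (to_fract v)"] by (simp add: map_poly_smult mult.commute)
  have "smult (to_fract (d * v)) (pCons a q) = map_poly to_fract (pCons (d * u) (smult v q'))"
    by (simp only: smult_pCons 1 2) (simp add: map_poly_pCons)
  thus ?case using IH(1) \<open>v \<noteq> 0\<close> by (intro exI[of _ "d * v"] exI) auto
qed

context artin_schreier begin

definition C :: "'k ambient set" where "C = {E B / E D | B D. E D \<noteq> 0}"

lemma E_C: "E B \<in> C"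
proof -
  have "E B = E B / E 1" "E 1 \<noteq> 0" by (simp_all add: em.ev_1)
  thus ?thesis unfolding C_def by blast
qed

lemma E_x: "E [:[:0, 1:]:] = gen_x" and E_eta: "E [:0, 1:] = eta" and E_embed: "E [:B:] = embed B"
  and E_const: "E [:[:a:]:] = const a"
  by (simp_all add: em.ev_const em.ev_X embed_const) (simp add: embed_def gen_x_def)

lemma C_divide: "E D \<noteq> 0 \<Longrightarrow> E B / E D \<in> C"
  by (auto simp: C_def)

lemma subfield_C: "is_subfield C"
  unfolding is_subfield_def
proof (intro conjI ballI)
  show "0 \<in> C" "1 \<in> C" using E_C[of 0] E_C[of 1] by (simp_all add: em.ev_1)
  fix u assume "u \<in> C"
  then obtain B D where u: "u = E B / E D" "E D \<noteq> 0" by (auto simp: C_def)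
  show "- u \<in> C" using C_divide[of D "-B"] u by (simp add: em.ev_uminus)
  show "inverse u \<in> C" using C_divide[of B D] u E_C[of 0] by (cases "E B = 0") auto
  fix v assume "v \<in> C"
  then obtain B' D' where v: "v = E B' / E D'" "E D' \<noteq> 0" by (auto simp: C_def)
  show "u + v \<in> C" using C_divide[of "D * D'" "B * D' + B' * D"] u v
    by (simp add: em.ev_mult em.ev_add add_frac_eq)
  show "u * v \<in> C" using C_divide[of "D * D'" "B * B'"] u v by (simp add: em.ev_mult)
qed

lemma C_simps: "u \<in> C \<Longrightarrow> v \<in> C \<Longrightarrow> u * v \<in> C" "u \<in> C \<Longrightarrow> inverse u \<in> C" "1 \<in> C" "0 \<in> C"
  "u \<in> C \<Longrightarrow> v \<in> C \<Longrightarrow> u + v \<in> C" "u \<in> C \<Longrightarrow> - u \<in> C" "u \<in> C \<Longrightarrow> v \<in> C \<Longrightarrow> u - v \<in> C"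
proof -
  note * = subfield_C[unfolded is_subfield_def]
  show "u \<in> C \<Longrightarrow> v \<in> C \<Longrightarrow> u * v \<in> C" "u \<in> C \<Longrightarrow> inverse u \<in> C" "1 \<in> C" "0 \<in> C"
  "u \<in> C \<Longrightarrow> v \<in> C \<Longrightarrow> u + v \<in> C" "u \<in> C \<Longrightarrow> - u \<in> C" using * by auto
  show "u - v \<in> C" if "u \<in> C" "v \<in> C" using * that by (metis add_uminus_conv_diff)
qed

lemma C_power: "u \<in> C \<Longrightarrow> u ^ i \<in> C"
  by (induction i) (auto simp: C_simps)

lemma C_powi: "u \<in> C \<Longrightarrow> u powi i \<in> C"
  by (simp add: power_int_def C_power C_simps)

lemma C_sum: "(\<And>i. i \<in> I \<Longrightarrow> g i \<in> C) \<Longrightarrow> sum g I \<in> C"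
  by (induction I rule: infinite_finite_induct) (auto simp: C_simps)

lemma x_C: "gen_x \<in> C" and eta_C: "eta \<in> C" and const_C: "const a \<in> C" and embed_C: "embed B \<in> C"
  using E_C E_x E_eta E_const E_embed by metis+

lemma mono_C: "mono i j \<in> C"
  by (simp add: mono_def C_simps C_powi x_C eta_C)

lemma E_in_subring:
  assumes "is_subring T" "range const \<subseteq> T" "gen_x \<in> T" "eta \<in> T"
  shows "E B \<in> T"
proof -
  note T = is_subringD[OF assms(1)]
  have c: "const a \<in> T" for a using assms(2) by blast
  have e: "embed D \<in> T" for D
    by (induction D) (auto simp: embed_pCons em.hom_0 intro: T(1) T(3)[OF c T(4)[OF assms(3)]])
  show ?thesis by (induction B) (auto simp: em.ev_pCons intro: T(1) T(3)[OF e T(4)[OF assms(4)]])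
qed

lemma compactification_f: "compactification f = C"
  unfolding compactification_def eta_def[symmetric]
proof (rule hull_unique)
  show "range const \<union> {gen_x, eta} \<subseteq> C" using x_C eta_C const_C by auto
  show "is_subfield C" by (rule subfield_C)
  fix T :: "'k ambient set" assume T: "range const \<union> {gen_x, eta} \<subseteq> T" "is_subfield T"
  hence "E B \<in> T" for B by (intro E_in_subring) (auto simp: is_subring_def is_subfield_def)
  thus "C \<subseteq> T" using T(2) by (auto simp: C_def is_subfield_def divide_inverse)
qed

lemma embed_monom: "embed (monom a i) = const a * gen_x ^ i"
  by (induction i) (simp_all add: monom_0 monom_Suc embed_pCons embed_const const_hom)

lemma embed_inj: "embed A = embed B \<Longrightarrow> A = B"
  by (simp add: embed_def)

text \<open>Chevalley's theorem is applied to \<open>k[1/x]\<close> and \<open>u = 1/x\<close>. An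
  expression of \<open>x\<close> by powers of \<open>1/x\<close> would become, after multiplication
  by a power of \<open>x\<close>, an identity between polynomials of different degrees.\<close>

lemma ex_infinite_place_ambient: "\<exists>V. infinite_place p0 p n N h UNIV V"
proof -
  let ?R = "adjoin (range const) (inverse gen_x) :: 'k ambient set"
  have sub: "is_subring (range (const :: 'k \<Rightarrow> 'k ambient))"
    unfolding is_subring_def
    by (auto simp flip: const_hom(1-3)) (metis const_hom(5) rangeI, metis const_hom(4) rangeI)
  note R = adjoin[OF sub, of "inverse gen_x"]
  have "inverse (inverse gen_x) \<notin> ?R"
  proof
    assume "inverse (inverse gen_x) \<in> ?R"
    then obtain P :: "'k ambient poly" where P: "gen_x = poly P (inverse gen_x)" "\<And>i. coeff P i \<in> range const"
      by (auto simp: adjoin_def)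
    have "\<exists>a. coeff P i = const a" for i using P(2)[of i] by blast
    then obtain c where c: "\<And>i. coeff P i = const (c i)" by metis
    let ?d = "degree P"
    have "gen_x ^ Suc ?d = poly P (inverse gen_x) * gen_x ^ ?d"
      unfolding P(1)[symmetric] by (rule power_Suc)
    also have "\<dots> = (\<Sum>i\<le>?d. const (c i) * gen_x ^ (?d - i))"
      unfolding poly_altdef sum_distrib_right
    proof (intro sum.cong refl)
      fix i assume "i \<in> {..?d}"
      hence "(gen_x :: 'k ambient) ^ ?d = gen_x ^ (?d - i) * gen_x ^ i" by (simp flip: power_add)
      thus "coeff P i * inverse gen_x ^ i * gen_x ^ ?d = const (c i) * gen_x ^ (?d - i)"
        using x_nz by (simp add: field_simps c)
    qed
    also have "\<dots> = embed (\<Sum>i\<le>?d. monom (c i) (?d - i))"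
    proof -
      have "embed (sum g J) = (\<Sum>i\<in>J. embed (g i))" for g :: "nat \<Rightarrow> 'k poly" and J
        by (induction J rule: infinite_finite_induct) (auto simp: em.hom_0 em.hom_add)
      thus ?thesis by (simp add: embed_monom)
    qed
    finally have "embed (monom 1 (Suc ?d)) = embed (\<Sum>i\<le>?d. monom (c i) (?d - i))"
      by (simp only: embed_monom const_hom mult_1)
    hence "monom 1 (Suc ?d) = (\<Sum>i\<le>?d. monom (c i) (?d - i))" by (rule embed_inj)
    hence "coeff (monom 1 (Suc ?d)) (Suc ?d) = coeff (\<Sum>i\<le>?d. monom (c i) (?d - i)) (Suc ?d)" by simp
    also have "\<dots> = 0" unfolding coeff_sum by (intro sum.neutral) auto
    finally show False by simp
  qed
  from exists_val_ring[OF R(1,3) this] obtain V where Vc: "val_ring UNIV V" "?R \<subseteq> V" "gen_x \<notin> V" by auto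
  interpret val_ring UNIV V by fact
  have "infinite_place p0 p n N h UNIV V"
    by unfold_locales (use Vc R(2) in auto)
  thus ?thesis ..
qed

lemma E_nonzero: "degree B < p \<Longrightarrow> B \<noteq> 0 \<Longrightarrow> E B \<noteq> 0"
  using ex_infinite_place_ambient infinite_place.E_nz by blast

lemma ex_reduced: "\<exists>Q B'. B = Q * f + B' \<and> degree B' < p"
proof (induction B)
  case 0
  show ?case using p_gt_1 by (intro exI[of _ 0]) simp
next
  case (pCons a B)
  then obtain Q B' where B: "B = Q * f + B'" "degree B' < p" by blast
  define D where "D = pCons a B'"
  have D: "degree D \<le> p" using B(2) unfolding D_def by (metis Suc_leI degree_pCons_le le_trans)
  define c where "c = coeff D p"
  have "degree (D - smult c f) < p"
  proof -
    have "coeff (D - smult c f) i = 0" if "i \<ge> p" for i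
      using that D degree_f by (cases "i = p") (auto simp: c_def lead_coeff_f coeff_eq_0)
    hence "degree (D - smult c f) \<le> p - 1" using p_gt_1 by (intro degree_le) auto
    thus ?thesis using p_gt_1 by linarith
  qed
  moreover have "pCons a B = (pCons 0 Q + [:c:]) * f + (D - smult c f)"
    by (simp add: B(1) D_def algebra_simps)
  ultimately show ?case by blast
qed

lemma E_reduced: "\<exists>B'. degree B' < p \<and> E B' = E B"
proof -
  obtain Q B' where "B = Q * f + B'" "degree B' < p" using ex_reduced by blast
  thus ?thesis using E_f by (intro exI[of _ B']) (simp add: em.ev_add em.ev_mult)
qed

lemma E_eq_0: "E B = 0 \<Longrightarrow> f dvd B"
proof -
  assume 0: "E B = 0"
  obtain Q B' where B: "B = Q * f + B'" "degree B' < p" using ex_reduced by blast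
  hence "E B' = 0" using 0 E_f by (simp add: em.ev_add em.ev_mult)
  hence "B' = 0" using E_nonzero B(2) by blast
  thus ?thesis using B by simp
qed

lemma ev_E: "\<exists>B1. E B1 = em.ev (E B) q"
proof (induction q)
  case 0
  show ?case by (intro exI[of _ 0]) simp
next
  case (pCons a q)
  then obtain B1 where "E B1 = em.ev (E B) q" by blast
  thus ?case by (intro exI[of _ "[:a:] + B * B1"]) (simp add: em.ev_pCons em.ev_add em.ev_mult em.ev_smult)
qed

text \<open>A substitute for the norm. In an algebraic equation of \<open>E B\<close> over
  \<open>k[x]\<close>, factors \<open>E B\<close> are cancelled until the constant term
  \<open>r\<close> is nonzero; the equation then shows \<open>r\<close> to be a multiple of
  \<open>E B\<close>. Hence denominators can be taken from \<open>k[x]\<close>.\<close>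

lemma ex_norm: "E B \<noteq> 0 \<Longrightarrow> \<exists>B1 r. r \<noteq> 0 \<and> E B * E B1 = embed r"
proof -
  assume z: "E B \<noteq> 0"
  obtain q0 where q0: "q0 \<noteq> 0" "poly (map_poly to_ac q0) (E B) = 0" using alg_closure_algebraic by blast
  obtain d q where d: "d \<noteq> 0" "smult (to_fract d) q0 = map_poly to_fract q" using fract_denominators by blast
  have "q \<noteq> 0" using d q0 by auto
  have "em.ev y q = poly (map_poly to_ac (map_poly to_fract q)) y" for y
    unfolding em.ev_def unfolding embed_def[abs_def] by (simp add: map_poly_map_poly o_def)
  hence "em.ev (E B) q = poly (map_poly to_ac (map_poly to_fract q)) (E B)" .
  also have "\<dots> = 0" unfolding d(2)[symmetric] by (simp add: map_poly_smult q0)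
  finally have "em.ev (E B) q = 0" .
  with \<open>q \<noteq> 0\<close> have "\<exists>r q3. r \<noteq> 0 \<and> embed r + E B * em.ev (E B) q3 = 0"
  proof (induction q)
    case (pCons a q)
    thus ?case
    proof (cases "a = 0")
      case True
      thus ?thesis using pCons z by (auto simp: em.ev_pCons em.hom_0)
    next
      case False
      thus ?thesis using pCons.prems by (auto simp: em.ev_pCons)
    qed
  qed simp
  then obtain r q3 where r: "r \<noteq> 0" "embed r + E B * em.ev (E B) q3 = 0" by blast
  obtain B1 where B1: "E B1 = em.ev (E B) q3" using ev_E by blast
  have "E B * E (- B1) = embed r" using r(2) by (simp add: B1 em.ev_uminus add_eq_0_iff2)
  thus ?thesis using r(1) by blast
qed

lemma C_denominator: "z \<in> C \<Longrightarrow> \<exists>B r. r \<noteq> 0 \<and> z = E B / embed r"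
proof -
  assume "z \<in> C"
  then obtain B D where z: "z = E B / E D" "E D \<noteq> 0" by (auto simp: C_def)
  then obtain D1 r where r: "r \<noteq> 0" "E D * E D1 = embed r" using ex_norm by blast
  hence "E D1 \<noteq> 0" by (metis embed_eq_0 mult_zero_right)
  hence "z = E (B * D1) / embed r" using z by (simp add: r(2)[symmetric] em.ev_mult)
  thus ?thesis using r by blast
qed

text \<open>\<open>i\<close>, \<open>j\<close> and \<open>l\<close> come from a representation of
  \<open>z\<close> as a quotient and are fixed before \<open>V\<close>; this uniformity makes the
  infinite place unique.\<close>

lemma ex_lead:
  assumes "z \<in> C" "z \<noteq> 0"
  shows "\<exists>i j l. l \<noteq> 0 \<and> (\<forall>V. infinite_place p0 p n N h C V \<longrightarrow> z / mono i j - const l \<in> val_ring.M V)"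
proof -
  obtain B D where z: "z = E B / E D" "E D \<noteq> 0" using assms by (auto simp: C_def)
  obtain B' D' where BD: "degree B' < p" "E B' = E B" "degree D' < p" "E D' = E D" using E_reduced by meson
  have nz: "B' \<noteq> 0" "D' \<noteq> 0" using assms z BD by auto
  obtain i j l where L: "leading B' i j l" using ex_leading BD nz by blast
  obtain i' j' l' where L': "leading D' i' j' l'" using ex_leading BD nz by blast
  have l: "l \<noteq> 0" "l' \<noteq> 0" using L L' by (auto simp: leading_def)
  have "z / mono (int i - int i') (int j - int j') - const (l / l') \<in> val_ring.M V" if "infinite_place p0 p n N h C V" for V
  proof -
    interpret infinite_place p0 p n N h C V by fact
    let ?u = "E B' / mono i j" and ?v = "E D' / mono i' j'"
    have u: "?u - const l \<in> M" by (rule leading_M[OF L BD(1)])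
    have v: "?v - const l' \<in> M" by (rule leading_M[OF L' BD(3)])
    have v': "?v \<in> V" "?v \<notin> M" using lead_unit[OF v l(2)] by auto
    hence vi: "inverse ?v \<in> V" by (rule unit_V)
    have "z / mono (int i - int i') (int j - int j') = ?u * inverse ?v"
      unfolding mono_divide[symmetric] using z BD mono_nz by (simp add: field_simps)
    moreover have "?u * inverse ?v - const (l / l') =
        (?u - const l) * inverse ?v - const (l / l') * (?v - const l') * inverse ?v"
    proof -
      have "?v \<noteq> 0" using v' M_0 by auto
      moreover have "const (l / l') * const l' = const l" using l by (simp flip: const_hom(2))
      ultimately show ?thesis by (simp add: algebra_simps)
    qed
    moreover have "(?u - const l) * inverse ?v - const (l / l') * (?v - const l') * inverse ?v \<in> M"
      by (intro M_diff M_mult[OF _ vi] u M_mult' v const_V)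
    ultimately show ?thesis by simp
  qed
  moreover have "l / l' \<noteq> 0" using l by simp
  ultimately show ?thesis by blast
qed

lemma closed_points_iff: "V \<in> closed_points C \<longleftrightarrow> val_ring C V \<and> range const \<subseteq> V \<and> V \<noteq> C"
proof
  assume Vc: "V \<in> closed_points C"
  have 0: "0 \<in> V" and 1: "1 \<in> V" and m1: "-1 \<in> V"
    using Vc const_hom(5) const_hom(4) const_hom(3)[of 1] unfolding closed_points_def by (auto, (metis rangeI subsetD)+)
  have "val_ring C V"
  proof
    show "is_subring V" using Vc 0 1 m1 unfolding is_subring_def closed_points_def
      by auto
  qed (use Vc subfield_C in \<open>auto simp: closed_points_def\<close>)
  thus "val_ring C V \<and> range const \<subseteq> V \<and> V \<noteq> C" using Vc by (auto simp: closed_points_def)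
next
  assume Vc: "val_ring C V \<and> range const \<subseteq> V \<and> V \<noteq> C"
  then interpret val_ring C V by simp
  show "V \<in> closed_points C" using Vc V_add V_mult val sub by (auto simp: closed_points_def)
qed

lemma infinite_place_iff: "infinite_place p0 p n N h C V \<longleftrightarrow> V \<in> closed_points C \<and> gen_x \<notin> V"
proof
  assume "infinite_place p0 p n N h C V"
  then interpret infinite_place p0 p n N h C V .
  show "V \<in> closed_points C \<and> gen_x \<notin> V"
    unfolding closed_points_iff using V_consts x_V x_C val_ring_axioms by blast
next
  assume Vc: "V \<in> closed_points C \<and> gen_x \<notin> V"
  then interpret val_ring C V by (simp add: closed_points_iff)
  show "infinite_place p0 p n N h C V"
    by unfold_locales (use Vc x_C eta_C in \<open>auto simp: closed_points_iff\<close>)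
qed

lemma ex_infinite: "\<exists>V. infinite_place p0 p n N h C V"
proof -
  obtain V where "infinite_place p0 p n N h UNIV V" using ex_infinite_place_ambient by blast
  then interpret infinite_place p0 p n N h UNIV V .
  have "val_ring C (V \<inter> C)"
  proof
    show "is_subfield C" by (rule subfield_C)
    show "is_subring (V \<inter> C)"
      using V_0 V_1 V_add V_mult V_minus C_simps by (auto simp: is_subring_def)
    show "z \<in> V \<inter> C \<or> inverse z \<in> V \<inter> C" if "z \<in> C" for z using that val[of z] C_simps by auto
  qed auto
  hence "V \<inter> C \<in> closed_points C \<and> gen_x \<notin> V \<inter> C"
    using x_V x_C V_consts const_C by (auto simp: closed_points_iff)
  thus ?thesis using infinite_place_iff by blast
qed

end

context infinite_place begin

lemma lead_V_iff:
  assumes "z / mono i j - const l \<in> M" "l \<noteq> 0"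
  shows "z \<in> V \<longleftrightarrow> wt i j \<le> 0" "z \<in> M \<longleftrightarrow> wt i j < 0"
proof -
  have u: "z / mono i j \<in> V" "z / mono i j \<notin> M" using lead_unit assms by auto
  have z: "z = mono i j * (z / mono i j)" using mono_nz by simp
  have m: "mono i j \<in> V" "mono i j \<notin> M" if "wt i j = 0" using mono_0[OF that] U_powi by auto
  have "z \<in> V \<longleftrightarrow> mono i j \<in> V" using mult_unit_V_iff[OF u, of "mono i j"] z by metis
  also have "\<dots> \<longleftrightarrow> wt i j \<le> 0"
    using m mono_not_V[of i j] M_V[OF mono_M, of i j] by (cases "wt i j" "0 :: int" rule: linorder_cases) auto
  finally show zV: "z \<in> V \<longleftrightarrow> wt i j \<le> 0" .
  have "z \<in> M" if "wt i j < 0" using M_mult[OF mono_M[OF that] u(1)] z by metis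
  moreover have "z \<notin> M" if "wt i j = 0" using M_prime[of "mono i j" "z / mono i j"] m[OF that] u z by metis
  moreover have "z \<notin> M" if "wt i j > 0" using zV that M_V by force
  ultimately show "z \<in> M \<longleftrightarrow> wt i j < 0" by (cases "wt i j" "0 :: int" rule: linorder_cases) auto
qed

end

context artin_schreier begin

lemma infinite_place_unique:
  assumes "infinite_place p0 p n N h C V" "infinite_place p0 p n N h C V'"
  shows "V = V'"
proof -
  have "V \<subseteq> V'" if VV: "infinite_place p0 p n N h C V" "infinite_place p0 p n N h C V'" for V V'
  proof
    fix z assume z: "z \<in> V"
    interpret V: infinite_place p0 p n N h C V by fact
    interpret V': infinite_place p0 p n N h C V' by fact
    show "z \<in> V'"
    proof (cases "z = 0")
      case False
      then obtain i j l where l: "l \<noteq> 0" "\<And>V. infinite_place p0 p n N h C V \<Longrightarrow> z / mono i j - const l \<in> val_ring.M V"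
        using ex_lead z V.sub by blast
      thus ?thesis using V.lead_V_iff[OF l(2)[OF VV(1)] l(1)] V'.lead_V_iff[OF l(2)[OF VV(2)] l(1)] z by blast
    qed (simp add: V'.V_0)
  qed
  thus ?thesis using assms by blast
qed

text \<open>The residue field is \<open>k\<close>: divided by a suitable monomial, \<open>z\<close>
  has constant residue. If the monomial has weight 0 it is a power of \<open>U\<close>, again with
  constant residue; if its weight is negative, \<open>z\<close> lies in \<open>M\<close>.\<close>

lemma infinite_residue:
  assumes "infinite_place p0 p n N h C V" "z \<in> V"
  shows "\<exists>c. z - const c \<in> val_ring.M V"
proof -
  interpret V: infinite_place p0 p n N h C V by fact
  have *: "\<exists>c. u * v - const c \<in> V.M" if "u - const a \<in> V.M" "v - const b \<in> V.M" for u v a b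
  proof -
    have "v \<in> V" using V.V_add[OF V.M_V[OF that(2)] V.const_V[of b]] by simp
    hence "(u - const a) * v + const a * (v - const b) \<in> V.M"
      using that by (intro V.M_add V.M_mult V.M_mult' V.const_V)
    thus ?thesis by (intro exI[of _ "a * b"]) (simp add: const_hom algebra_simps)
  qed
  have inv: "inverse u - const (inverse a) \<in> V.M" if "u - const a \<in> V.M" "a \<noteq> 0" for u a
  proof -
    have u: "u \<in> V" "u \<notin> V.M" using V.lead_unit that by auto
    hence ui: "inverse u \<in> V" "u \<noteq> 0" using V.unit_V V.M_0 by auto
    have "inverse u - const (inverse a) = - (inverse u * const (inverse a) * (u - const a))"
      using that ui by (simp add: const_hom algebra_simps)
    thus ?thesis using V.M_minus[OF V.M_mult'[OF V.V_mult[OF ui(1) V.const_V] that(1)]] by simp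
  qed
  have pow: "\<exists>c. u ^ k - const c \<in> V.M" if "u - const a \<in> V.M" for u a k
  proof (induction k)
    case 0
    show ?case by (intro exI[of _ 1]) (simp add: const_hom V.M_0)
  next
    case (Suc k)
    thus ?case using *[OF that] by auto
  qed
  show ?thesis
  proof (cases "z = 0")
    case False
    then obtain i j l where l: "l \<noteq> 0" "z / mono i j - const l \<in> V.M"
      using ex_lead assms V.sub by blast
    show ?thesis
    proof (cases "wt i j = 0")
      case True
      then obtain m where m: "mono i j = V.U powi m" using V.mono_0 by blast
      have "\<exists>c. V.U powi m - const c \<in> V.M"
        using pow[OF V.U_const] pow[OF inv[OF V.U_const V.lc_nz]] by (simp add: power_int_def)
      then obtain c where "mono i j - const c \<in> V.M" unfolding m by blast
      from *[OF l(2) this] show ?thesis using mono_nz by simp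
    next
      case False
      hence "z \<in> V.M" using V.lead_V_iff[OF l(2,1)] assms(2) by auto
      thus ?thesis by (intro exI[of _ 0]) (simp add: const_hom)
    qed
  qed (auto simp: V.M_0 const_hom intro!: exI[of _ 0])
qed

end

section \<open>Finite places\<close>

lemma (in frobenius_power) fld_dvd: "m dvd m' \<Longrightarrow> z \<in> fld m \<Longrightarrow> z \<in> fld m'"
proof -
  assume "m dvd m'" and z: "z \<in> fld m"
  then obtain j where j: "m' = m * j" by (elim dvdE)
  have "z ^ (p ^ (m * j)) = z"
    using z by (induction j) (simp_all add: fld_def power_add power_mult)
  thus ?thesis by (simp add: fld_def j)
qed

lemma finite_field_power_card:
  fixes a :: "'k::{finite, field}"
  shows "a ^ CARD('k) = a"
proof (cases "a = 0")
  case False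
  let ?N = "UNIV - {0 :: 'k}"
  have "(\<Prod>y\<in>?N. a * y) = (\<Prod>y\<in>?N. y)"
    by (rule prod.reindex_bij_witness[of _ "\<lambda>y. y / a" "\<lambda>y. a * y"]) (use False in auto)
  moreover have "(\<Prod>y\<in>?N. y) \<noteq> 0" by simp
  ultimately have "a ^ card ?N = 1" by (simp add: prod.distrib)
  moreover have "CARD('k) = Suc (card ?N)"
    using card_Suc_Diff1[of UNIV "0 :: 'k"] by (simp only: finite UNIV_I)
  ultimately show ?thesis by (simp only: power_Suc mult_1_right)
qed (simp add: power_0_left)

context artin_schreier begin

sublocale ac: comm_hom "to_ac :: 'k \<Rightarrow> 'k alg_closure"
  by (rule comm_hom_to_ac)

sublocale K: frobenius_power "\<lambda>z :: 'k alg_closure. z ^ p" p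
  by (rule frobenius_closure)

abbreviation aev :: "'k alg_closure \<Rightarrow> 'k poly \<Rightarrow> 'k alg_closure" where "aev a \<equiv> ac.ev a"

lemma hom_at: "comm_hom (aev a)" by (rule ac.comm_hom_ev)

text \<open>
  Evaluation at the point \<open>(a, b)\<close>; below, \<open>Y a\<close> consists of the second coordinates of the points over \<open>a\<close>.
\<close>

definition theta :: "'k alg_closure \<Rightarrow> 'k alg_closure \<Rightarrow> 'k poly poly \<Rightarrow> 'k alg_closure" where
  "theta a b B = comm_hom.ev (aev a) b B"

lemmas theta_simps =
  comm_hom.ev_add[OF hom_at, folded theta_def] comm_hom.ev_mult[OF hom_at, folded theta_def]
  comm_hom.ev_1[OF hom_at, folded theta_def] comm_hom.ev_0[OF hom_at, folded theta_def]
  comm_hom.ev_uminus[OF hom_at, folded theta_def] comm_hom.ev_diff[OF hom_at, folded theta_def]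
  comm_hom.ev_power[OF hom_at, folded theta_def] comm_hom.ev_const[OF hom_at, folded theta_def]
  comm_hom.ev_prod[OF hom_at, folded theta_def]

definition Y :: "'k alg_closure \<Rightarrow> 'k alg_closure set" where "Y a = {b. b ^ p - b = aev a h}"

lemma Y: "finite (Y a)" "card (Y a) = p"
proof -
  have "Y a = {b. K.twist (K.cyc 1) b = aev a h}" by (simp add: Y_def K.twist_cyc)
  thus "finite (Y a)" "card (Y a) = p"
    using K.card_twist_fibre[of "K.cyc 1" "aev a h"] by (simp_all add: K.coeff_cyc_0 K.degree_cyc)
qed

lemma theta_f: "b \<in> Y a \<Longrightarrow> theta a b f = 0"
  by (simp add: theta_def f_def comm_hom.ev_diff[OF hom_at] comm_hom.ev_monom[OF hom_at]
      comm_hom.ev_const[OF hom_at] comm_hom.hom_1[OF hom_at] Y_def)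

lemma theta_E: "b \<in> Y a \<Longrightarrow> E B = E D \<Longrightarrow> theta a b B = theta a b D"
proof -
  assume b: "b \<in> Y a" and "E B = E D"
  hence "f dvd B - D" using E_eq_0[of "B - D"] by (simp add: em.ev_diff)
  then obtain k where k: "B - D = f * k" by (elim dvdE)
  have "theta a b (B - D) = 0" unfolding k by (simp add: theta_simps theta_f[OF b])
  thus ?thesis by (simp add: theta_simps)
qed

lemma theta_nz: "b \<in> Y a \<Longrightarrow> theta a b B \<noteq> 0 \<Longrightarrow> E B \<noteq> 0"
  using theta_E[of b a B 0] by (auto simp: theta_simps)

text \<open>A generator of the kernel of evaluation at \<open>a\<close>, not normalised to be monic.
  It serves as a common local parameter at all points above \<open>a\<close>.\<close>

definition minpoly :: "'k alg_closure \<Rightarrow> 'k poly \<Rightarrow> bool" where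
  "minpoly a P \<longleftrightarrow> P \<noteq> 0 \<and> aev a P = 0 \<and> (\<forall>B. aev a B = 0 \<longrightarrow> P dvd B)"

lemma ex_minpoly: "\<exists>P. minpoly a P"
proof -
  have "\<exists>P. P \<noteq> 0 \<and> aev a P = 0" using alg_closure_algebraic[of a] by (metis ac.ev_def)
  then obtain P where P: "P \<noteq> 0" "aev a P = 0" and min: "\<And>B. B \<noteq> 0 \<Longrightarrow> aev a B = 0 \<Longrightarrow> degree P \<le> degree B"
    using ex_has_least_nat[of "\<lambda>P. P \<noteq> 0 \<and> aev a P = 0" _ degree] by blast
  have "P dvd B" if "aev a B = 0" for B
  proof -
    have "aev a (B mod P) = 0"
      using that P by (simp add: minus_div_mult_eq_mod[symmetric] ac.ev_diff ac.ev_mult)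
    hence "B mod P = 0" using min[of "B mod P"] degree_mod_less[OF P(1), of B] by force
    thus ?thesis by (simp add: dvd_eq_mod_eq_0)
  qed
  thus ?thesis using P by (auto simp: minpoly_def)
qed

lemma degree_minpoly: "minpoly a P \<Longrightarrow> degree P > 0"
proof (rule Nat.gr0I)
  assume "minpoly a P" "degree P = 0"
  moreover from this obtain c where "P = [:c:]" by (metis degree_eq_zeroE)
  ultimately show False by (auto simp: minpoly_def ac.ev_const)
qed

lemma minpoly_embed_nz: "minpoly a P \<Longrightarrow> embed P \<noteq> 0"
  by (simp add: minpoly_def)

lemma to_ac_fld: "to_ac (c :: 'k) \<in> K.fld n"
  using finite_field_power_card[of c] card_k by (simp add: K.fld_def flip: to_ac_power)

text \<open>The iterated images of \<open>z\<close> under the \<open>p ^ n\<close>-th power map are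
  all roots of one polynomial over \<open>k\<close>, so two of them coincide; these maps being
  injective, some iterate fixes \<open>z\<close>.\<close>

lemma ex_fld: "\<exists>m>0. z \<in> K.fld m"
proof -
  obtain P where P: "P \<noteq> 0" "aev z P = 0" using ex_minpoly[of z] by (auto simp: minpoly_def)
  have frob: "aev (w ^ (p ^ n)) B = aev w B ^ (p ^ n)" for w B
  proof (induction B)
    case (pCons c B)
    have "to_ac c = to_ac c ^ (p ^ n)" using to_ac_fld[of c] by (simp add: K.fld_def)
    thus ?case using pCons by (simp add: ac.ev_pCons K.add_pow_p_pow power_mult_distrib)
  qed simp
  have root: "aev (z ^ (p ^ (n * i))) P = 0" for i
  proof (induction i)
    case (Suc i)
    have "z ^ (p ^ (n * Suc i)) = (z ^ (p ^ (n * i))) ^ (p ^ n)"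
      by (simp add: power_add mult.commute flip: power_mult)
    thus ?case using Suc frob by simp
  qed (simp add: P)
  have "map_poly to_ac P \<noteq> 0" using P by (simp add: map_poly_eq_0_iff)
  hence "finite {w. aev w P = 0}" unfolding ac.ev_def by (rule poly_roots_finite)
  moreover have "range (\<lambda>i. z ^ (p ^ (n * i))) \<subseteq> {w. aev w P = 0}" using root by auto
  ultimately have "finite (range (\<lambda>i. z ^ (p ^ (n * i))))" by (rule rev_finite_subset)
  hence "\<not> inj (\<lambda>i. z ^ (p ^ (n * i)))" using finite_imageD infinite_UNIV_nat by blast
  then obtain i j where ij: "z ^ (p ^ (n * i)) = z ^ (p ^ (n * j))" "i < j"
    unfolding inj_def by (metis linorder_neqE_nat)
  define d where "d = n * (j - i)"
  have d: "d > 0" "n * j = d + n * i" using ij n0 by (auto simp: d_def algebra_simps)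
  have "(z ^ (p ^ d) - z) ^ (p ^ (n * i)) = 0"
    using ij(1) by (simp add: K.diff_pow_p_pow d(2) power_add flip: power_mult)
  hence "z \<in> K.fld d" by (simp add: K.fld_def)
  thus ?thesis using d by blast
qed

lemma ex_fld_finite: "finite S \<Longrightarrow> \<exists>m>0. S \<subseteq> K.fld m"
proof (induction S rule: finite_induct)
  case (insert z S)
  then obtain m where "m > 0" "S \<subseteq> K.fld m" by blast
  moreover obtain m' where "m' > 0" "z \<in> K.fld m'" using ex_fld by blast
  ultimately have "insert z S \<subseteq> K.fld (m * m')" "m * m' > 0"
    using K.fld_dvd[of m "m * m'"] K.fld_dvd[of m' "m * m'"] by auto
  thus ?case by blast
qed (auto intro: exI[of _ 1])

lemma fld_power_eq: "z \<in> K.fld m \<Longrightarrow> z ^ (p ^ m - 1) = (if z = 0 \<and> m > 0 then 0 else 1)"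
proof -
  assume z: "z \<in> K.fld m"
  show ?thesis
  proof (cases "z = 0")
    case True
    have "p ^ m - 1 > 0" if "m > 0" using that p_gt_1 one_less_power[of p m] by simp
    thus ?thesis using True by (cases "m > 0") (simp_all add: power_0_left)
  next
    case False
    have "z * z ^ (p ^ m - 1) = z" using z p_gt_1 power_minus_mult[of "p ^ m" z] by (simp add: K.fld_def mult.commute)
    thus ?thesis using False by simp
  qed
qed

text \<open>
  Modulo \<open>f\<close> the function is a polynomial of degree less than \<open>p\<close> in \<open>y\<close>, whose value at \<open>x = a\<close> has the \<open>p\<close>
  roots \<open>Y a\<close>.
\<close>

lemma vanishing_over:
  assumes P: "minpoly a P" and B: "\<And>b. b \<in> Y a \<Longrightarrow> theta a b B = 0"
  shows "\<exists>B'. E B = embed P * E B'"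
proof -
  obtain Q B1 where B1: "B = Q * f + B1" "degree B1 < p" using ex_reduced by blast
  hence EB: "E B = E B1" using E_f by (simp add: em.ev_add em.ev_mult)
  define q where "q = map_poly (aev a) B1"
  have "poly q b = 0" if "b \<in> Y a" for b
    using B[OF that] theta_E[OF that EB] by (simp add: theta_def comm_hom.ev_def[OF hom_at] q_def)
  hence sub: "Y a \<subseteq> {b. poly q b = 0}" by auto
  have "degree q < p"
  proof -
    have "degree q \<le> degree B1" unfolding q_def
      by (intro degree_le) (auto simp: coeff_map_poly coeff_eq_0)
    thus ?thesis using B1 by simp
  qed
  have "q = 0"
  proof (rule ccontr)
    assume "q \<noteq> 0"
    hence "card (Y a) \<le> degree q" using card_poly_roots_bound[of q] card_mono[OF poly_roots_finite sub] by force
    thus False using Y \<open>degree q < p\<close> by simp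
  qed
  hence "aev a (coeff B1 j) = 0" for j
  proof -
    have "aev a (coeff B1 j) = coeff q j" by (simp add: q_def coeff_map_poly)
    thus ?thesis using \<open>q = 0\<close> by simp
  qed
  hence "[:P:] dvd B1" using P by (simp add: const_poly_dvd_iff minpoly_def)
  then obtain B' where "B1 = [:P:] * B'" by (elim dvdE)
  thus ?thesis using EB by (intro exI[of _ B']) (simp add: em.ev_smult)
qed

text \<open>The finitely many values lie in one field \<open>K.fld m\<close>, and the exponent
  \<open>p ^ m - 1\<close> sends its nonzero elements to 1. So \<open>B ^ k\<close> is the indicator
  function of the points above \<open>a\<close> where \<open>B\<close> does not vanish.\<close>

lemma ex_idempotent_exponent:
  assumes "finite S"
  shows "\<exists>k>0. \<forall>b\<in>Y a. \<forall>B\<in>S. theta a b (B ^ k) = (if theta a b B = 0 then 0 else 1)"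
proof -
  have "finite ((\<lambda>(b, B). theta a b B) ` (Y a \<times> S))" using assms Y by simp
  then obtain m where m: "m > 0" "(\<lambda>(b, B). theta a b B) ` (Y a \<times> S) \<subseteq> K.fld m"
    using ex_fld_finite by blast
  have "p ^ m - 1 > 0" using m p_gt_1 one_less_power[of p m] by simp
  moreover have "theta a b (B ^ (p ^ m - 1)) = (if theta a b B = 0 then 0 else 1)"
    if "b \<in> Y a" "B \<in> S" for b B
    using that m fld_power_eq[of "theta a b B" m] by (auto simp: theta_simps image_subset_iff)
  ultimately show ?thesis by blast
qed

text \<open>\<open>1 - B ^ k\<close> has value 1 at \<open>(a, b)\<close> and vanishes wherever
  \<open>B\<close> does not, so \<open>(1 - B ^ k) * B\<close> vanishes at all points above
  \<open>a\<close> and is divisible by \<open>P\<close>.\<close>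

lemma vanishing_at:
  assumes P: "minpoly a P" and b: "b \<in> Y a" and B: "theta a b B = 0"
  shows "\<exists>D B'. theta a b D = 1 \<and> E D * E B = embed P * E B'"
proof -
  obtain k where k: "k > 0" "\<And>b'. b' \<in> Y a \<Longrightarrow> theta a b' (B ^ k) = (if theta a b' B = 0 then 0 else 1)"
    using ex_idempotent_exponent[of "{B}" a] by auto
  have "theta a b' ((1 - B ^ k) * B) = 0" if "b' \<in> Y a" for b'
    using k(2)[OF that] by (simp add: theta_simps)
  then obtain B' where "E ((1 - B ^ k) * B) = embed P * E B'" using vanishing_over[OF P] by blast
  moreover have "theta a b (1 - B ^ k) = 1" using k(2)[OF b] B by (simp add: theta_simps)
  ultimately show ?thesis by (simp only: em.ev_mult) blast
qed

lemma split_power: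
  assumes P: "minpoly a P" and "r \<noteq> 0"
  shows "\<exists>l r'. r = P ^ l * r' \<and> aev a r' \<noteq> 0"
  using assms(2)
proof (induction "degree r" arbitrary: r rule: less_induct)
  case less
  show ?case
  proof (cases "aev a r = 0")
    case True
    then obtain s where s: "r = P * s" using P by (auto simp: minpoly_def)
    hence "s \<noteq> 0" "degree s < degree r"
      using less.prems degree_minpoly[OF P] P by (auto simp: degree_mult_eq)
    then obtain l r' where "s = P ^ l * r'" "aev a r' \<noteq> 0" using less.hyps by blast
    thus ?thesis using s by (intro exI[of _ "Suc l"] exI[of _ r']) simp
  next
    case False
    thus ?thesis by (intro exI[of _ 0] exI[of _ r]) simp
  qed
qed

lemma theta_const: "theta a b [:B:] = aev a B"
  by (simp add: theta_simps)

text \<open>\<open>m\<close> is the order of \<open>E B\<close> at the point, found as the largest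
  power of \<open>P\<close> that splits off after multiplication by a local unit. It is bounded
  since the multiple \<open>r\<close> of \<open>E B\<close> in \<open>k[x]\<close> contains just
  \<open>P ^ l\<close>.\<close>

lemma uniformizer:
  assumes P: "minpoly a P" and b: "b \<in> Y a" and B: "E B \<noteq> 0"
  shows "\<exists>m D B'. theta a b D \<noteq> 0 \<and> theta a b B' \<noteq> 0 \<and> E D * E B = embed P ^ m * E B'"
proof -
  define S where "S = {m. \<exists>D B'. theta a b D \<noteq> 0 \<and> E D * E B = embed P ^ m * E B'}"
  obtain B1 r where r: "r \<noteq> 0" "E B * E B1 = embed r" using ex_norm[OF B] by blast
  obtain l r' where l: "r = P ^ l * r'" "aev a r' \<noteq> 0" using split_power[OF P r(1)] by blast
  have pw: "embed (P ^ i) = embed P ^ i" for i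
    by (induction i) (simp_all add: em.hom_1 em.hom_mult)
  have P0: "embed P \<noteq> 0" by (rule minpoly_embed_nz[OF P])
  have bound: "m \<le> l" if m: "m \<in> S" for m
  proof (rule ccontr)
    assume "\<not> m \<le> l"
    hence ml: "m = l + Suc (m - l - 1)" by simp
    obtain D B' where D: "theta a b D \<noteq> 0" "E D * E B = embed P ^ m * E B'" using m by (auto simp: S_def)
    have "embed P ^ l * (E D * embed r') = E D * (E B * E B1)"
      unfolding r(2) l(1) by (simp add: em.hom_mult pw)
    also have "\<dots> = embed P ^ m * E B' * E B1" by (simp add: D(2) mult.assoc[symmetric])
    also have "\<dots> = embed P ^ l * (embed P * embed P ^ (m - l - 1) * E B' * E B1)"
      by (subst ml) (simp add: power_add mult_ac)
    finally have "E D * embed r' = embed P * embed P ^ (m - l - 1) * E B' * E B1"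
      using P0 by simp
    hence "E (D * [:r':]) = E ([:P:] * [:P:] ^ (m - l - 1) * B' * B1)"
      by (simp only: em.ev_mult em.ev_power E_embed)
    from theta_E[OF b this] have "theta a b D * aev a r' = 0"
      using P by (simp add: theta_simps minpoly_def del: mult_pCons_right mult_pCons_left)
    thus False using D l by simp
  qed
  have "theta a b 1 \<noteq> 0" "E 1 * E B = embed P ^ 0 * E B" by (simp_all add: theta_simps em.ev_1)
  hence "0 \<in> S" unfolding S_def by blast
  hence "Max S \<in> S" using bound by (intro Max_in) (auto intro: finite_subset[of _ "{..l}"])
  define m where "m = Max S"
  have fin: "finite S" using bound by (auto intro: finite_subset[of _ "{..l}"])
  obtain D B' where D: "theta a b D \<noteq> 0" "E D * E B = embed P ^ m * E B'"
    using \<open>Max S \<in> S\<close> by (auto simp: m_def S_def)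
  have "theta a b B' \<noteq> 0"
  proof
    assume "theta a b B' = 0"
    then obtain D' B'' where D': "theta a b D' = 1" "E D' * E B' = embed P * E B''"
      using vanishing_at[OF P b] by blast
    have "E (D' * D) * E B = embed P ^ m * (E D' * E B')"
      using D(2) by (simp add: em.ev_mult mult_ac)
    also have "\<dots> = embed P ^ Suc m * E B''" unfolding D'(2) by (simp add: mult_ac)
    finally have "Suc m \<in> S" using D D' unfolding S_def
      by (intro CollectI exI[of _ "D' * D"] exI[of _ B'']) (simp add: theta_simps)
    thus False using Max_ge[OF fin, of "Suc m"] by (simp add: m_def)
  qed
  thus ?thesis using D by blast
qed

text \<open>Conjugate points have the same local ring; therefore later statements compare
  \<open>\<O> a b\<close> with \<open>\<O> a b'\<close>, not \<open>b\<close> with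
  \<open>b'\<close>.\<close>

definition \<O> :: "'k alg_closure \<Rightarrow> 'k alg_closure \<Rightarrow> 'k ambient set" where
  "\<O> a b = {E B / E D | B D. theta a b D \<noteq> 0}"

lemma O_I: "theta a b D \<noteq> 0 \<Longrightarrow> E B / E D \<in> \<O> a b"
  by (auto simp: \<O>_def)

lemma E_O: "E B \<in> \<O> a b"
  using O_I[of a b 1 B] by (simp add: theta_simps em.ev_1)

lemma val_ring_O:
  assumes b: "b \<in> Y a"
  shows "val_ring C (\<O> a b)"
proof
  show "is_subfield C" by (rule subfield_C)
  show "\<O> a b \<subseteq> C" using theta_nz[OF b] by (auto simp: \<O>_def C_def)
  show "is_subring (\<O> a b)"
    unfolding is_subring_def
  proof (intro conjI ballI)
    show "0 \<in> \<O> a b" "1 \<in> \<O> a b" using E_O[of 0] E_O[of 1] by (simp_all add: em.ev_1)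
    fix u assume "u \<in> \<O> a b"
    then obtain B D where u: "u = E B / E D" "theta a b D \<noteq> 0" by (auto simp: \<O>_def)
    show "- u \<in> \<O> a b" using O_I[of a b D "-B"] u by (simp add: em.ev_uminus)
    fix v assume "v \<in> \<O> a b"
    then obtain B' D' where v: "v = E B' / E D'" "theta a b D' \<noteq> 0" by (auto simp: \<O>_def)
    have nz: "E D \<noteq> 0" "E D' \<noteq> 0" using theta_nz[OF b] u v by auto
    show "u + v \<in> \<O> a b" using O_I[of a b "D * D'" "B * D' + B' * D"] u v nz
      by (simp add: em.ev_mult em.ev_add add_frac_eq theta_simps)
    show "u * v \<in> \<O> a b" using O_I[of a b "D * D'" "B * B'"] u v by (simp add: em.ev_mult theta_simps)
  qed
  fix z assume "z \<in> C"
  then obtain B D where z: "z = E B / E D" "E D \<noteq> 0" by (auto simp: C_def)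
  obtain P where P: "minpoly a P" using ex_minpoly by blast
  have P0: "embed P \<noteq> 0" by (rule minpoly_embed_nz[OF P])
  show "z \<in> \<O> a b \<or> inverse z \<in> \<O> a b"
  proof (cases "E B = 0")
    case True
    thus ?thesis using z E_O[of 0] by simp
  next
    case False
    obtain m B1 B' where m: "theta a b B1 \<noteq> 0" "theta a b B' \<noteq> 0" "E B1 * E B = embed P ^ m * E B'"
      using uniformizer[OF P b False] by blast
    obtain k D1 D' where k: "theta a b D1 \<noteq> 0" "theta a b D' \<noteq> 0" "E D1 * E D = embed P ^ k * E D'"
      using uniformizer[OF P b z(2)] by blast
    have nz: "E B1 \<noteq> 0" "E B' \<noteq> 0" "E D1 \<noteq> 0" "E D' \<noteq> 0" using theta_nz[OF b] m k by auto
    have B: "E B = embed P ^ m * E B' / E B1" using m(3) nz by (simp add: field_simps)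
    have D: "E D = embed P ^ k * E D' / E D1" using k(3) nz by (simp add: field_simps)
    show ?thesis
    proof (cases "k \<le> m")
      case True
      hence "embed P ^ m = embed P ^ (m - k) * embed P ^ k" by (simp flip: power_add)
      hence "z = E ([:P:] ^ (m - k) * B' * D1) / E (B1 * D')"
        unfolding z B D using nz P0 by (simp add: em.ev_mult em.ev_power E_embed field_simps)
      thus ?thesis using O_I[of a b "B1 * D'"] m k by (simp add: theta_simps)
    next
      case False
      hence "embed P ^ k = embed P ^ (k - m) * embed P ^ m" by (simp flip: power_add)
      hence "inverse z = E ([:P:] ^ (k - m) * D' * B1) / E (D1 * B')"
        unfolding z B D using nz P0 by (simp add: em.ev_mult em.ev_power E_embed field_simps)
      thus ?thesis using O_I[of a b "D1 * B'"] m k by (simp add: theta_simps)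
    qed
  qed
qed

lemma O_M_iff:
  assumes b: "b \<in> Y a" and D: "theta a b D \<noteq> 0"
  shows "E B / E D \<in> val_ring.M (\<O> a b) \<longleftrightarrow> theta a b B = 0"
proof -
  interpret val_ring C "\<O> a b" by (rule val_ring_O[OF b])
  have nz: "E D \<noteq> 0" using theta_nz[OF b D] .
  show ?thesis
  proof
    assume M: "E B / E D \<in> M"
    show "theta a b B = 0"
    proof (rule ccontr)
      assume "theta a b B \<noteq> 0"
      hence "inverse (E B / E D) \<in> \<O> a b" "E B / E D \<noteq> 0"
        using O_I[of a b B D] theta_nz[OF b] nz by auto
      thus False using unit_not_M M by blast
    qed
  next
    assume B: "theta a b B = 0"
    show "E B / E D \<in> M"
    proof (rule ccontr)
      assume n: "E B / E D \<notin> M"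
      hence "inverse (E B / E D) \<in> \<O> a b" using unit_V O_I[OF D] by blast
      then obtain B' D' where D': "inverse (E B / E D) = E B' / E D'" "theta a b D' \<noteq> 0" by (auto simp: \<O>_def)
      have "E B \<noteq> 0" using n M_0 by auto
      hence "E (D * D') = E (B * B')"
        using D' nz theta_nz[OF b D'(2)] by (simp add: em.ev_mult field_simps)
      from theta_E[OF b this] show False using D D' B by (simp add: theta_simps)
    qed
  qed
qed

lemma O_M_E_iff: "b \<in> Y a \<Longrightarrow> E B \<in> val_ring.M (\<O> a b) \<longleftrightarrow> theta a b B = 0"
  using O_M_iff[of b a 1 B] by (simp add: theta_simps em.ev_1)

lemma minpoly_M: "minpoly a P \<Longrightarrow> b \<in> Y a \<Longrightarrow> embed P \<in> val_ring.M (\<O> a b)"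
  using O_M_E_iff[of b a "[:P:]"] by (simp add: E_embed theta_const minpoly_def)

lemma M_O_divisible:
  assumes P: "minpoly a P" and b: "b \<in> Y a" and z: "z \<in> val_ring.M (\<O> a b)"
  shows "\<exists>w\<in>\<O> a b. z = embed P * w"
proof -
  interpret val_ring C "\<O> a b" by (rule val_ring_O[OF b])
  obtain B D where zz: "z = E B / E D" "theta a b D \<noteq> 0" using M_V[OF z] by (auto simp: \<O>_def)
  hence "theta a b B = 0" using O_M_iff[OF b] z by blast
  then obtain D' B' where D': "theta a b D' = 1" "E D' * E B = embed P * E B'"
    using vanishing_at[OF P b] by blast
  have nz: "E D' \<noteq> 0" "E D \<noteq> 0" using theta_nz[OF b] D' zz by auto
  have "z = (E D' * E B) / (E D' * E D)" using nz zz by simp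
  hence "z = embed P * (E B' / E (D' * D))" by (simp add: D'(2) em.ev_mult)
  moreover have "E B' / E (D' * D) \<in> \<O> a b"
    by (rule O_I) (use D' zz in \<open>simp add: theta_simps\<close>)
  ultimately show ?thesis by blast
qed

lemma closed_point_O: "b \<in> Y a \<Longrightarrow> \<O> a b \<in> closed_points C \<and> gen_x \<in> \<O> a b"
proof
  assume b: "b \<in> Y a"
  interpret val_ring C "\<O> a b" by (rule val_ring_O[OF b])
  obtain P where P: "minpoly a P" using ex_minpoly by blast
  have "inverse (embed P) \<notin> \<O> a b"
    using minpoly_M[OF P b] minpoly_embed_nz[OF P] unit_not_M by blast
  hence "\<O> a b \<noteq> C" using embed_C C_simps by metis
  thus "\<O> a b \<in> closed_points C"
    using val_ring_axioms E_O E_const unfolding closed_points_iff by (metis image_subsetI)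
  show "gen_x \<in> \<O> a b" using E_O E_x by metis
qed

text \<open>Otherwise \<open>inverse eta\<close> is in \<open>M\<close>, and dividing the integral
  equation of \<open>eta\<close> by \<open>eta ^ p\<close> puts 1 into \<open>M\<close>.\<close>

lemma eta_in_finite:
  assumes "V \<in> closed_points C" "gen_x \<in> V"
  shows "E B \<in> V"
proof -
  interpret val_ring C V using assms closed_points_iff by blast
  have c: "const c \<in> V" for c using assms closed_points_iff by blast
  have e: "embed B \<in> V" for B
    by (induction B) (auto simp: embed_pCons em.hom_0 V_0 intro!: V_add V_mult c assms)
  have "eta \<in> V"
  proof (rule ccontr)
    assume "eta \<notin> V"
    hence i: "inverse eta \<in> M" using not_V_M eta_C by blast
    have "eta ^ p = embed h + eta" using eta_eq by (simp add: algebra_simps)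
    hence "1 = embed h * inverse eta ^ p + inverse eta ^ (p - 1)"
    proof -
      assume a: "eta ^ p = embed h + eta"
      have "inverse eta ^ p * eta = inverse eta ^ (p - 1)"
        using eta_nz p_gt_1 power_minus_mult[of p "inverse eta"] by (simp add: field_simps)
      moreover have "inverse eta ^ p * eta ^ p = 1" using eta_nz by (simp flip: power_mult_distrib)
      ultimately show ?thesis by (simp add: a algebra_simps)
    qed
    moreover have "embed h * inverse eta ^ p + inverse eta ^ (p - 1) \<in> M"
      using p_gt_1 by (intro M_add M_mult' e M_power i) auto
    ultimately show False using one_not_M by simp
  qed
  thus ?thesis by (induction B) (auto simp: em.ev_pCons V_0 intro!: V_add V_mult e)
qed

text \<open>
  If every point over \<open>a\<close> had a function \<open>D b\<close> in the maximal ideal with nonzero value there, the product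
  of the units \<open>1 - D b\<^sup>k\<close> would vanish at all these points and so lie in the maximal ideal.
\<close>

lemma finite_place_over:
  assumes Vc: "V \<in> closed_points C" "gen_x \<in> V" and P: "minpoly a P" and PM: "embed P \<in> val_ring.M V"
  shows "\<exists>b\<in>Y a. V = \<O> a b"
proof -
  interpret val_ring C V using Vc closed_points_iff by blast
  note EV = eta_in_finite[OF Vc]
  have "\<exists>b\<in>Y a. \<forall>D. theta a b D \<noteq> 0 \<longrightarrow> E D \<notin> M"
  proof (rule ccontr)
    assume "\<not> ?thesis"
    hence "\<forall>b\<in>Y a. \<exists>D. theta a b D \<noteq> 0 \<and> E D \<in> M" by blast
    then obtain D where D: "\<And>b. b \<in> Y a \<Longrightarrow> theta a b (D b) \<noteq> 0" "\<And>b. b \<in> Y a \<Longrightarrow> E (D b) \<in> M"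
      by metis
    obtain k where k: "k > 0" "\<And>b B. b \<in> Y a \<Longrightarrow> B \<in> D ` Y a \<Longrightarrow> theta a b (B ^ k) = (if theta a b B = 0 then 0 else 1)"
      using ex_idempotent_exponent[of "D ` Y a" a] Y by blast
    let ?G = "\<Prod>b\<in>Y a. 1 - D b ^ k"
    have "theta a b ?G = 0" if b: "b \<in> Y a" for b
    proof -
      have "theta a b (1 - D b ^ k) = 0"
        using k(2)[OF b, of "D b"] D(1)[OF b] b by (simp add: theta_simps)
      thus ?thesis unfolding theta_simps(9) using b by (intro prod_zero[OF Y(1)]) blast
    qed
    then obtain G' where "E ?G = embed P * E G'" using vanishing_over[OF P] by blast
    hence "E ?G \<in> M" using M_mult[OF PM EV] by simp
    hence "(\<Prod>b\<in>Y a. E (1 - D b ^ k)) \<in> M" by (simp add: em.ev_prod)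
    then obtain b where b: "b \<in> Y a" "E (1 - D b ^ k) \<in> M"
      using M_prime_prod[OF Y(1)] EV by blast
    have "E (D b) ^ k \<in> M" using M_power[OF D(2)[OF b(1)] k(1)] .
    hence "1 \<in> M" using M_add[OF b(2), of "E (D b) ^ k"] by (simp add: em.ev_diff em.ev_1 em.ev_power)
    thus False using one_not_M by simp
  qed
  then obtain b where b: "b \<in> Y a" "\<And>D. theta a b D \<noteq> 0 \<Longrightarrow> E D \<notin> M" by blast
  have OV: "\<O> a b \<subseteq> V"
    using b(2) EV unit_V V_mult by (auto simp: \<O>_def divide_inverse)
  interpret L: val_ring C "\<O> a b" by (rule val_ring_O[OF b(1)])
  \<comment> \<open>An element outside \<open>\<O> a b\<close> has an inverse divisible by
    \<open>P\<close> there, so \<open>V\<close>, where \<open>P\<close> is a nonunit, cannot contain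
    it.\<close>
  have "z \<in> \<O> a b" if z: "z \<in> V" for z
  proof (rule ccontr)
    assume n: "z \<notin> \<O> a b"
    have zC: "z \<in> C" using z sub by blast
    have "inverse z \<in> L.M" using L.not_V_M[OF zC n] .
    then obtain w where w: "w \<in> \<O> a b" "inverse z = embed P * w" using M_O_divisible[OF P b(1)] by blast
    hence "inverse z \<in> M" using M_mult[OF PM] OV by auto
    moreover have "z \<noteq> 0" using n L.V_0 by auto
    ultimately show False using M_mult[of "inverse z" z] z one_not_M by simp
  qed
  thus ?thesis using OV b(1) by blast
qed

lemma root_exists: "degree r > 0 \<Longrightarrow> \<exists>a. aev a r = 0"
  using alg_closed_imp_poly_has_root[of "map_poly to_ac r"]
  by (auto simp: ac.ev_def degree_map_poly)

text \<open>If no nonzero polynomial in \<open>x\<close> were in \<open>M\<close>, all denominators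
  would be units and \<open>V = C\<close>. In one of least degree, the cofactor of the minimal
  polynomial of a root is too small to lie in \<open>M\<close>, so the minimal polynomial
  does.\<close>

lemma ex_minpoly_M:
  assumes Vc: "V \<in> closed_points C" "gen_x \<in> V"
  shows "\<exists>a P. minpoly a P \<and> embed P \<in> val_ring.M V"
proof -
  interpret val_ring C V using Vc closed_points_iff by blast
  note EV = eta_in_finite[OF Vc]
  have eV: "embed r \<in> V" for r using EV[of "[:r:]"] by (simp add: E_embed)
  have "\<exists>r. r \<noteq> 0 \<and> embed r \<in> M"
  proof (rule ccontr)
    assume "\<not> ?thesis"
    hence "inverse (embed r) \<in> V" if "r \<noteq> 0" for r using that unit_V eV by blast
    hence "z \<in> V" if "z \<in> C" for z
      using C_denominator[OF that] EV V_mult by (metis divide_inverse)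
    hence "C \<subseteq> V" by blast
    thus False using Vc closed_points_iff by (auto simp: closed_points_def)
  qed
  then obtain r where r: "r \<noteq> 0" "embed r \<in> M" and min: "\<And>s. s \<noteq> 0 \<Longrightarrow> embed s \<in> M \<Longrightarrow> degree r \<le> degree s"
    using ex_has_least_nat[of "\<lambda>r. r \<noteq> 0 \<and> embed r \<in> M" _ degree] by blast
  have "degree r > 0"
  proof (rule Nat.gr0I)
    assume "degree r = 0"
    then obtain c where c: "r = [:c:]" by (metis degree_eq_zeroE)
    have "const (inverse c) \<in> V" using Vc closed_points_iff by blast
    hence "const c * const (inverse c) \<in> M"
      using r(2) by (intro M_mult) (simp_all add: c embed_const)
    moreover have "const c * const (inverse c) = 1" using r(1) by (simp add: c const_hom(6,7))
    ultimately show False using one_not_M by simp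
  qed
  then obtain a where a: "aev a r = 0" using root_exists by blast
  obtain P where P: "minpoly a P" using ex_minpoly by blast
  then obtain s where s: "r = P * s" using a by (auto simp: minpoly_def)
  hence "s \<noteq> 0" "degree s < degree r"
    using r degree_minpoly[OF P] P by (auto simp: degree_mult_eq)
  hence "embed s \<notin> M" using min by force
  hence "embed P \<in> M" using M_prime[of "embed P" "embed s"] r s eV by (simp add: em.hom_mult)
  thus ?thesis using P by blast
qed

section \<open>Rational points\<close>

lemma rational_pointI:
  assumes V: "val_ring C V" "range const \<subseteq> V"
    and L: "\<And>z. z \<in> V \<Longrightarrow> r z \<in> L" and const: "\<And>c. r (const c) = to_ac c"
    and add: "\<And>u v. u \<in> V \<Longrightarrow> v \<in> V \<Longrightarrow> r (u + v) = r u + r v"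
    and mult: "\<And>u v. u \<in> V \<Longrightarrow> v \<in> V \<Longrightarrow> r (u * v) = r u * r v"
    and M: "\<And>z. z \<in> val_ring.M V \<Longrightarrow> r z = 0"
  shows "(\<lambda>z. if z \<in> V then Some (r z) else None) \<in> rational_points C L"
proof -
  interpret val_ring C V by fact
  let ?\<pi> = "\<lambda>z. if z \<in> V then Some (r z) else None"
  have dom: "dom ?\<pi> = V" by (auto simp: dom_def split: if_splits)
  show ?thesis
    unfolding rational_points_def mem_Collect_eq dom
  proof (intro conjI allI ballI)
    show "V \<subseteq> C" by (rule sub)
    show "ran ?\<pi> \<subseteq> L" using L by (auto simp: ran_def split: if_splits)
    show "?\<pi> (const c) = Some (to_ac c)" for c using assms(2) const by auto
    fix u v assume uv: "u \<in> V" "v \<in> V"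
    show "?\<pi> (u + v) = Some (the (?\<pi> u) + the (?\<pi> v))" using uv V_add add by simp
    show "?\<pi> (u * v) = Some (the (?\<pi> u) * the (?\<pi> v))" using uv V_mult mult by simp
  next
    fix z assume "z \<in> C - V"
    hence "inverse z \<in> M" using not_V_M by blast
    thus "?\<pi> (inverse z) = Some 0" using M M_V by simp
  qed
qed

definition Vinf :: "'k ambient set" where "Vinf = (THE V. infinite_place p0 p n N h C V)"

lemma infinite_Vinf: "infinite_place p0 p n N h C Vinf"
  unfolding Vinf_def using ex_infinite infinite_place_unique by (metis theI)

definition place_inf :: "'k ambient \<Rightarrow> 'k alg_closure option" where
  "place_inf z = (if z \<in> Vinf then Some (to_ac (SOME c. z - const c \<in> val_ring.M Vinf)) else None)"

text \<open>The value is independent of the representation chosen, because evaluation at a point of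
  the curve factors through \<open>E\<close> (\<open>place_fin_eq\<close>).\<close>

definition place_fin :: "'k alg_closure \<Rightarrow> 'k alg_closure \<Rightarrow> 'k ambient \<Rightarrow> 'k alg_closure option" where
  "place_fin a b z = (if z \<in> \<O> a b then
     Some (SOME w. \<exists>B D. z = E B / E D \<and> theta a b D \<noteq> 0 \<and> w = theta a b B / theta a b D) else None)"

lemma inf_residue_eq:
  assumes "z - const c \<in> val_ring.M Vinf"
  shows "(SOME c. z - const c \<in> val_ring.M Vinf) = c"
proof -
  interpret infinite_place p0 p n N h C Vinf by (rule infinite_Vinf)
  have "d = c" if "z - const d \<in> M" for d
  proof -
    have "const (d - c) = (z - const c) - (z - const d)"
      using const_hom(1)[of d "-c"] const_hom(3)[of c] by simp
    also have "\<dots> \<in> M" using assms that by (rule M_diff)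
    finally show ?thesis using const_M by simp
  qed
  thus ?thesis using assms by (intro some_equality)
qed

lemma place_inf_rational:
  assumes "range to_ac \<subseteq> L"
  shows "place_inf \<in> rational_points C L"
proof -
  interpret infinite_place p0 p n N h C Vinf by (rule infinite_Vinf)
  define res where "res z = (SOME c. z - const c \<in> M)" for z
  have res: "z - const (res z) \<in> M" if "z \<in> Vinf" for z
    unfolding res_def using infinite_residue[OF infinite_Vinf that] by (rule someI_ex)
  have eq: "res z = c" if "z - const c \<in> M" for z c
    unfolding res_def by (rule inf_residue_eq[OF that])
  have "(\<lambda>z. if z \<in> Vinf then Some (to_ac (res z)) else None) \<in> rational_points C L"
  proof (rule rational_pointI)
    show "to_ac (res z) \<in> L" for z using assms by auto
    show "to_ac (res (const c)) = to_ac c" for c by (subst eq[of _ c]) (simp_all add: M_0)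
    show "to_ac (res z) = 0" if "z \<in> M" for z
      using that by (subst eq[of _ 0]) (simp_all add: const_hom)
    fix u v assume uv: "u \<in> Vinf" "v \<in> Vinf"
    have "(u + v) - const (res u + res v) = (u - const (res u)) + (v - const (res v))"
      by (simp add: const_hom)
    also have "\<dots> \<in> M" using res uv by (intro M_add) auto
    finally show "to_ac (res (u + v)) = to_ac (res u) + to_ac (res v)"
      by (subst eq[of _ "res u + res v"]) (assumption, rule to_ac_add)
    have "u * v - const (res u * res v) = (u - const (res u)) * v + const (res u) * (v - const (res v))"
      by (simp add: const_hom algebra_simps)
    also have "\<dots> \<in> M" using res uv by (intro M_add M_mult M_mult' const_V) auto
    finally show "to_ac (res (u * v)) = to_ac (res u) * to_ac (res v)"
      by (subst eq[of _ "res u * res v"]) (assumption, rule to_ac_mult)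
  qed (use val_ring_axioms V_consts in auto)
  moreover have "place_inf = (\<lambda>z. if z \<in> Vinf then Some (to_ac (res z)) else None)"
    by (auto simp: place_inf_def res_def)
  ultimately show ?thesis by simp
qed

lemma place_fin_eq:
  assumes b: "b \<in> Y a" and D: "theta a b D \<noteq> 0"
  shows "place_fin a b (E B / E D) = Some (theta a b B / theta a b D)"
proof -
  have "w = theta a b B / theta a b D"
    if "E B / E D = E B' / E D'" "theta a b D' \<noteq> 0" "w = theta a b B' / theta a b D'" for w B' D'
  proof -
    have "E (B * D') = E (B' * D)"
      using that theta_nz[OF b] D by (simp add: em.ev_mult field_simps)
    from theta_E[OF b this] have "theta a b B * theta a b D' = theta a b B' * theta a b D"
      by (simp add: theta_simps)
    thus ?thesis using that D by (simp add: frac_eq_eq)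
  qed
  hence "(SOME w. \<exists>B' D'. E B / E D = E B' / E D' \<and> theta a b D' \<noteq> 0 \<and> w = theta a b B' / theta a b D')
     = theta a b B / theta a b D"
    using D by (intro some_equality) blast+
  thus ?thesis using O_I[OF D] by (simp add: place_fin_def)
qed

lemma place_fin_E: "b \<in> Y a \<Longrightarrow> place_fin a b (E B) = Some (theta a b B)"
  using place_fin_eq[of b a 1 B] by (simp add: theta_simps em.ev_1)

lemma theta_mem:
  assumes "n dvd m" "a \<in> K.fld m" "b \<in> K.fld m"
  shows "theta a b B \<in> K.fld m"
proof -
  have c: "to_ac (c :: 'k) \<in> K.fld m" for c using K.fld_dvd[OF assms(1) to_ac_fld] .
  have "aev a P \<in> K.fld m" for P
    by (induction P) (auto simp: ac.ev_pCons K.fld_0 intro!: K.fld_add K.fld_mult c assms)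
  thus ?thesis unfolding theta_def
    by (induction B) (auto simp: comm_hom.ev_pCons[OF hom_at] comm_hom.ev_0[OF hom_at] K.fld_0 intro!: K.fld_add K.fld_mult assms)
qed

lemma place_fin_rational:
  assumes m: "n dvd m" and ab: "a \<in> K.fld m" "b \<in> K.fld m" "b \<in> Y a"
  shows "place_fin a b \<in> rational_points C (K.fld m)"
proof -
  note b = ab(3)
  let ?r = "\<lambda>z. the (place_fin a b z)"
  have r: "?r (E B / E D) = theta a b B / theta a b D" if "theta a b D \<noteq> 0" for B D
    using place_fin_eq[OF b that] by simp
  have rep: "\<exists>B D. z = E B / E D \<and> theta a b D \<noteq> 0 \<and> E D \<noteq> 0" if "z \<in> \<O> a b" for z
    using that theta_nz[OF b] by (auto simp: \<O>_def)
  have "(\<lambda>z. if z \<in> \<O> a b then Some (?r z) else None) \<in> rational_points C (K.fld m)"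
  proof (rule rational_pointI)
    show "val_ring C (\<O> a b)" by (rule val_ring_O[OF b])
    show "range const \<subseteq> \<O> a b" using E_O E_const by (metis image_subsetI)
    show "?r (const c) = to_ac c" for c
      using place_fin_E[OF b, of "[:[:c:]:]"] by (simp add: E_const theta_const ac.ev_const)
    show "?r z \<in> K.fld m" if z: "z \<in> \<O> a b" for z
      using rep[OF z] r theta_mem[OF m ab(1,2)] by (auto intro!: K.fld_divide)
    show "?r z = 0" if z: "z \<in> val_ring.M (\<O> a b)" for z
    proof -
      have "z \<in> \<O> a b" using z val_ring.M_V[OF val_ring_O[OF b]] by blast
      then obtain B D where zz: "z = E B / E D" "theta a b D \<noteq> 0" using rep by blast
      thus ?thesis using r O_M_iff[OF b zz(2)] z by simp
    qed
    fix u v assume "u \<in> \<O> a b" "v \<in> \<O> a b"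
    then obtain B D B' D' where uv: "u = E B / E D" "theta a b D \<noteq> 0" "E D \<noteq> 0"
      "v = E B' / E D'" "theta a b D' \<noteq> 0" "E D' \<noteq> 0" using rep by meson
    have nz: "theta a b (D * D') \<noteq> 0" using uv by (simp add: theta_simps)
    have "u + v = E (B * D' + B' * D) / E (D * D')" "u * v = E (B * B') / E (D * D')"
      using uv by (simp_all add: em.ev_mult em.ev_add add_frac_eq)
    thus "?r (u + v) = ?r u + ?r v" "?r (u * v) = ?r u * ?r v"
      using uv r[OF nz] r[OF uv(2)] r[OF uv(5)] by (simp_all add: theta_simps add_frac_eq)
  qed
  moreover have "place_fin a b = (\<lambda>z. if z \<in> \<O> a b then Some (?r z) else None)"
    by (auto simp: place_fin_def)
  ultimately show ?thesis by simp
qed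

text \<open>The domain of \<open>\<pi>\<close> is a valuation ring. If it omits \<open>x\<close> it
  is the infinite one, whose residue field \<open>k\<close> leaves \<open>\<pi>\<close> no freedom.
  Otherwise \<open>a\<close> and \<open>b\<close> are the values of \<open>x\<close> and
  \<open>eta\<close>, and since \<open>\<pi>\<close> kills the minimal polynomial of
  \<open>a\<close>, the domain is \<open>\<O> a b\<close>.\<close>

lemma rational_point_cases:
  assumes \<pi>: "\<pi> \<in> rational_points C L"
  shows "\<pi> = place_inf \<or> (\<exists>a\<in>L. \<exists>b\<in>L. b \<in> Y a \<and> \<pi> = place_fin a b)"
proof -
  define V where "V = dom \<pi>"
  define r where "r z = the (\<pi> z)" for z
  have Vc: "V \<subseteq> C" "\<And>c. \<pi> (const c) = Some (to_ac c)"
    and hom: "\<And>u v. u \<in> V \<Longrightarrow> v \<in> V \<Longrightarrow> \<pi> (u + v) = Some (r u + r v) \<and> \<pi> (u * v) = Some (r u * r v)"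
    and inv: "\<And>z. z \<in> C \<Longrightarrow> z \<notin> V \<Longrightarrow> \<pi> (inverse z) = Some 0"
    and ran: "ran \<pi> \<subseteq> L"
    using \<pi> by (auto simp: rational_points_def V_def r_def)
  have some: "\<pi> z = Some (r z)" if "z \<in> V" for z using that by (auto simp: V_def r_def)
  have cV: "const c \<in> V" for c using Vc(2)[of c] by (auto simp: V_def)
  have rc: "r (const c) = to_ac c" for c using Vc(2)[of c] by (simp add: r_def)
  have V_closed: "u + v \<in> V" "u * v \<in> V" "r (u + v) = r u + r v" "r (u * v) = r u * r v" if "u \<in> V" "v \<in> V" for u v
    using hom[OF that] by (auto simp: V_def r_def)
  have V01: "0 \<in> V" "1 \<in> V" "-1 \<in> V" and r01: "r 0 = 0" "r 1 = 1"
    using cV[of 0] cV[of 1] cV[of "-1"] rc[of 0] rc[of 1] by (auto simp: const_hom)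
  interpret val_ring C V
  proof
    show "is_subring V" using V_closed(1,2) V01 by (auto simp: is_subring_def) (metis mult_minus1)
    show "z \<in> V \<or> inverse z \<in> V" if "z \<in> C" for z using inv[OF that] by (auto simp: V_def)
  qed (use subfield_C Vc in auto)
  have rM: "r z = 0" if z: "z \<in> M" for z
  proof (cases "z = 0")
    case False
    hence "inverse z \<notin> V" "inverse z \<in> C" using z C_simps(2) sub by (auto simp: M_def)
    thus ?thesis using inv[of "inverse z"] by (simp add: r_def)
  qed (simp add: r01)
  have r_unit: "False" if "r z = 0" "z \<in> V" "inverse z \<in> V" "z \<noteq> 0" for z
    using V_closed(4)[OF that(2,3)] that r01 by simp
  show ?thesis
  proof (cases "gen_x \<in> V")
    case False
    hence "infinite_place p0 p n N h C V"
      unfolding infinite_place_iff closed_points_iff using val_ring_axioms cV x_C by blast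
    hence V: "V = Vinf" using infinite_place_unique infinite_Vinf by blast
    have "\<pi> z = place_inf z" for z
    proof (cases "z \<in> V")
      case True
      then obtain c where c: "z - const c \<in> M" using infinite_residue infinite_Vinf V by blast
      have "r z = r (const c + (z - const c))" by simp
      also have "\<dots> = to_ac c" by (subst V_closed(3)[OF cV M_V[OF c]]) (simp add: rM[OF c] rc)
      finally show ?thesis using some[OF True] True inf_residue_eq[of z c] c V by (simp add: place_inf_def)
    next
      case False
      thus ?thesis using V by (auto simp: place_inf_def V_def)
    qed
    thus ?thesis by blast
  next
    case True
    define a where "a = r gen_x"
    define b where "b = r eta"
    have re: "embed B \<in> V \<and> r (embed B) = aev a B" for B
      by (induction B) (auto simp: embed_pCons em.hom_0 V_closed cV True rc ac.ev_pCons a_def V01 r01)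
    obtain P where P: "minpoly a P" using ex_minpoly by blast
    have rP: "r (embed P) = 0" using re P by (simp add: minpoly_def)
    have "inverse (embed P) \<notin> V" using r_unit[OF rP] re minpoly_embed_nz[OF P] by blast
    hence "V \<noteq> C" using embed_C C_simps(2) by blast
    hence Vcl: "V \<in> closed_points C" using val_ring_axioms cV by (auto simp: closed_points_iff)
    note EV = eta_in_finite[OF Vcl True]
    have eV: "eta \<in> V" using EV E_eta by metis
    have rE: "r (E B) = theta a b B" for B
    proof (induction B)
      case (pCons c B)
      have "E (pCons c B) = embed c + eta * E B" by (simp add: em.ev_pCons)
      thus ?case using pCons.IH re[of c] V_closed eV EV[of B]
        by (simp add: theta_def comm_hom.ev_pCons[OF hom_at] b_def)
    qed (simp add: r01 theta_simps)
    have "theta a b f = 0" using rE[of f] E_f r01 by simp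
    hence b: "b \<in> Y a"
      by (simp add: theta_def f_def comm_hom.ev_diff[OF hom_at] comm_hom.ev_monom[OF hom_at]
        comm_hom.ev_const[OF hom_at] comm_hom.hom_1[OF hom_at] Y_def)
    have OV: "E B / E D \<in> V \<and> r (E B / E D) = theta a b B / theta a b D" if D: "theta a b D \<noteq> 0" for B D
    proof -
      have D0: "E D \<noteq> 0" using theta_nz[OF b D] .
      have "E D \<notin> M" using rM[of "E D"] rE D by auto
      hence i: "inverse (E D) \<in> V" using unit_V EV by blast
      have "r (E D) * r (inverse (E D)) = 1" using V_closed(4)[OF EV i, of D] D0 r01 by simp
      hence "r (inverse (E D)) = inverse (theta a b D)" using D by (simp add: rE inverse_unique)
      thus ?thesis using V_closed[OF EV i, of B] by (simp add: divide_inverse rE)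
    qed
    interpret L: val_ring C "\<O> a b" by (rule val_ring_O[OF b])
    have VO: "z \<in> \<O> a b" if z: "z \<in> V" for z
    proof (rule ccontr)
      assume n: "z \<notin> \<O> a b"
      have zC: "z \<in> C" using z sub by blast
      have z0: "z \<noteq> 0" using n L.V_0 by auto
      have "inverse z \<in> L.M" using L.not_V_M[OF zC n] .
      then obtain w where w: "w \<in> \<O> a b" "inverse z = embed P * w" using M_O_divisible[OF P b] by blast
      hence wV: "w \<in> V" using OV by (auto simp: \<O>_def)
      have "r (inverse z) = 0" using V_closed(4)[of "embed P" w] wV re rP by (simp add: w)
      moreover have "inverse z \<in> V" unfolding w(2) using V_closed(2) wV re by blast
      ultimately show False using r_unit[of "inverse z"] z z0 by simp
    qed
    have "\<pi> z = place_fin a b z" for z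
    proof (cases "z \<in> V")
      case True
      from VO[OF this] obtain B D where zz: "z = E B / E D" "theta a b D \<noteq> 0"
        unfolding \<O>_def by blast
      thus ?thesis using some[OF True] OV place_fin_eq[OF b] by simp
    next
      case False
      hence "z \<notin> \<O> a b" using OV by (auto simp: \<O>_def)
      thus ?thesis using False by (auto simp: place_fin_def V_def)
    qed
    moreover have "a \<in> L" "b \<in> L"
      using ran some[OF True] some[OF eV] by (auto simp: a_def b_def ran_def)
    ultimately show ?thesis using b by blast
  qed
qed

theorem card_rational_points:
  assumes "m > 0" "n dvd m"
  shows "card (rational_points C (GF (p ^ m))) =
    Suc (card {(a, b). a \<in> K.fld m \<and> b \<in> K.fld m \<and> b ^ p - b = aev a h})"
proof -
  let ?P = "{(a, b). a \<in> K.fld m \<and> b \<in> K.fld m \<and> b ^ p - b = aev a h}"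
  have GF: "GF (p ^ m) = K.fld m" by (simp add: GF_def K.fld_def)
  have L: "range (to_ac :: 'k \<Rightarrow> _) \<subseteq> K.fld m" using K.fld_dvd[OF assms(2) to_ac_fld] by auto
  have eq: "rational_points C (GF (p ^ m)) = insert place_inf ((\<lambda>(a, b). place_fin a b) ` ?P)"
  proof (intro equalityI subsetI)
    fix \<pi> assume "\<pi> \<in> rational_points C (GF (p ^ m))"
    from rational_point_cases[OF this]
    show "\<pi> \<in> insert place_inf ((\<lambda>(a, b). place_fin a b) ` ?P)"
      unfolding GF Y_def by auto
  next
    fix \<pi> assume "\<pi> \<in> insert place_inf ((\<lambda>(a, b). place_fin a b) ` ?P)"
    thus "\<pi> \<in> rational_points C (GF (p ^ m))"
      unfolding GF using place_inf_rational[OF L] place_fin_rational[OF assms(2)] by (auto simp: Y_def)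
  qed
  have fin: "finite ?P"
    by (rule finite_subset[of _ "K.fld m \<times> K.fld m"]) (use K.card_fld assms in auto)
  \<comment> \<open>The values at \<open>gen_x\<close> and \<open>eta\<close> recover
    \<open>(a, b)\<close>, whereas \<open>place_inf\<close> is undefined at \<open>gen_x\<close>; so
    all these places are distinct.\<close>
  have x: "place_fin a b gen_x = Some a" "place_fin a b eta = Some b" if "b \<in> Y a" for a b
    using place_fin_E[OF that, of "[:[:0, 1:]:]"] place_fin_E[OF that, of "[:0, 1:]"]
    by (simp_all add: E_x E_eta theta_const ac.ev_X comm_hom.ev_X[OF hom_at, folded theta_def])
  have inj: "inj_on (\<lambda>(a, b). place_fin a b) ?P"
  proof (rule inj_onI, clarify)
    fix a b a' b' assume *: "b ^ p - b = aev a h" "b' ^ p - b' = aev a' h" "place_fin a b = place_fin a' b'"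
    have "place_fin a b gen_x = place_fin a' b' gen_x" "place_fin a b eta = place_fin a' b' eta" using * by auto
    thus "a = a' \<and> b = b'" using x[of b a] x[of b' a'] * by (simp add: Y_def)
  qed
  have "gen_x \<notin> Vinf" using infinite_Vinf by (simp add: infinite_place_iff)
  hence "place_inf gen_x = None" by (simp add: place_inf_def)
  hence "place_inf \<notin> (\<lambda>(a, b). place_fin a b) ` ?P" using x by (force simp: Y_def)
  thus ?thesis unfolding eq using fin by (simp add: card_image[OF inj])
qed

section \<open>The genus\<close>

text \<open>This is where smoothness of the affine curve enters: the numerator vanishes at every
  point above a root of the denominator, so \<open>vanishing_over\<close> cancels the minimal
  polynomial of that root and the degree of the denominator drops.\<close>

lemma regular_function:
  assumes "z \<in> C" and fin: "\<And>V. V \<in> closed_points C \<Longrightarrow> gen_x \<in> V \<Longrightarrow> z \<in> V"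
  shows "\<exists>B. z = E B"
proof -
  obtain B r where "r \<noteq> 0" "z = E B / embed r" using C_denominator[OF assms(1)] by blast
  thus ?thesis
  proof (induction "degree r" arbitrary: r B rule: less_induct)
    case less
    show ?case
    proof (cases "degree r = 0")
      case True
      then obtain c where c: "r = [:c:]" by (metis degree_eq_zeroE)
      hence "z = E ([:[:inverse c:]:] * B)"
        using less.prems by (simp only: em.ev_mult E_const) (simp add: embed_const const_hom divide_inverse mult.commute)
      thus ?thesis by blast
    next
      case False
      then obtain a where a: "aev a r = 0" using root_exists by blast
      obtain P where P: "minpoly a P" using ex_minpoly by blast
      then obtain s where s: "r = P * s" using a by (auto simp: minpoly_def)
      have s0: "s \<noteq> 0" "degree s < degree r"
        using s less.prems degree_minpoly[OF P] P by (auto simp: degree_mult_eq)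
      have "theta a b B = 0" if b: "b \<in> Y a" for b
      proof -
        have "z \<in> \<O> a b" using fin closed_point_O[OF b] by blast
        then obtain B' D' where D': "z = E B' / E D'" "theta a b D' \<noteq> 0" unfolding \<O>_def by blast
        have "E (B * D') = E (B' * [:r:])"
          using D' less.prems theta_nz[OF b D'(2)] by (simp only: em.ev_mult E_embed) (simp add: field_simps)
        from theta_E[OF b this] have "theta a b B * theta a b D' = theta a b B' * aev a r"
          by (simp only: theta_simps(2) theta_const)
        thus ?thesis using a D' by simp
      qed
      then obtain B'' where "E B = embed P * E B''" using vanishing_over[OF P] by blast
      hence "z = E B'' / embed s"
        using less.prems s minpoly_embed_nz[OF P] by (simp add: em.hom_mult)
      thus ?thesis using less.hyps[OF s0(2) s0(1)] by blast
    qed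
  qed
qed

lemma local_ring_eqI:
  assumes b: "b \<in> Y a" "b' \<in> Y a" and sub: "\<O> a b \<subseteq> \<O> a b'"
  shows "\<O> a b = \<O> a b'"
proof -
  interpret L: val_ring C "\<O> a b" by (rule val_ring_O[OF b(1)])
  interpret L': val_ring C "\<O> a b'" by (rule val_ring_O[OF b(2)])
  obtain P where P: "minpoly a P" using ex_minpoly by blast
  have "z \<in> \<O> a b" if z: "z \<in> \<O> a b'" for z
  proof (rule ccontr)
    assume n: "z \<notin> \<O> a b"
    have zC: "z \<in> C" using z L'.sub by blast
    have z0: "z \<noteq> 0" using n L.V_0 by auto
    have "inverse z \<in> L.M" using L.not_V_M[OF zC n] .
    then obtain w where w: "w \<in> \<O> a b" "inverse z = embed P * w" using M_O_divisible[OF P b(1)] by blast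
    hence "inverse z \<in> L'.M" using L'.M_mult[OF minpoly_M[OF P b(2)]] sub by auto
    thus False using L'.M_mult[of "inverse z" z] z z0 L'.one_not_M by simp
  qed
  thus ?thesis using sub by blast
qed

text \<open>Local rings do not properly contain each other, so for every other place above
  \<open>a\<close> some function vanishes there but not at \<open>b\<close>. The exponent
  \<open>k\<close> normalises the values to 0 and 1 before the product is taken.\<close>

lemma ex_separating:
  assumes b: "b \<in> Y a"
  shows "\<exists>D0. theta a b D0 = 1 \<and> (\<forall>b'\<in>Y a. \<O> a b' \<noteq> \<O> a b \<longrightarrow> theta a b' D0 = 0)"
proof -
  define S where "S = {b'\<in>Y a. \<O> a b' \<noteq> \<O> a b}"
  have "\<exists>D. theta a b D \<noteq> 0 \<and> theta a b' D = 0" if b': "b' \<in> S" for b'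
  proof (rule ccontr)
    assume "\<not> ?thesis"
    hence "\<O> a b \<subseteq> \<O> a b'" unfolding \<O>_def by blast
    thus False using local_ring_eqI[OF b, of b'] b' by (auto simp: S_def)
  qed
  then obtain D where D: "\<And>b'. b' \<in> S \<Longrightarrow> theta a b (D b') \<noteq> 0 \<and> theta a b' (D b') = 0" by metis
  have finS: "finite S" using Y by (simp add: S_def)
  obtain k where k: "k > 0" "\<And>b'' B. b'' \<in> Y a \<Longrightarrow> B \<in> D ` S \<Longrightarrow> theta a b'' (B ^ k) = (if theta a b'' B = 0 then 0 else 1)"
    using ex_idempotent_exponent[of "D ` S" a] finS by blast
  have "theta a b (\<Prod>b'\<in>S. D b' ^ k) = 1"
    unfolding theta_simps(9) using k(2)[OF b] D by (intro prod.neutral) auto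
  moreover have "theta a b' (\<Prod>b'\<in>S. D b' ^ k) = 0" if "b' \<in> Y a" "\<O> a b' \<noteq> \<O> a b" for b'
  proof -
    have "b' \<in> S" using that by (simp add: S_def)
    moreover from this have "theta a b' (D b' ^ k) = 0" using k(2)[OF that(1)] D by auto
    ultimately show ?thesis unfolding theta_simps(9) by (intro prod_zero[OF finS]) blast
  qed
  ultimately show ?thesis by blast
qed

text \<open>
  Let \<open>y = B / (D P\<^sup>s)\<close> with \<open>D\<close> a unit there, and let \<open>D\<^sub>2\<close> be a
  multiple of \<open>D\<close> that has the value \<open>1\<close> at this place and \<open>0\<close> at the other places over \<open>P\<close>. A high power of
  \<open>p\<close> as exponent makes \<open>D\<^sub>2\<close> congruent to \<open>1\<close> resp. \<open>0\<close> modulo \<open>P\<^sup>s\<close>.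
\<close>

lemma approximation:
  assumes V0: "V0 \<in> closed_points C" "gen_x \<in> V0" and y: "y \<in> C"
  shows "\<exists>z\<in>C. y - z \<in> V0 \<and> (\<forall>V\<in>closed_points C. gen_x \<in> V \<longrightarrow> V \<noteq> V0 \<longrightarrow> z \<in> V)"
proof -
  obtain a P where P: "minpoly a P" "embed P \<in> val_ring.M V0" using ex_minpoly_M[OF V0] by blast
  then obtain b where b: "b \<in> Y a" "V0 = \<O> a b" using finite_place_over[OF V0] by blast
  have P0: "embed P \<noteq> 0" by (rule minpoly_embed_nz[OF P(1)])
  obtain B0 D0 where y0: "y = E B0 / E D0" "E D0 \<noteq> 0" using y by (auto simp: C_def)
  obtain s D1 D where D: "theta a b D1 \<noteq> 0" "theta a b D \<noteq> 0" "E D1 * E D0 = embed P ^ s * E D"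
    using uniformizer[OF P(1) b(1) y0(2)] by blast
  have nz: "E D1 \<noteq> 0" "E D \<noteq> 0" using theta_nz[OF b(1)] D by auto
  define B where "B = B0 * D1"
  have "y = E B / (E D1 * E D0)" using y0 nz by (simp add: B_def em.ev_mult)
  hence yB: "y = E B / (E D * embed P ^ s)" unfolding D(3) by (simp only: mult.commute)
  obtain c where c: "theta a b c = 1" "\<And>b'. b' \<in> Y a \<Longrightarrow> \<O> a b' \<noteq> \<O> a b \<Longrightarrow> theta a b' c = 0"
    using ex_separating[OF b(1)] by blast
  obtain k where k: "k > 0" "\<And>b'. b' \<in> Y a \<Longrightarrow> theta a b' (D ^ k) = (if theta a b' D = 0 then 0 else 1)"
    using ex_idempotent_exponent[of "{D}" a] by auto
  define D2 where "D2 = D ^ k * c"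
  define t where "t = p ^ s"
  have t: "t > s"
  proof -
    have "s < 2 ^ s" by (rule less_exp)
    also have "\<dots> \<le> t" unfolding t_def using p_gt_1 by (intro power_mono) auto
    finally show ?thesis .
  qed
  have D2: "theta a b D2 = 1" using k(2)[OF b(1)] D c by (simp add: D2_def theta_simps)
  \<comment> \<open>One factor \<open>D2\<close> is spent on cancelling the denominator
    \<open>D\<close>, of which it is a multiple; the remaining \<open>D2 ^ (t - 1)\<close> still
    absorbs \<open>P ^ s\<close> at the other places, as \<open>t > s\<close>.\<close>
  define w where "w = B * (D ^ (k - 1) * c) * D2 ^ (t - 1)"
  have "D2 ^ t = D2 * D2 ^ (t - 1)" using t by (cases t) auto
  moreover have "D2 = D * (D ^ (k - 1) * c)" using k(1) by (cases k) (auto simp: D2_def)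
  ultimately have "D * w = B * D2 ^ t" by (simp add: w_def mult_ac)
  hence Dw: "E D * E w = E B * E D2 ^ t" by (metis em.ev_mult em.ev_power)
  define z where "z = E w / embed P ^ s"
  have pw: "embed P ^ i = E ([:P:] ^ i)" for i by (simp only: em.ev_power E_embed)
  have zC: "z \<in> C" unfolding z_def pw by (rule C_divide) (use P0 in \<open>simp add: em.ev_power E_embed\<close>)
  have split: "(embed P * v) ^ i / embed P ^ s = E ([:P:] ^ (i - s)) * v ^ i" if "i \<ge> s" for v i
  proof -
    have "embed P ^ i = embed P ^ (i - s) * embed P ^ s" using that by (simp flip: power_add)
    thus ?thesis using P0 by (simp add: power_mult_distrib pw[symmetric])
  qed
  interpret A: frobenius_power "\<lambda>z :: 'k ambient. z ^ p" p by (rule frobenius_ambient)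
  interpret L: val_ring C "\<O> a b" by (rule val_ring_O[OF b(1)])
  have "y - z \<in> \<O> a b"
  proof -
    have "theta a b (1 - D2) = 0" using D2 by (simp add: theta_simps)
    hence "E (1 - D2) \<in> L.M" using O_M_E_iff[OF b(1)] by blast
    then obtain v where v: "v \<in> \<O> a b" "E (1 - D2) = embed P * v"
      using M_O_divisible[OF P(1) b(1)] by blast
    have ft: "(1 - E D2) ^ t = 1 - E D2 ^ t" unfolding t_def by (simp add: A.diff_pow_p_pow)
    have "z = E B * E D2 ^ t / (E D * embed P ^ s)"
      unfolding z_def Dw[symmetric] using nz by simp
    hence "y - z = (E B / E D) * ((1 - E D2 ^ t) / embed P ^ s)"
      unfolding yB using nz P0 by (simp add: field_simps)
    also have "\<dots> = (E B / E D) * (E (1 - D2) ^ t / embed P ^ s)" by (simp add: ft[symmetric] em.ev_diff em.ev_1)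
    also have "\<dots> = (E B / E D) * (E ([:P:] ^ (t - s)) * v ^ t)"
      unfolding v(2) using split[of t v] t by simp
    also have "\<dots> \<in> \<O> a b" using v D by (intro L.V_mult L.V_power O_I E_O)
    finally show ?thesis .
  qed
  moreover have "z \<in> V" if V: "V \<in> closed_points C" "gen_x \<in> V" "V \<noteq> V0" for V
  proof (cases "embed P \<in> val_ring.M V")
    case False
    interpret W: val_ring C V using V closed_points_iff by blast
    note EV = eta_in_finite[OF V(1,2)]
    have "inverse (embed P) \<in> V" using W.unit_V[OF _ False] EV[of "[:P:]"] by (simp add: E_embed)
    thus ?thesis unfolding z_def divide_inverse power_inverse[symmetric] by (intro W.V_mult EV W.V_power)
  next
    case True
    then obtain b' where b': "b' \<in> Y a" "V = \<O> a b'" using finite_place_over[OF V(1,2) P(1)] by blast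
    interpret W: val_ring C "\<O> a b'" by (rule val_ring_O[OF b'(1)])
    have "theta a b' D2 = 0" using c(2)[OF b'(1)] b' b V by (simp add: D2_def theta_simps)
    hence "E D2 \<in> W.M" using O_M_E_iff[OF b'(1)] by blast
    then obtain v where v: "v \<in> \<O> a b'" "E D2 = embed P * v" using M_O_divisible[OF P(1) b'(1)] by blast
    have "z = E (B * (D ^ (k - 1) * c)) * (E D2 ^ (t - 1) / embed P ^ s)"
      by (simp only: z_def w_def em.ev_mult em.ev_power times_divide_eq_right)
    also have "\<dots> = E (B * (D ^ (k - 1) * c)) * (E ([:P:] ^ (t - 1 - s)) * v ^ (t - 1))"
      unfolding v(2) using split[of "t - 1" v] t by simp
    also have "\<dots> \<in> \<O> a b'" using v by (intro W.V_mult W.V_power E_O)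
    finally show ?thesis using b' by simp
  qed
  ultimately show ?thesis using zC b(2) by blast
qed

lemma approximation_finite:
  assumes r: "r \<in> repartitions C"
  shows "\<exists>z\<in>C. \<forall>V\<in>closed_points C. gen_x \<in> V \<longrightarrow> r V - z \<in> V"
proof -
  define S where "S = {V\<in>closed_points C. r V \<notin> V \<and> gen_x \<in> V}"
  have fin: "finite S"
    by (rule finite_subset[of _ "{V \<in> closed_points C. r V \<notin> V}"]) (use r in \<open>auto simp: S_def repartitions_def\<close>)
  have "\<exists>z\<in>C. r V0 - z \<in> V0 \<and> (\<forall>V\<in>closed_points C. gen_x \<in> V \<longrightarrow> V \<noteq> V0 \<longrightarrow> z \<in> V)" if "V0 \<in> S" for V0
    by (rule approximation) (use that r in \<open>auto simp: S_def repartitions_def\<close>)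
  then obtain g where g: "\<And>V0. V0 \<in> S \<Longrightarrow> g V0 \<in> C" "\<And>V0. V0 \<in> S \<Longrightarrow> r V0 - g V0 \<in> V0"
    "\<And>V0 V. V0 \<in> S \<Longrightarrow> V \<in> closed_points C \<Longrightarrow> gen_x \<in> V \<Longrightarrow> V \<noteq> V0 \<Longrightarrow> g V0 \<in> V"
    by metis
  have "r V - (\<Sum>W\<in>S. g W) \<in> V" if Vc: "V \<in> closed_points C" "gen_x \<in> V" for V
  proof -
    interpret val_ring C V using Vc closed_points_iff by blast
    show ?thesis
    proof (cases "V \<in> S")
      case True
      hence "r V - (\<Sum>W\<in>S. g W) = (r V - g V) - (\<Sum>W\<in>S - {V}. g W)"
        using fin by (simp add: sum.remove[of S V])
      moreover have "(\<Sum>W\<in>S - {V}. g W) \<in> V" using g(3) Vc by (intro V_sum) auto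
      ultimately show ?thesis using V_diff[OF g(2)[OF True]] by metis
    next
      case False
      hence "r V \<in> V" using Vc by (auto simp: S_def)
      moreover have "(\<Sum>W\<in>S. g W) \<in> V" using g(3) Vc False by (intro V_sum) auto
      ultimately show ?thesis by (rule V_diff)
    qed
  qed
  moreover have "(\<Sum>W\<in>S. g W) \<in> C" using g by (intro C_sum)
  ultimately show ?thesis by blast
qed

text \<open>Their weights are the gaps of the numerical semigroup generated by \<open>p\<close> and
  \<open>N\<close>, the Weierstrass gaps at infinity: every integer is a weight with
  \<open>0 \<le> j < p\<close> in just one way, and a positive one is in the semigroup iff
  \<open>i \<ge> 0\<close>.\<close>

definition gaps :: "(int \<times> nat) set" where
  "gaps = {(i, j). i < 0 \<and> j < p \<and> wt i j > 0}"

definition gmono :: "int \<times> nat \<Rightarrow> 'k ambient" where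
  "gmono g = mono (fst g) (int (snd g))"

lemma finite_gaps: "finite gaps"
proof -
  have "(i, j) \<in> {- int (N * p)..0} \<times> {..<p}" if "(i, j) \<in> gaps" for i j
  proof -
    have ij: "i < 0" "j < p" "int p * (- i) < int N * int j" using that by (auto simp: gaps_def wt_def)
    have "- i \<le> int p * (- i)" using ij p_gt_1 by (simp add: mult_le_cancel_right1)
    also have "\<dots> \<le> int N * int j" using ij by simp
    also have "\<dots> \<le> int N * int p" using ij by (intro mult_left_mono) auto
    finally show ?thesis using ij by simp
  qed
  hence "gaps \<subseteq> {- int (N * p)..0} \<times> {..<p}" by auto
  thus ?thesis by (rule finite_subset) simp
qed

lemma gmono_C: "gmono g \<in> C"
  by (simp add: gmono_def mono_C)

text \<open>\<open>x ^ (- N) y ^ p\<close> is the unit \<open>U\<close>, so multiples of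
  \<open>p\<close> can be moved from the exponent of \<open>y\<close> to that of \<open>x\<close>
  without changing the weight; only the constant changes.\<close>

lemma ex_lead_reduced:
  assumes z: "z \<in> C" "z \<noteq> 0"
  shows "\<exists>i j c. j < p \<and> c \<noteq> 0 \<and> z / mono i (int j) - const c \<in> val_ring.M Vinf"
proof -
  interpret infinite_place p0 p n N h C Vinf by (rule infinite_Vinf)
  obtain i j l where l: "l \<noteq> 0" "z / mono i j - const l \<in> M" using ex_lead[OF z] infinite_Vinf by blast
  define j' where "j' = nat (j mod int p)"
  define i' where "i' = i + int N * (j div int p)"
  have j': "int j' = j mod int p" "j' < p" using p_gt_1 by (simp_all add: j'_def nat_less_iff)
  have "j = int p * (j div int p) + int j'" using j' by simp
  hence "wt i j = int p * i + int N * (int p * (j div int p) + int j')" by (simp add: wt_def)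
  also have "\<dots> = wt i' (int j')" by (simp add: wt_def i'_def algebra_simps)
  finally have w: "wt (i - i') (j - int j') = 0" by (simp add: wt_def algebra_simps)
  let ?u = "z / mono i' (int j')"
  have "?u / mono (i - i') (j - int j') = z / mono i j"
    using mono_nz by (simp add: mono_divide[symmetric])
  hence q: "?u / mono (i - i') (j - int j') - const l \<in> M" using l(2) by (simp only:)
  hence u: "?u \<in> Vinf" "?u \<notin> M" using lead_V_iff[OF q l(1)] w by auto
  obtain c where c: "?u - const c \<in> M" using infinite_residue[OF infinite_Vinf u(1)] by blast
  have "c \<noteq> 0" using c u by (auto simp: const_hom)
  thus ?thesis using c j' by blast
qed

text \<open>Induction on the pole order at infinity: the leading monomial is subtracted, as a gap
  monomial if \<open>i < 0\<close> and as the polynomial \<open>x ^ i y ^ j\<close>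
  otherwise.\<close>

lemma gap_decomposition:
  assumes "z \<in> C"
  shows "\<exists>a B. z - E B - (\<Sum>g\<in>gaps. const (a g) * gmono g) \<in> Vinf"
proof -
  interpret infinite_place p0 p n N h C Vinf by (rule infinite_Vinf)
  define bnd where "bnd z w \<longleftrightarrow> (z = 0 \<or> (\<exists>i j c. j < p \<and> c \<noteq> 0 \<and> z / mono i (int j) - const c \<in> M \<and> wt i (int j) \<le> int w))"
    for z and w :: nat
  have main: "bnd z w \<Longrightarrow> z \<in> C \<Longrightarrow> \<exists>a B. z - E B - (\<Sum>g\<in>gaps. const (a g) * gmono g) \<in> Vinf" for z w
  proof (induction w arbitrary: z rule: less_induct)
    case (less w)
    have triv: ?case if "z \<in> Vinf"
      using that by (intro exI[of _ "\<lambda>_. 0"] exI[of _ 0]) (simp add: const_hom)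
    show ?case
    proof (cases "z \<in> Vinf")
      case False
      hence "z \<noteq> 0" using V_0 by auto
      then obtain i j c where ij: "j < p" "c \<noteq> 0" "z / mono i (int j) - const c \<in> M" "wt i (int j) \<le> int w"
        using less.prems(1) by (auto simp: bnd_def)
      have wpos: "wt i (int j) > 0" using lead_V_iff(1)[OF ij(3,2)] False by simp
      let ?m = "const c * mono i (int j)"
      define z' where "z' = z - ?m"
      have z'C: "z' \<in> C" using less.prems mono_C const_C C_simps by (simp add: z'_def)
      have small: "z' / mono i (int j) \<in> M"
        using ij(3) mono_nz by (simp add: z'_def diff_divide_distrib)
      have "bnd z' (nat (wt i (int j) - 1))"
      proof (cases "z' = 0")
        case False
        then obtain i' j' c' where i': "j' < p" "c' \<noteq> 0" "z' / mono i' (int j') - const c' \<in> M"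
          using ex_lead_reduced[OF z'C] by blast
        have "z' / mono i (int j) / mono (i' - i) (int j' - int j) = z' / mono i' (int j')"
          using mono_nz by (simp add: mono_divide[symmetric])
        hence q: "z' / mono i (int j) / mono (i' - i) (int j' - int j) - const c' \<in> M" using i'(3) by (simp only:)
        hence "wt (i' - i) (int j' - int j) < 0" using lead_V_iff(2)[OF q i'(2)] small by blast
        hence "wt i' (int j') < wt i (int j)" by (simp add: wt_def algebra_simps)
        hence "wt i' (int j') \<le> int (nat (wt i (int j) - 1))" using wpos by simp
        thus ?thesis using i' unfolding bnd_def by blast
      qed (simp add: bnd_def)
      moreover have "nat (wt i (int j) - 1) < w" using wpos ij(4) by linarith
      ultimately obtain a B where aB: "z' - E B - (\<Sum>g\<in>gaps. const (a g) * gmono g) \<in> Vinf"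
        using less.IH z'C by blast
      show ?thesis
      proof (cases "i < 0")
        case True
        hence g: "(i, j) \<in> gaps" using ij wpos by (simp add: gaps_def)
        define a' where "a' g = a g + (if g = (i, j) then c else 0)" for g
        have "(\<Sum>g\<in>gaps. const (a' g) * gmono g) = (\<Sum>g\<in>gaps. const (a g) * gmono g + (if g = (i, j) then ?m else 0))"
          by (intro sum.cong refl) (auto simp: a'_def const_hom gmono_def algebra_simps)
        also have "\<dots> = (\<Sum>g\<in>gaps. const (a g) * gmono g) + ?m"
          using g finite_gaps by (simp add: sum.distrib)
        finally have "z - E B - (\<Sum>g\<in>gaps. const (a' g) * gmono g) = z' - E B - (\<Sum>g\<in>gaps. const (a g) * gmono g)"
          by (simp add: z'_def algebra_simps)
        thus ?thesis using aB by (intro exI[of _ a'] exI[of _ B]) (simp only:)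
      next
        case False
        have "E (monom (monom c (nat i)) j) = ?m"
          using False by (simp add: em.ev_monom embed_monom mono_def power_int_def)
        hence "z - E (B + monom (monom c (nat i)) j) - (\<Sum>g\<in>gaps. const (a g) * gmono g)
            = z' - E B - (\<Sum>g\<in>gaps. const (a g) * gmono g)"
          by (simp add: z'_def em.ev_add algebra_simps)
        thus ?thesis using aB by (intro exI[of _ a] exI[of _ "B + monom (monom c (nat i)) j"]) (simp only:)
      qed
    qed (rule triv)
  qed
  show ?thesis
  proof (cases "z = 0")
    case False
    then obtain i j c where "j < p" "c \<noteq> 0" "z / mono i (int j) - const c \<in> M"
      using ex_lead_reduced[OF assms] by blast
    hence "bnd z (nat (wt i (int j)))" unfolding bnd_def by (metis int_nat_eq linorder_le_cases order_refl)
    thus ?thesis using main assms by blast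
  qed (use main[of 0 0] C_simps in \<open>auto simp: bnd_def\<close>)
qed

lemma Vinf_closed: "Vinf \<in> closed_points C" and x_not_Vinf: "gen_x \<notin> Vinf"
  using infinite_Vinf infinite_place_iff by auto

lemma closed_point_cases: "V \<in> closed_points C \<Longrightarrow> V = Vinf \<or> gen_x \<in> V"
  using infinite_place_iff infinite_place_unique infinite_Vinf by blast

definition at_inf :: "'k ambient \<Rightarrow> 'k ambient set \<Rightarrow> 'k ambient" where
  "at_inf z V = (if V = Vinf then z else 0)"

lemma at_inf_repartition: "z \<in> C \<Longrightarrow> at_inf z \<in> repartitions C"
proof -
  assume z: "z \<in> C"
  have "0 \<in> V" if "V \<in> closed_points C" for V
    using that by (auto simp: closed_points_iff intro: val_ring.V_0)
  hence "{V \<in> closed_points C. at_inf z V \<notin> V} \<subseteq> {Vinf}" by (auto simp: at_inf_def)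
  hence "finite {V \<in> closed_points C. at_inf z V \<notin> V}" by (rule finite_subset) simp
  moreover have "at_inf z V \<in> C" for V using z C_simps(4) by (simp add: at_inf_def)
  ultimately show ?thesis by (simp add: repartitions_def)
qed

lemma gmono_inj: "inj_on gmono gaps"
proof (rule inj_onI)
  interpret infinite_place p0 p n N h C Vinf by (rule infinite_Vinf)
  fix g g' assume g: "g \<in> gaps" "g' \<in> gaps" "gmono g = gmono g'"
  obtain i j i' j' where ij: "g = (i, j)" "g' = (i', j')" by (cases g, cases g') auto
  have 1: "mono (i - i') (int j - int j') = 1" using g mono_nz by (simp add: gmono_def ij flip: mono_divide)
  have "wt (i - i') (int j - int j') = 0"
    using mono_M[of "i - i'" "int j - int j'"] mono_not_V[of "i - i'" "int j - int j'"] V_1 one_not_M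
    unfolding 1 by (cases "wt (i - i') (int j - int j')" "0 :: int" rule: linorder_cases) auto
  hence "wt i (int j) = wt i' (int j')" by (simp add: wt_def algebra_simps)
  thus "g = g'" using wt_inj[of i "int j" i' "int j'"] g by (auto simp: ij gaps_def)
qed

definition generates :: "('k ambient set \<Rightarrow> 'k ambient) set \<Rightarrow> bool" where
  "generates B \<longleftrightarrow> finite B \<and> B \<subseteq> repartitions C \<and>
     (\<forall>r\<in>repartitions C. \<exists>a. \<exists>z\<in>C. \<forall>V\<in>closed_points C. r V - z - (\<Sum>b\<in>B. const (a b) * b V) \<in> V)"

text \<open>A global function clears the finite places; what remains at infinity is decomposed into
  gap monomials and some \<open>E B\<close>, which is regular at the finite places and can be added
  to that global function.\<close>

lemma generates_gaps: "generates ((\<lambda>g. at_inf (gmono g)) ` gaps)"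
  unfolding generates_def
proof (intro conjI ballI)
  let ?b = "\<lambda>g. at_inf (gmono g)"
  show "finite (?b ` gaps)" using finite_gaps by simp
  show "?b ` gaps \<subseteq> repartitions C" using at_inf_repartition gmono_C by auto
  have inj: "inj_on ?b gaps"
  proof (rule inj_onI)
    fix g g' assume g: "g \<in> gaps" "g' \<in> gaps" "?b g = ?b g'"
    have "?b g Vinf = ?b g' Vinf" using g(3) by simp
    hence "gmono g = gmono g'" by (simp add: at_inf_def)
    thus "g = g'" using inj_onD[OF gmono_inj] g by blast
  qed
  fix r assume r: "r \<in> repartitions C"
  obtain z where z: "z \<in> C" "\<And>V. V \<in> closed_points C \<Longrightarrow> gen_x \<in> V \<Longrightarrow> r V - z \<in> V"
    using approximation_finite[OF r] by blast
  have "r Vinf - z \<in> C" using r z Vinf_closed C_simps by (auto simp: repartitions_def)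
  then obtain a B where aB: "r Vinf - z - E B - (\<Sum>g\<in>gaps. const (a g) * gmono g) \<in> Vinf"
    using gap_decomposition by blast
  define a' where "a' = a \<circ> inv_into gaps ?b"
  have sum: "(\<Sum>b\<in>?b ` gaps. const (a' b) * b V) = (\<Sum>g\<in>gaps. const (a g) * at_inf (gmono g) V)" for V
    by (subst sum.reindex[OF inj]) (simp add: a'_def inv_into_f_f[OF inj] cong: sum.cong_simp)
  have "r V - (z + E B) - (\<Sum>b\<in>?b ` gaps. const (a' b) * b V) \<in> V" if Vc: "V \<in> closed_points C" for V
  proof (cases "V = Vinf")
    case True
    thus ?thesis using aB unfolding sum by (simp add: at_inf_def diff_diff_eq)
  next
    case False
    hence x: "gen_x \<in> V" using closed_point_cases Vc by blast
    interpret val_ring C V using Vc closed_points_iff by blast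
    have "(r V - z) - E B \<in> V" by (rule V_diff[OF z(2)[OF Vc x] eta_in_finite[OF Vc x]])
    thus ?thesis unfolding sum using False by (simp add: at_inf_def diff_diff_eq)
  qed
  moreover have "z + E B \<in> C" using z E_C C_simps by blast
  ultimately show "\<exists>a. \<exists>z\<in>C. \<forall>V\<in>closed_points C. r V - z - (\<Sum>b\<in>?b ` gaps. const (a b) * b V) \<in> V"
    by blast
qed

text \<open>\<open>z\<close> is regular at all finite places, so it is some \<open>E B\<close>, with
  leading exponent \<open>i \<ge> 0\<close> if nonzero, while gaps have \<open>i < 0\<close>. By
  \<open>wt_inj\<close> the leading weights differ, so the larger one survives in the difference as
  a pole at infinity.\<close>

lemma gap_independence:
  assumes "\<delta> g1 \<noteq> 0" "g1 \<in> gaps" and z: "z \<in> C"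
    and fin: "\<And>V. V \<in> closed_points C \<Longrightarrow> gen_x \<in> V \<Longrightarrow> z \<in> V"
    and inf: "(\<Sum>g\<in>gaps. const (\<delta> g) * gmono g) - z \<in> Vinf"
  shows False
proof -
  interpret infinite_place p0 p n N h C Vinf by (rule infinite_Vinf)
  define S where "S = {g\<in>gaps. \<delta> g \<noteq> 0}"
  define w where "w g = wt (fst g) (int (snd g))" for g :: "int \<times> nat"
  have "g1 \<in> S" using assms by (simp add: S_def)
  hence "S \<noteq> {}" by blast
  moreover have "finite S" using finite_gaps by (simp add: S_def)
  ultimately have finS: "finite S" "S \<noteq> {}" by simp_all
  have "Max (w ` S) \<in> w ` S" using finS by (intro Max_in) auto
  then obtain g0 where g0: "g0 \<in> S" "w g0 = Max (w ` S)" by auto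
  have w_inj: "g = g'" if "w g = w g'" "g \<in> gaps" "g' \<in> gaps" for g g'
    using wt_inj[of "fst g" "int (snd g)" "fst g'" "int (snd g')"] that
    by (auto simp: w_def gaps_def prod_eq_iff)
  have less: "w g < w g0" if "g \<in> S" "g \<noteq> g0" for g
  proof -
    have "w g \<le> w g0" unfolding g0(2) using that finS by (intro Max_ge) auto
    moreover have "w g \<noteq> w g0" using w_inj[of g g0] that g0(1) by (auto simp: S_def)
    ultimately show ?thesis by linarith
  qed
  have wpos: "w g0 > 0" using g0 by (auto simp: w_def S_def gaps_def)
  let ?y = "\<Sum>g\<in>gaps. const (\<delta> g) * gmono g"
  have "?y = (\<Sum>g\<in>S. const (\<delta> g) * gmono g)"
    using finite_gaps by (intro sum.mono_neutral_right) (auto simp: S_def const_hom)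
  also have "\<dots> = const (\<delta> g0) * gmono g0 + (\<Sum>g\<in>S - {g0}. const (\<delta> g) * gmono g)"
    using finS g0 by (simp add: sum.remove)
  finally have y: "?y = const (\<delta> g0) * gmono g0 + (\<Sum>g\<in>S - {g0}. const (\<delta> g) * gmono g)" .
  have ylead: "?y / gmono g0 - const (\<delta> g0) \<in> M"
  proof -
    have nz: "gmono g0 \<noteq> 0" by (simp add: gmono_def mono_nz)
    have "?y / gmono g0 - const (\<delta> g0) = (\<Sum>g\<in>S - {g0}. const (\<delta> g) * (gmono g / gmono g0))"
      unfolding y using nz by (simp add: add_divide_distrib sum_divide_distrib)
    also have "\<dots> \<in> M"
    proof (intro M_sum M_mult' const_V)
      fix g assume "g \<in> S - {g0}"
      hence "w g < w g0" using less by blast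
      hence "wt (fst g - fst g0) (int (snd g) - int (snd g0)) < 0" by (simp add: w_def wt_def algebra_simps)
      thus "gmono g / gmono g0 \<in> M" using mono_M by (simp add: gmono_def mono_divide)
    qed
    finally show ?thesis .
  qed
  have \<delta>0: "\<delta> g0 \<noteq> 0" using g0 by (simp add: S_def)
  obtain B0 where "z = E B0" using regular_function[OF z fin] by blast
  then obtain B where B: "degree B < p" "z = E B" using E_reduced[of B0] by auto
  have contra: False if L: "((?y - z) / mono i j) - const l \<in> M" "l \<noteq> 0" "wt i j > 0" for i j l
    using lead_V_iff(1)[OF L(1,2)] inf L(3) by simp
  show False
  proof (cases "B = 0")
    case True
    hence "z = 0" using B by simp
    thus False using contra[of "fst g0" "int (snd g0)" "\<delta> g0"] ylead \<delta>0 wpos by (simp add: gmono_def w_def)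
  next
    case False
    obtain i j l where L: "leading B i j l" using ex_leading B False by blast
    have l: "l \<noteq> 0" "j < p" using L by (auto simp: leading_def)
    have zl: "z / mono (int i) (int j) - const l \<in> M" using leading_M[OF L B(1)] B(2) by simp
    have "wt (int i) (int j) \<noteq> w g0"
    proof
      assume "wt (int i) (int j) = w g0"
      hence "int i = fst g0" using wt_inj[of "int i" "int j" "fst g0" "int (snd g0)"] l g0
        by (auto simp: w_def S_def gaps_def)
      thus False using g0 by (auto simp: S_def gaps_def)
    qed
    then consider "wt (int i) (int j) < w g0" | "wt (int i) (int j) > w g0" by linarith
    thus False
    proof cases
      case 1
      let ?g = "gmono g0"
      have eq: "z / ?g = (z / mono (int i) (int j)) * mono (int i - fst g0) (int j - int (snd g0))"
        using mono_nz by (simp add: gmono_def mono_divide[symmetric])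
      have m: "mono (int i - fst g0) (int j - int (snd g0)) \<in> M"
        using 1 by (intro mono_M) (simp add: w_def wt_def algebra_simps)
      have "z / ?g \<in> M"
        unfolding eq by (rule M_mult'[OF _ m]) (use lead_unit[OF zl l(1)] in blast)
      hence "(?y / ?g - const (\<delta> g0)) - z / ?g \<in> M" by (rule M_diff[OF ylead])
      also have "(?y / ?g - const (\<delta> g0)) - z / ?g = (?y - z) / ?g - const (\<delta> g0)"
        by (simp add: diff_divide_distrib)
      finally show False
        using contra[of "fst g0" "int (snd g0)" "\<delta> g0"] \<delta>0 wpos by (simp add: gmono_def w_def)
    next
      case 2
      let ?g = "mono (int i) (int j)"
      have eq: "?y / ?g = (?y / gmono g0) * mono (fst g0 - int i) (int (snd g0) - int j)"
        using mono_nz by (simp add: gmono_def mono_divide[symmetric])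
      have m: "mono (fst g0 - int i) (int (snd g0) - int j) \<in> M"
        using 2 by (intro mono_M) (simp add: w_def wt_def algebra_simps)
      have "?y / ?g \<in> M"
        unfolding eq by (rule M_mult'[OF _ m]) (use lead_unit[OF ylead \<delta>0] in blast)
      hence "?y / ?g - (z / ?g - const l) \<in> M" by (rule M_diff[OF _ zl])
      also have "?y / ?g - (z / ?g - const l) = (?y - z) / ?g - const (- l)"
        by (simp add: diff_divide_distrib const_hom)
      finally show False using contra[of "int i" "int j" "- l"] l 2 wpos by simp
    qed
  qed
qed

text \<open>As \<open>k\<close> is finite, counting replaces linear algebra: with fewer generators
  than gaps, two different combinations of gap monomials would receive the same coefficients on
  \<open>B\<close>, and their difference would contradict \<open>gap_independence\<close>.\<close>

lemma card_generating:
  assumes B: "generates B"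
  shows "card gaps \<le> card B"
proof (rule ccontr)
  assume "\<not> card gaps \<le> card B"
  hence less: "card B < card gaps" by simp
  have finB: "finite B" using B by (simp add: generates_def)
  let ?F = "PiE gaps (\<lambda>_. UNIV :: 'k set)" and ?T = "PiE B (\<lambda>_. UNIV :: 'k set)"
  let ?y = "\<lambda>l. \<Sum>g\<in>gaps. const (l g) * gmono g"
  have yC: "?y l \<in> C" for l by (intro C_sum C_simps const_C gmono_C)
  define R where "R l a z \<longleftrightarrow> z \<in> C \<and> (\<forall>V\<in>closed_points C. at_inf (?y l) V - z - (\<Sum>b\<in>B. const (a b) * b V) \<in> V)"
    for l a z
  have "\<exists>a z. R l a z" for l
    using B at_inf_repartition[OF yC, of l] unfolding generates_def R_def by blast
  then obtain a z where "\<And>l. R l (a l) (z l)" by metis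
  hence az: "\<And>l. z l \<in> C"
    "\<And>l V. V \<in> closed_points C \<Longrightarrow> at_inf (?y l) V - z l - (\<Sum>b\<in>B. const (a l b) * b V) \<in> V"
    unfolding R_def by blast+
  have "card ?T < card ?F"
  proof -
    have "CARD('k) > 1" using one_less_power[OF p_gt_1 n0] card_k by simp
    thus ?thesis using less finB finite_gaps by (simp add: card_PiE power_strict_increasing)
  qed
  moreover have "(\<lambda>l. restrict (a l) B) ` ?F \<subseteq> ?T" by auto
  moreover have "finite ?T" using finB by (intro finite_PiE) auto
  ultimately have "\<not> inj_on (\<lambda>l. restrict (a l) B) ?F"
    using card_inj_on_le[of "\<lambda>l. restrict (a l) B" ?F ?T] by linarith
  then obtain l l' where l: "l \<in> ?F" "l' \<in> ?F" "l \<noteq> l'" "restrict (a l) B = restrict (a l') B"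
    unfolding inj_on_def by blast
  have a_eq: "a l b = a l' b" if "b \<in> B" for b using fun_cong[OF l(4), of b] that by simp
  obtain g1 where g1: "g1 \<in> gaps" "l g1 \<noteq> l' g1" using PiE_ext[OF l(1,2)] l(3) by blast
  define \<delta> where "\<delta> g = l g - l' g" for g
  have y_diff: "?y \<delta> = ?y l - ?y l'"
  proof -
    have "const (\<delta> g) = const (l g) - const (l' g)" for g
      using const_hom(1)[of "l g" "- l' g"] const_hom(3)[of "l' g"] by (simp add: \<delta>_def)
    thus ?thesis by (simp add: sum_subtractf left_diff_distrib)
  qed
  have diff: "at_inf (?y \<delta>) V - (z l - z l') \<in> V" if Vc: "V \<in> closed_points C" for V
  proof -
    interpret val_ring C V using Vc closed_points_iff by blast
    have "(\<Sum>b\<in>B. const (a l b) * b V) = (\<Sum>b\<in>B. const (a l' b) * b V)" using a_eq by (intro sum.cong) auto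
    hence eq: "at_inf (?y \<delta>) V - (z l - z l') =
      (at_inf (?y l) V - z l - (\<Sum>b\<in>B. const (a l b) * b V)) - (at_inf (?y l') V - z l' - (\<Sum>b\<in>B. const (a l' b) * b V))"
      unfolding y_diff by (auto simp: at_inf_def)
    show ?thesis unfolding eq by (rule V_diff[OF az(2)[OF Vc] az(2)[OF Vc]])
  qed
  show False
  proof (rule gap_independence)
    show "\<delta> g1 \<noteq> 0" "g1 \<in> gaps" using g1 by (auto simp: \<delta>_def)
    show "z l - z l' \<in> C" by (rule C_simps(7)[OF az(1) az(1)])
    show "z l - z l' \<in> V" if Vc: "V \<in> closed_points C" "gen_x \<in> V" for V
    proof -
      interpret val_ring C V using Vc closed_points_iff by blast
      have "V \<noteq> Vinf" using Vc x_not_Vinf by auto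
      hence "0 - (z l - z l') \<in> V" using diff[OF Vc(1)] unfolding at_inf_def by (simp only: if_False)
      from V_minus[OF this] show ?thesis by simp
    qed
    show "?y \<delta> - (z l - z l') \<in> Vinf" using diff[OF Vinf_closed] by (simp add: at_inf_def)
  qed
qed

theorem genus_C: "genus C = card gaps"
proof -
  have eq: "genus C = (LEAST g. \<exists>B. generates B \<and> card B = g)"
    unfolding genus_def generates_def by (rule arg_cong[of _ _ Least]) auto
  show ?thesis unfolding eq
  proof (rule Least_equality)
    let ?G = "(\<lambda>g. at_inf (gmono g)) ` gaps"
    \<comment> \<open>Coinciding repartitions would make this generating set smaller than
      \<open>card gaps\<close>, which \<open>card_generating\<close> excludes.\<close>
    have "card ?G \<le> card gaps" by (rule card_image_le[OF finite_gaps])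
    hence "card ?G = card gaps" using card_generating[OF generates_gaps] by simp
    thus "\<exists>B. generates B \<and> card B = card gaps" using generates_gaps by blast
  qed (use card_generating in auto)
qed

end

section \<open>Maximality and minimality\<close>

text \<open>Translation by 1 permutes the field, so comparing the sums of all elements shows that
  \<open>p0 ^ f0\<close> is zero in it.\<close>

lemma finite_field_char:
  assumes "prime p0" "CARD('k::{finite, field}) = p0 ^ f0"
  shows "CHAR('k) = p0"
proof -
  have 1: "(\<Sum>y\<in>UNIV. y + 1 :: 'k) = (\<Sum>y\<in>UNIV. y)"
    by (rule sum.reindex_bij_witness[of _ "\<lambda>y. y - 1" "\<lambda>y. y + 1"]) auto
  have "(\<Sum>y\<in>UNIV. y + 1 :: 'k) = (\<Sum>y\<in>UNIV. y) + of_nat (p0 ^ f0)"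
    by (simp only: sum.distrib sum_constant mult_1_right assms(2))
  hence "(of_nat (p0 ^ f0) :: 'k) = 0" unfolding 1 by (rule add_cancel_right_right[THEN iffD1])
  hence dvd: "CHAR('k) dvd p0 ^ f0" by (simp only: of_nat_eq_0_iff_char_dvd)
  have "prime CHAR('k)" by (intro prime_CHAR_semidom finite_imp_CHAR_pos finite)
  moreover from this have "CHAR('k) dvd p0" using dvd by (rule prime_dvd_power)
  ultimately show ?thesis using assms(1) by (intro primes_dvd_imp_eq)
qed

lemma power_mod_4_odd_exponent:
  assumes "p mod 4 = (3::nat)"
  shows "p ^ j mod 4 = (if odd j then 3 else 1)"
proof (induction j)
  case (Suc j)
  have "p ^ Suc j mod 4 = (p mod 4) * (p ^ j mod 4) mod 4" by (simp add: mod_mult_eq)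
  thus ?case using Suc assms by simp
qed simp

lemma power_mod_4_eq_1: "p mod 4 = (1::nat) \<Longrightarrow> p ^ j mod 4 = 1"
  using power_mod[of p 4 j] by simp

lemma map_poly_to_ac_mult: "map_poly to_ac (A * B) = map_poly to_ac A * map_poly to_ac B"
  by (rule poly_eqI) (simp add: coeff_map_poly coeff_mult to_ac_sum)

lemma map_poly_to_ac_g_poly:
  "e \<ge> 1 \<Longrightarrow> map_poly to_ac (g_poly e c) = g_poly e (\<lambda>i. to_ac (c i))"
  by (rule poly_eqI) (simp add: coeff_map_poly coeff_g_poly)

locale self_reciprocal_curve = artin_schreier p0 p n N h
  for p0 p n N and h :: "'k::{finite, field} poly" +
  fixes e and c :: "nat \<Rightarrow> 'k"
  assumes N_eq: "N = p ^ e + 1" and h_eq: "h = [:0, 1:] * R_poly p e c"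
    and odd_p: "odd p" and cong: "[p = 1] (mod n)" and e: "e \<ge> 1"
    and c: "\<And>i. i < e \<Longrightarrow> c i ^ p = c i" and g_dvd: "g_poly e c dvd monom 1 n - 1"
begin

lemma two_nz: "(2 :: 'k alg_closure) \<noteq> 0"
proof
  assume "(2 :: 'k alg_closure) = 0"
  hence "(of_nat (2 * (p div 2)) :: 'k alg_closure) = 0" by simp
  moreover have "p = 2 * (p div 2) + 1" using odd_p by presburger
  ultimately have "(of_nat p :: 'k alg_closure) = 1" by (metis add.left_neutral of_nat_1 of_nat_add)
  thus False using K.p_zero by simp
qed

lemma card_points:
  assumes m: "m > 0" "n dvd m"
  shows "int (card (rational_points C (GF (p ^ m)))) =
    1 + int (p ^ m) + int (p ^ (e + 1)) * (int (card {b\<in>K.fld m. K.tr m (b ^ 2) = 0}) - int (p ^ (m - 1)))"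
proof -
  let ?c = "\<lambda>i. to_ac (c i)"
  have ev: "aev a h = a * poly (R_poly p e ?c) a" for a
    by (simp only: h_eq ac.ev_mult ac.ev_X)
      (simp add: R_poly_def ac.ev_add ac.ev_sum ac.ev_monom poly_sum poly_monom)
  obtain u where u: "monom 1 n - 1 = g_poly e c * u" using g_dvd by (elim dvdE)
  have "K.cyc n = map_poly to_ac (monom 1 n - 1)"
    by (rule poly_eqI) (simp add: K.cyc_def coeff_map_poly coeff_1)
  also have "\<dots> = g_poly e ?c * map_poly to_ac u"
    by (simp only: u map_poly_to_ac_mult map_poly_to_ac_g_poly[OF e])
  finally have dvd: "g_poly e ?c dvd K.cyc n" by simp
  have mem: "?c i \<in> K.fld (Suc 0)" if "i < e" for i
    using c[OF that] by (simp add: K.fld_1 flip: to_ac_power)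
  have "n \<ge> 1" using n0 by simp
  from K.card_affine_points[OF this cong e two_nz mem dvd m]
  show ?thesis unfolding card_rational_points[OF m] ev by simp
qed

text \<open>With \<open>i = - t\<close> the condition is \<open>p t < (p ^ e + 1) j\<close>, which
  \<open>j < p\<close> turns into \<open>1 \<le> t \<le> p ^ (e - 1) j\<close>; the count is an
  arithmetic sum.\<close>

lemma card_gaps: "2 * card gaps = p ^ e * (p - 1)"
proof -
  let ?S = "SIGMA j:{..<p}. {1..p ^ (e - 1) * j}"
  have pe: "p ^ e = p * p ^ (e - 1)" using e by (cases e) auto
  have mem: "(- int t, j) \<in> gaps \<longleftrightarrow> (j, t) \<in> ?S" for t j
  proof -
    have "wt (- int t) (int j) = int ((p ^ e + 1) * j) - int (p * t)"
      unfolding wt_def unfolding N_eq by (simp add: algebra_simps)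
    hence "wt (- int t) (int j) > 0 \<longleftrightarrow> int (p * t) < int ((p ^ e + 1) * j)" by linarith
    also have "\<dots> \<longleftrightarrow> p * t < p * (p ^ (e - 1) * j) + j" unfolding of_nat_less_iff by (simp add: pe algebra_simps)
    also have "\<dots> \<longleftrightarrow> t \<le> p ^ (e - 1) * j" if "j < p" "t > 0"
    proof
      assume a: "p * t < p * (p ^ (e - 1) * j) + j"
      hence "p * t < p * (p ^ (e - 1) * j + 1)" using that by simp
      thus "t \<le> p ^ (e - 1) * j" by (simp only: nat_mult_less_cancel1 mult_less_cancel1) simp
    next
      assume a: "t \<le> p ^ (e - 1) * j"
      hence "j > 0" using that by (cases j) auto
      thus "p * t < p * (p ^ (e - 1) * j) + j" using mult_le_mono2[OF a, of p] by linarith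
    qed
    finally show ?thesis unfolding gaps_def by auto
  qed
  have "gaps = (\<lambda>(j, t). (- int t, j)) ` ?S"
  proof (intro equalityI subsetI)
    fix g assume g: "g \<in> gaps"
    obtain i j where ij: "g = (i, j)" by (cases g)
    have "i < 0" using g ij by (simp add: gaps_def)
    then obtain t where t: "i = - int t" by (metis neg_int_cases)
    hence "(j, t) \<in> ?S" using g mem[of t j] ij by simp
    thus "g \<in> (\<lambda>(j, t). (- int t, j)) ` ?S" using ij t by (intro image_eqI[of _ _ "(j, t)"]) auto
  next
    fix g assume "g \<in> (\<lambda>(j, t). (- int t, j)) ` ?S"
    then obtain j t where "(j, t) \<in> ?S" "g = (- int t, j)" by auto
    thus "g \<in> gaps" using mem[of t j] by blast
  qed
  moreover have "inj_on (\<lambda>(j, t). (- int t, j)) ?S" by (auto simp: inj_on_def)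
  ultimately have "card gaps = card ?S" by (simp add: card_image)
  also have "\<dots> = p ^ (e - 1) * (\<Sum>j<p. j)" by (simp add: sum_distrib_left)
  finally have "2 * card gaps = p ^ (e - 1) * (2 * (\<Sum>j<p. j))" by simp
  also have "2 * (\<Sum>j<p. j) = p * (p - 1)"
    by (induction p) (auto simp: algebra_simps)
  finally show ?thesis by (simp add: pe)
qed

lemma genus_eq: "2 * real (genus C) = real (p ^ e * (p - 1))"
  using card_gaps genus_C by (metis of_nat_mult of_nat_numeral)

theorem even_extension:
  assumes k: "k > 0" "n dvd 2 * k"
  shows "p ^ k mod 4 = 3 \<Longrightarrow> maximal_curve (p ^ (2 * k)) C"
    "p ^ k mod 4 \<noteq> 3 \<Longrightarrow> minimal_curve (p ^ (2 * k)) C"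
proof -
  let ?Z = "int (card {b\<in>K.fld (2 * k). K.tr (2 * k) (b ^ 2) = 0})"
  let ?card = "card (rational_points C (GF (p ^ (2 * k))))"
  have sq: "sqrt (real (p ^ (2 * k))) = real p ^ k"
  proof -
    have "real (p ^ (2 * k)) = (real p ^ k)\<^sup>2" by (simp add: mult.commute flip: power_mult)
    thus ?thesis by (simp only: real_sqrt_abs) simp
  qed
  have pk: "p ^ k = p * p ^ (k - 1)" using k by (cases k) auto
  \<comment> \<open>Both sides are \<open>2 g sqrt Q\<close> for \<open>Q = p ^ (2 * k)\<close>: the
    deviation of the point count from \<open>Q + 1\<close> attains the bound.\<close>
  have d: "int (p ^ (e + 1)) * (int (p ^ k) - int (p ^ (k - 1))) = int (p ^ e * (p - 1) * p ^ k)"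
    using p_gt_1 unfolding pk by (simp add: of_nat_diff algebra_simps)
  have le: "p ^ (k - 1) \<le> p ^ k" using p_gt_1 by (intro power_increasing) auto
  have g: "2 * real (genus C) * sqrt (real (p ^ (2 * k))) = real_of_int (int (p ^ e * (p - 1) * p ^ k))"
    unfolding genus_eq sq by simp
  have pts: "int ?card = 1 + int (p ^ (2 * k)) + int (p ^ (e + 1)) * (?Z - int (p ^ (2 * k - 1)))"
    by (rule card_points[OF _ k(2)]) (use k(1) in simp)
  note Z = K.card_trace_square_even[OF k(1) odd_p]
  have real_card: "real ?card = real (p ^ (2 * k)) + 1 + real_of_int y" if "int ?card = 1 + int (p ^ (2 * k)) + y" for y
    using arg_cong[OF that, of real_of_int] by (simp only: of_int_add of_int_1 of_int_of_nat_eq add_ac)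
  { assume "p ^ k mod 4 = 3"
    hence z: "?Z - int (p ^ (2 * k - 1)) = int (p ^ k) - int (p ^ (k - 1))"
      using Z le by (simp add: of_nat_diff)
    from real_card[OF pts[unfolded z d]]
    show "maximal_curve (p ^ (2 * k)) C" unfolding maximal_curve_def g . }
  { assume "p ^ k mod 4 \<noteq> 3"
    hence "?Z - int (p ^ (2 * k - 1)) = - (int (p ^ k) - int (p ^ (k - 1)))"
      using Z le by simp
    from real_card[OF pts[unfolded this mult_minus_right d]]
    show "minimal_curve (p ^ (2 * k)) C"
      unfolding minimal_curve_def g of_int_minus diff_conv_add_uminus . }
qed

text \<open>In odd degree \<open>tr(b ^ 2)\<close> has exactly \<open>p ^ (m - 1)\<close> zeros, so
  there are \<open>p ^ m + 1\<close> points, strictly between the two bounds because the genus is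
  positive.\<close>

theorem odd_extension:
  assumes "odd m" "n dvd m"
  shows "\<not> maximal_curve (p ^ m) C" "\<not> minimal_curve (p ^ m) C"
proof -
  have m: "m > 0" using assms by (auto intro: Nat.gr0I)
  have "card {b\<in>K.fld m. K.tr m (b ^ 2) = 0} = p ^ (m - 1)"
    by (rule K.card_trace_square_odd[OF assms(1) two_nz])
  hence "int (card (rational_points C (GF (p ^ m)))) = int (1 + p ^ m)"
    using card_points[OF m assms(2)] by simp
  hence "card (rational_points C (GF (p ^ m))) = 1 + p ^ m" by (rule of_nat_eq_iff[THEN iffD1])
  hence "real (card (rational_points C (GF (p ^ m)))) = real (p ^ m) + 1" by simp
  moreover have "2 * real (genus C) * sqrt (real (p ^ m)) > 0"
    unfolding genus_eq using p_gt_1 by simp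
  ultimately show "\<not> maximal_curve (p ^ m) C" "\<not> minimal_curve (p ^ m) C"
    unfolding maximal_curve_def minimal_curve_def by linarith+
qed

end

theorem theorem5p4:
  fixes p0 p n q f0 e :: nat
    and c :: "nat \<Rightarrow> 'k::{finite, field}"
    and C :: "'k ambient set"
  assumes "prime p0" and "odd p0"
    and "\<exists>m\<ge>1. p = p0 ^ m"
    and "n \<ge> 1" and "[p = 1] (mod n)"
    and "q = p ^ n" and "q = p0 ^ f0"
    and "CARD('k) = q"
    and "e \<ge> 1"
    and "\<forall>i<e. c i ^ p = c i"  \<comment> \<open>that is, \<open>c i\<close> lies in the subfield of order \<open>p\<close>\<close>
    and "g_poly e c dvd monom 1 n - 1"
    and "C = compactification (artin_schreier_poly p (R_poly p e c))"
  shows "(q mod 4 = 3 \<longrightarrow> maximal_curve (q ^ 2) C) \<and>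
         (q mod 4 = 1 \<longrightarrow> minimal_curve (q ^ 2) C) \<and>
         (even n \<and> p0 mod 4 = 1 \<longrightarrow> minimal_curve q C) \<and>
         (even n \<and> p0 mod 4 = 3 \<and> f0 mod 4 = 2 \<longrightarrow> maximal_curve q C) \<and>
         (even n \<and> p0 mod 4 = 3 \<and> f0 mod 4 = 0 \<longrightarrow> minimal_curve q C) \<and>
         (odd n \<longrightarrow> \<not> maximal_curve q C \<and> \<not> minimal_curve q C)"
proof -
  obtain a where a: "a \<ge> 1" "p = p0 ^ a" using assms(3) by blast
  have char: "CHAR('k) = p0" using finite_field_char[where ?'k = 'k] assms(1,7,8) by simp
  have p0_gt: "p0 > 1" using assms(1) by (rule prime_gt_1_nat)
  have p_gt: "p > 1" using a p0_gt one_less_power[of p0 a] by simp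
  have odd_p: "odd p" using a assms(2) by simp
  have two: "(2 :: 'k) \<noteq> 0"
  proof
    assume "(2 :: 'k) = 0"
    hence "of_nat 2 = (0 :: 'k)" by simp
    hence "p0 dvd 2" using of_nat_eq_0_iff_char_dvd[where ?'a = 'k, of 2] char by simp
    hence "p0 = 2" using p0_gt dvd_imp_le[of p0 2] by simp
    thus False using assms(2) by simp
  qed
  have coR: "coeff (R_poly p e c) j = (if j = p ^ e then 2 else 0)
      + (\<Sum>i=1..<e. if p ^ i = j then 2 * c i else 0) + (if j = 1 then c 0 else 0)" for j
    by (auto simp: R_poly_def coeff_sum)
  have "degree (R_poly p e c) = p ^ e"
  proof (rule antisym)
    have "coeff (R_poly p e c) j = 0" if j: "j > p ^ e" for j
    proof -
      have "p ^ i \<noteq> j" if "i < e" for i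
        using power_strict_increasing[OF that p_gt] j by simp
      moreover have "j \<noteq> 1" using one_le_power[of p e] p_gt j by linarith
      ultimately show ?thesis using j unfolding coR by (auto intro!: sum.neutral)
    qed
    thus "degree (R_poly p e c) \<le> p ^ e" by (intro degree_le) auto
    have "p ^ i \<noteq> p ^ e" if "i < e" for i
      using power_strict_increasing[OF that p_gt] by simp
    moreover have "p ^ e \<noteq> 1" using one_less_power[OF p_gt, of e] assms(9) by linarith
    ultimately have "coeff (R_poly p e c) (p ^ e) = 2" unfolding coR by (auto intro!: sum.neutral)
    thus "p ^ e \<le> degree (R_poly p e c)" using two by (intro le_degree) simp
  qed
  moreover from this have "R_poly p e c \<noteq> 0" using p_gt by auto
  ultimately have deg: "degree ([:0, 1:] * R_poly p e c) = p ^ e + 1"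
    by (simp add: degree_mult_eq)
  have "p dvd p ^ e" using assms(9) by (simp add: dvd_power)
  hence copr: "coprime p (p ^ e + 1)" by (metis coprime_add_one_right coprime_divisors dvd_refl)
  define N where "N = p ^ e + 1"
  define h where "h = [:0, 1:] * R_poly p e c"
  interpret self_reciprocal_curve p0 p n N h e c
    by unfold_locales (use assms char deg copr odd_p in \<open>auto simp: N_def h_def\<close>)
  have "f = artin_schreier_poly p (R_poly p e c)"
    unfolding f_def unfolding artin_schreier_poly_def h_def ..
  hence C: "C = artin_schreier.C p h" using assms(12) compactification_f by simp
  have q2: "q ^ 2 = p ^ (2 * n)" by (simp add: assms(6) mult.commute flip: power_mult)
  have "p0 ^ (a * n) = p0 ^ f0" using assms(6,7) a by (simp add: power_mult)
  hence f0: "f0 = a * n" using p0_gt by (simp add: power_inject_exp)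
  \<comment> \<open>Over the field of order \<open>q\<close> the parameter \<open>k\<close> is
    \<open>n div 2\<close>, and \<open>p ^ k\<close> is the square root of \<open>q\<close>. For
    \<open>p0 mod 4 = 3\<close> its class mod 4 is governed by the parity of
    \<open>f0 div 2\<close>.\<close>
  have half: "q = p ^ (2 * (n div 2))" "n div 2 > 0" "p ^ (n div 2) = p0 ^ (f0 div 2)" "n dvd 2 * (n div 2)"
    if "even n"
  proof -
    from that obtain k where k: "n = 2 * k" by (elim evenE)
    thus "q = p ^ (2 * (n div 2))" "n div 2 > 0" "n dvd 2 * (n div 2)" using assms(4,6) by auto
    show "p ^ (n div 2) = p0 ^ (f0 div 2)" by (simp add: k f0 a(2) power_mult)
  qed
  have n: "n > 0" "n dvd 2 * n" using assms(4) by auto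
  show ?thesis
    unfolding C
  proof (intro conjI impI)
    assume "q mod 4 = 3"
    thus "maximal_curve (q ^ 2) (artin_schreier.C p h)" unfolding q2 using even_extension(1)[OF n] assms(6) by simp
  next
    assume "q mod 4 = 1"
    thus "minimal_curve (q ^ 2) (artin_schreier.C p h)" unfolding q2 using even_extension(2)[OF n] assms(6) by simp
  next
    assume *: "even n \<and> p0 mod 4 = 1"
    hence ev: "even n" by simp
    have "p ^ (n div 2) mod 4 = 1" unfolding half(3)[OF ev] using * by (intro power_mod_4_eq_1) simp
    thus "minimal_curve q (artin_schreier.C p h)"
      using even_extension(2)[OF half(2,4)[OF ev]] half(1)[OF ev] by simp
  next
    assume *: "even n \<and> p0 mod 4 = 3 \<and> f0 mod 4 = 2"
    hence ev: "even n" by simp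
    have "odd (f0 div 2)" using * by presburger
    hence "p ^ (n div 2) mod 4 = 3" unfolding half(3)[OF ev] using * power_mod_4_odd_exponent by simp
    thus "maximal_curve q (artin_schreier.C p h)"
      using even_extension(1)[OF half(2,4)[OF ev]] half(1)[OF ev] by simp
  next
    assume *: "even n \<and> p0 mod 4 = 3 \<and> f0 mod 4 = 0"
    hence ev: "even n" by simp
    have "even (f0 div 2)" using * by presburger
    hence "p ^ (n div 2) mod 4 = 1" unfolding half(3)[OF ev] using * power_mod_4_odd_exponent by simp
    thus "minimal_curve q (artin_schreier.C p h)"
      using even_extension(2)[OF half(2,4)[OF ev]] half(1)[OF ev] by simp
  next
    assume "odd n"
    thus "\<not> maximal_curve q (artin_schreier.C p h)" "\<not> minimal_curve q (artin_schreier.C p h)"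
      using odd_extension[of n] assms(6) by simp_all
  qed
qed

end
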